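(* Let $\alpha:P\to M$ be a fiber bundle, $\dim M=n$, let $q\ge0$ and let $\omega\in\Omega^q$ be $\delta$-closed, i.e. $\delta\omega=0$. Then: 1) if $q=0$, $\omega$ is locally (on $P$) of the form $\alpha^*(\eta)$ for some (local) $\eta\in\Lambda^{n-1}(M)$; 2) if $q>0$, $\omega$ is locally (on $P$) $\delta$-exact, i.e. locally of the form $\delta\theta$ with $\theta$ a local element of $\Omega^{q-1}$.
   Context: Everything is smooth. $\Lambda_p^k$ is the module of $k$-forms $\omega$ on $P$ with $i_{Y_1}\cdots i_{Y_{k-p+1}}\omega=0$ for all $\alpha$-vertical vector fields $Y_j$ (zero if $k<p$). Affine $q$-forms are identified with differential forms: $\Omega^q:=\Lambda_{n-1}^{q+n-1}$, $q\ge0$, $\Omega=\bigoplus_q\Omega^q$, and $\delta:\Omega\to\Omega$ is the restriction of the de Rham differential. *)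

theory Defs
  imports "HOL-Analysis.Analysis"
begin

section \<open>Smooth maps between open subsets of model spaces\<close>

text \<open>
  Model spaces are finite-dimensional real inner product spaces. The class
  \<^class>\<open>euclidean_space\<close> is not used for them throughout, because it excludes dimension
  \<open>0\<close>, which has to be allowed for the typical fibre of a bundle.
\<close>

primrec Ck_on :: "nat \<Rightarrow> 'a::real_normed_vector set \<Rightarrow> ('a \<Rightarrow> 'b::real_normed_vector) \<Rightarrow> bool" where
  "Ck_on 0 S f \<longleftrightarrow> continuous_on S f"
| "Ck_on (Suc k) S f \<longleftrightarrow>
     (\<forall>x\<in>S. f differentiable (at x)) \<and> (\<forall>v. Ck_on k S (\<lambda>x. frechet_derivative f (at x) v))"

text \<open>Only meant for open \<open>S\<close> in a finite-dimensional space.\<close>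

definition smooth_on :: "'a::real_normed_vector set \<Rightarrow> ('a \<Rightarrow> 'b::real_normed_vector) \<Rightarrow> bool" where
  "smooth_on S f \<longleftrightarrow> (\<forall>k. Ck_on k S f)"


section \<open>Smooth manifolds, smooth maps, fibre bundles\<close>

text \<open>
  A manifold is a Hausdorff second countable type together with a smooth atlas, not required to be
  maximal. A chart is its open domain paired with the coordinate map, whose values outside the
  domain are irrelevant.
\<close>

type_synonym ('p, 'g) chart = "'p set \<times> ('p \<Rightarrow> 'g)"

definition chart_inv :: "('p, 'g) chart \<Rightarrow> 'g \<Rightarrow> 'p" where
  "chart_inv c = inv_into (fst c) (snd c)"

definition chart_img :: "('p, 'g) chart \<Rightarrow> 'p set \<Rightarrow> 'g set" where
  "chart_img c W = snd c ` (fst c \<inter> W)"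

definition coord_rep :: "('p, 'g) chart \<Rightarrow> ('m, 'e) chart \<Rightarrow> ('p \<Rightarrow> 'm) \<Rightarrow> 'g \<Rightarrow> 'e" where
  "coord_rep c d f = snd d \<circ> f \<circ> chart_inv c"

abbreviation coord_deriv ::
    "('p, 'g::real_inner) chart \<Rightarrow> ('m, 'e::real_inner) chart \<Rightarrow> ('p \<Rightarrow> 'm) \<Rightarrow> 'g \<Rightarrow> 'g \<Rightarrow> 'e" where
  "coord_deriv c d f x \<equiv> frechet_derivative (coord_rep c d f) (at x)"

definition smooth_atlas ::
    "('p::{t2_space,second_countable_topology}, 'g::real_inner) chart set \<Rightarrow> bool" where
  "smooth_atlas A \<longleftrightarrow>
     (\<exists>B::'g set. finite B \<and> span B = UNIV) \<and>
     (\<Union>c\<in>A. fst c) = UNIV \<and>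
     (\<forall>c\<in>A. open (fst c) \<and> open (chart_img c UNIV) \<and>
             homeomorphism (fst c) (chart_img c UNIV) (snd c) (chart_inv c)) \<and>
     (\<forall>c\<in>A. \<forall>c'\<in>A. smooth_on (chart_img c (fst c')) (coord_rep c c' id))"

definition prod_atlas ::
    "('m, 'e) chart set \<Rightarrow> ('f, 'h) chart set \<Rightarrow> ('m \<times> 'f, 'e \<times> 'h) chart set" where
  "prod_atlas B C = (\<lambda>(b, c). (fst b \<times> fst c, map_prod (snd b) (snd c))) ` (B \<times> C)"

definition smooth_map_on ::
    "('p::topological_space, 'g::real_inner) chart set \<Rightarrow> ('m::topological_space, 'e::real_inner) chart set
      \<Rightarrow> 'p set \<Rightarrow> ('p \<Rightarrow> 'm) \<Rightarrow> bool" where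
  "smooth_map_on A B W f \<longleftrightarrow> continuous_on W f \<and>
     (\<forall>c\<in>A. \<forall>d\<in>B. smooth_on (chart_img c (W \<inter> f -` fst d)) (coord_rep c d f))"

definition diffeo_betw ::
    "('p::topological_space, 'g::real_inner) chart set \<Rightarrow> ('m::topological_space, 'e::real_inner) chart set
      \<Rightarrow> 'p set \<Rightarrow> 'm set \<Rightarrow> ('p \<Rightarrow> 'm) \<Rightarrow> bool" where
  "diffeo_betw A B W V f \<longleftrightarrow> bij_betw f W V \<and>
     smooth_map_on A B W f \<and> smooth_map_on B A V (inv_into W f)"

text \<open>
  \<open>\<alpha> : P \<rightarrow> M\<close> with typical fibre \<open>F\<close>, the atlases of \<open>P\<close>, \<open>M\<close>, \<open>F\<close> being \<open>A\<close>, \<open>B\<close>, \<open>C\<close>.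
\<close>

definition fiber_bundle ::
    "('p::{t2_space,second_countable_topology}, 'g::real_inner) chart set
      \<Rightarrow> ('m::{t2_space,second_countable_topology}, 'e::real_inner) chart set
      \<Rightarrow> ('f::{t2_space,second_countable_topology}, 'h::real_inner) chart set
      \<Rightarrow> ('p \<Rightarrow> 'm) \<Rightarrow> bool" where
  "fiber_bundle A B C \<alpha> \<longleftrightarrow>
     smooth_atlas A \<and> smooth_atlas B \<and> smooth_atlas C \<and> smooth_map_on A B UNIV \<alpha> \<and>
     (\<forall>x. \<exists>U \<psi>. open U \<and> x \<in> U \<and>
        diffeo_betw A (prod_atlas B C) (\<alpha> -` U) (U \<times> UNIV) \<psi> \<and>
        (\<forall>p\<in>\<alpha> -` U. fst (\<psi> p) = \<alpha> p))"


section \<open>Vector fields and differential forms on open submanifolds\<close>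

text \<open>
  A vector field (or form) on an open set \<open>W\<close> is the family of its coordinate representatives,
  one for each chart of the atlas, related by the transition maps. The representative in the
  chart \<open>c\<close> only matters on \<open>chart_img c W\<close>.
\<close>

type_synonym ('p, 'g) vfield = "('p, 'g) chart \<Rightarrow> 'g \<Rightarrow> 'g"

definition vector_fields ::
    "('p, 'g::real_inner) chart set \<Rightarrow> 'p set \<Rightarrow> ('p, 'g) vfield set" where
  "vector_fields A W = {Y.
     (\<forall>c\<in>A. smooth_on (chart_img c W) (Y c)) \<and>
     (\<forall>c\<in>A. \<forall>c'\<in>A. \<forall>p \<in> fst c \<inter> fst c' \<inter> W.
        Y c' (snd c' p) = coord_deriv c c' id (snd c p) (Y c (snd c p)))}"

definition vertical_fields ::
    "('p, 'g::real_inner) chart set \<Rightarrow> ('m, 'e::real_inner) chart set \<Rightarrow> ('p \<Rightarrow> 'm) \<Rightarrow> 'p set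
      \<Rightarrow> ('p, 'g) vfield set" where
  "vertical_fields A B \<alpha> W = {Y \<in> vector_fields A W.
     \<forall>c\<in>A. \<forall>d\<in>B. \<forall>p \<in> fst c \<inter> W \<inter> \<alpha> -` fst d.
       coord_deriv c d \<alpha> (snd c p) (Y c (snd c p)) = 0}"

text \<open>
  A \<open>k\<close>-form at a point takes the list of its arguments. By convention it vanishes on lists of
  any length other than \<open>k\<close>; with this convention the contraction of a \<open>0\<close>-form is \<open>0\<close>.
\<close>

definition alternating_form :: "nat \<Rightarrow> ('v::real_vector list \<Rightarrow> real) \<Rightarrow> bool" where
  "alternating_form k f \<longleftrightarrow>
     (\<forall>vs. length vs \<noteq> k \<longrightarrow> f vs = 0) \<and>
     (\<forall>vs i. length vs = k \<longrightarrow> i < k \<longrightarrow> linear (\<lambda>u. f (vs[i := u]))) \<and>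
     (\<forall>vs i j. length vs = k \<longrightarrow> i < j \<longrightarrow> j < k \<longrightarrow> vs ! i = vs ! j \<longrightarrow> f vs = 0)"

type_synonym ('p, 'g) form = "('p, 'g) chart \<Rightarrow> 'g \<Rightarrow> 'g list \<Rightarrow> real"

definition diff_forms ::
    "('p, 'g::real_inner) chart set \<Rightarrow> nat \<Rightarrow> 'p set \<Rightarrow> ('p, 'g) form set" where
  "diff_forms A k W = {\<omega>.
     (\<forall>c\<in>A. \<forall>x\<in>chart_img c W. alternating_form k (\<omega> c x)) \<and>
     (\<forall>c\<in>A. \<forall>vs. smooth_on (chart_img c W) (\<lambda>x. \<omega> c x vs)) \<and>
     (\<forall>c\<in>A. \<forall>c'\<in>A. \<forall>p \<in> fst c \<inter> fst c' \<inter> W. \<forall>vs.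
        \<omega> c (snd c p) vs = \<omega> c' (snd c' p) (map (coord_deriv c c' id (snd c p)) vs))}"

definition form_eq_on ::
    "('p, 'g) chart set \<Rightarrow> 'p set \<Rightarrow> ('p, 'g) form \<Rightarrow> ('p, 'g) form \<Rightarrow> bool" where
  "form_eq_on A W \<omega> \<eta> \<longleftrightarrow> (\<forall>c\<in>A. \<forall>x\<in>chart_img c W. \<omega> c x = \<eta> c x)"

definition zero_form :: "('p, 'g) form" where
  "zero_form = (\<lambda>c x vs. 0)"

definition interior_prod :: "('p, 'g) vfield \<Rightarrow> ('p, 'g) form \<Rightarrow> ('p, 'g) form" where
  "interior_prod Y \<omega> = (\<lambda>c x vs. \<omega> c x (Y c x # vs))"

text \<open>
  \<open>d\<omega>(v\<^sub>0, \<dots>, v\<^sub>k) = \<Sum>\<^sub>i (-1)\<^sup>i D\<omega>(v\<^sub>i)(v\<^sub>0, \<dots>, v\<^sub>i\<^sub>-\<^sub>1, v\<^sub>i\<^sub>+\<^sub>1, \<dots>, v\<^sub>k)\<close> in every chart.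
\<close>

definition ext_deriv :: "('p, 'g::real_inner) form \<Rightarrow> ('p, 'g) form" where
  "ext_deriv \<omega> = (\<lambda>c x vs. \<Sum>i<length vs.
     (-1) ^ i * frechet_derivative (\<lambda>y. \<omega> c y (take i vs @ drop (Suc i) vs)) (at x) (vs ! i))"

text \<open>
  The pullback of a form \<open>\<eta>\<close> along \<open>f\<close>; the chart chosen around the image point is immaterial, as
  the representatives of \<open>\<eta>\<close> are compatible.
\<close>

definition form_pullback ::
    "('m, 'e::real_inner) chart set \<Rightarrow> ('p \<Rightarrow> 'm) \<Rightarrow> ('m, 'e) form \<Rightarrow> ('p, 'g::real_inner) form" where
  "form_pullback B f \<eta> = (\<lambda>c x vs.
     let p = chart_inv c x; d = (SOME d. d \<in> B \<and> f p \<in> fst d)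
     in \<eta> d (snd d (f p)) (map (coord_deriv c d f x) vs))"


section \<open>Affine forms\<close>

text \<open>\<open>\<Lambda>\<^sup>k\<^sub>p\<close> of the bundle \<open>\<alpha>\<close> restricted to the open set \<open>W\<close> of its total space.\<close>

definition Lambda_forms ::
    "('p, 'g::real_inner) chart set \<Rightarrow> ('m, 'e::real_inner) chart set \<Rightarrow> ('p \<Rightarrow> 'm)
      \<Rightarrow> nat \<Rightarrow> nat \<Rightarrow> 'p set \<Rightarrow> ('p, 'g) form set" where
  "Lambda_forms A B \<alpha> p k W = {\<omega> \<in> diff_forms A k W.
     if k < p then form_eq_on A W \<omega> zero_form
     else \<forall>Ys. length Ys = k - p + 1 \<longrightarrow> set Ys \<subseteq> vertical_fields A B \<alpha> W \<longrightarrow>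
            form_eq_on A W (foldr interior_prod Ys \<omega>) zero_form}"

definition affine_forms ::
    "('p, 'g::real_inner) chart set \<Rightarrow> ('m, 'e::real_inner) chart set \<Rightarrow> ('p \<Rightarrow> 'm)
      \<Rightarrow> nat \<Rightarrow> nat \<Rightarrow> 'p set \<Rightarrow> ('p, 'g) form set" where
  "affine_forms A B \<alpha> n q W = Lambda_forms A B \<alpha> (n - 1) (q + n - 1) W"

text \<open>The differential \<open>\<delta>\<close> of affine forms is \<^const>\<open>ext_deriv\<close> restricted to \<^const>\<open>affine_forms\<close>.\<close>

end

theory Submission
  imports Defs
begin

text \<open>
  The statement is a Poincare lemma relative to the bundle. Near a point of the total space there are
  coordinates in which \<open>\<alpha>\<close> is a linear projection \<open>\<pi>\<close> (\<open>adapted_coordinates_exist\<close>); let \<open>\<sigma>\<close> be a linear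
  section of it and \<open>P = \<sigma> \<circ> \<pi>\<close>. An affine \<open>q\<close>-form becomes a form \<open>f\<close> of degree \<open>q + n - 1\<close> that
  vanishes when \<open>q + 1\<close> of its arguments lie in the kernel of \<open>\<pi>\<close>.

  For a linear map \<open>P\<close> consider the homotopy \<open>h\<^sub>t = P + t (1 - P)\<close> from \<open>P\<close> to the identity, and let
  \<open>(K\<^sub>P f)(z)(vs)\<close> be the integral over \<open>t\<close> of \<open>f(h\<^sub>t z)(z - P z, h\<^sub>t vs)\<close>. If \<open>f\<close> is closed, then
  \<open>f = d (K\<^sub>P f) + P\<^sup>* f\<close> (\<open>homotopy_formula\<close>). For the projection \<open>P = \<sigma> \<circ> \<pi>\<close> this homotopy contracts
  the fibres, so the inserted vector \<open>z - P z\<close> is vertical. Therefore \<open>K\<^sub>P f\<close> vanishes on \<open>q\<close> vertical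
  vectors, one fewer than \<open>f\<close>. For \<open>q = 0\<close> this means \<open>K\<^sub>P f = 0\<close>, so \<open>f = P\<^sup>* f\<close> comes from the base.
  For \<open>q > 0\<close> the remaining term \<open>P\<^sup>* f\<close> is closed of positive degree, and the contraction to the
  origin, the case of the map \<open>0\<close>, gives \<open>P\<^sup>* f = d (K\<^sub>0 (P\<^sup>* f))\<close>. As \<open>P\<close> kills vertical vectors, this
  second primitive vanishes already on a single vertical vector, and \<open>K\<^sub>P f + K\<^sub>0 (P\<^sup>* f)\<close> is the
  required affine \<open>(q - 1)\<close>-form.

  Two facts connect the coordinates with the manifold. The exterior derivative commutes with pullbacks
  (\<open>exd_pullback\<close>), by the symmetry of second derivatives; so closedness and exactness can be transported
  between coordinates and all charts. And every vertical vector at a point extends to a vertical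
  field on the whole of \<open>P\<close> (\<open>vertical_field_extension\<close>), by means of a bump function; so the
  definition of affine forms, which tests such fields, is a condition on the form at each point.
\<close>

section \<open>Calculus of smooth functions\<close>

lemma Ck_on_subset: "Ck_on k S f \<Longrightarrow> T \<subseteq> S \<Longrightarrow> Ck_on k T f"
  by (induction k arbitrary: f) (auto intro: continuous_on_subset)

lemma frechet_derivative_cong_open:
  assumes "open S" "x \<in> S" "\<And>y. y \<in> S \<Longrightarrow> f y = g y"
  shows "frechet_derivative f (at x) = frechet_derivative g (at x)"
proof -
  have "(f has_derivative f') (at x) \<longleftrightarrow> (g has_derivative f') (at x)" for f'
    using has_derivative_transform_within_open[OF _ assms(1,2), of f f' UNIV g]
      has_derivative_transform_within_open[OF _ assms(1,2), of g f' UNIV f] assms(3) by auto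
  then show ?thesis by (simp add: frechet_derivative_def)
qed

lemma differentiable_cong_open:
  assumes "open S" "x \<in> S" "\<And>y. y \<in> S \<Longrightarrow> f y = g y" "f differentiable (at x)"
  shows "g differentiable (at x)"
  using assms has_derivative_transform_within_open[OF _ assms(1,2), of f _ UNIV g]
  unfolding differentiable_def by blast

lemma Ck_on_cong:
  assumes "open S" "Ck_on k S f" "\<And>x. x \<in> S \<Longrightarrow> f x = g x"
  shows "Ck_on k S g"
  using assms(2,3)
proof (induction k arbitrary: f g)
  case 0
  then show ?case by (auto intro: continuous_on_eq)
next
  case (Suc k)
  have "Ck_on k S (\<lambda>x. frechet_derivative g (at x) v)" for v
    by (rule Suc.IH[of "\<lambda>x. frechet_derivative f (at x) v"])
      (use Suc.prems frechet_derivative_cong_open[OF assms(1), of _ f g] in auto)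
  then show ?case
    using Suc.prems differentiable_cong_open[OF assms(1), of _ f g] by auto
qed

text \<open>
  The closure properties below rest on this rule: it suffices to exhibit a derivative.
  Openness of \<open>S\<close> is what lets a formula for the derivative that holds only on \<open>S\<close> be
  differentiated again.
\<close>

lemma Ck_on_SucI:
  assumes "open S" "\<And>x. x \<in> S \<Longrightarrow> (f has_derivative f' x) (at x)"
    and "\<And>v. Ck_on k S (\<lambda>x. f' x v)"
  shows "Ck_on (Suc k) S f"
proof -
  have "Ck_on k S (\<lambda>x. frechet_derivative f (at x) v)" for v
    by (rule Ck_on_cong[OF assms(1,3)]) (simp add: frechet_derivative_at[OF assms(2), symmetric])
  then show ?thesis using assms(2) by (auto simp: differentiable_def)
qed

lemma Ck_on_has_derivative:
  "Ck_on (Suc k) S f \<Longrightarrow> x \<in> S \<Longrightarrow> (f has_derivative frechet_derivative f (at x)) (at x)"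
  by (simp add: frechet_derivative_works[symmetric])

lemma Ck_on_Suc_imp: "Ck_on (Suc k) S f \<Longrightarrow> Ck_on k S f"
proof (induction k arbitrary: f)
  case 0
  then show ?case
    by (auto intro!: continuous_at_imp_continuous_on dest: differentiable_imp_continuous_within)
next
  case (Suc k)
  then show ?case by (metis Ck_on.simps(2))
qed

lemma Ck_on_const: "open S \<Longrightarrow> Ck_on k S (\<lambda>x. c)"
proof (induction k arbitrary: c)
  case (Suc k)
  show ?case by (rule Ck_on_SucI[where f' = "\<lambda>x v. 0"]) (use Suc in auto)
qed auto

lemma Ck_on_local:
  assumes "\<And>x. x \<in> S \<Longrightarrow> \<exists>T. open T \<and> x \<in> T \<and> Ck_on k T f"
  shows "Ck_on k S f"
  using assms
proof (induction k arbitrary: f)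
  case 0
  show ?case
  proof (simp, rule continuous_at_imp_continuous_on, rule ballI)
    fix x assume "x \<in> S"
    with 0 obtain T where "open T" "x \<in> T" "continuous_on T f" by auto
    then show "isCont f x" by (simp add: continuous_on_eq_continuous_at)
  qed
next
  case (Suc k)
  have "Ck_on k S (\<lambda>x. frechet_derivative f (at x) v)" for v
    by (rule Suc.IH) (use Suc.prems in force)
  moreover have "f differentiable (at x)" if "x \<in> S" for x
    using Suc.prems[OF that] by auto
  ultimately show ?case by simp
qed

lemma Ck_on_bounded_linear:
  assumes "open S" "bounded_linear L" "Ck_on k S f"
  shows "Ck_on k S (\<lambda>x. L (f x))"
  using assms(3)
proof (induction k arbitrary: f)
  case 0
  then show ?case using bounded_linear.continuous_on[OF assms(2)] by auto
next
  case (Suc k)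
  show ?case
    by (rule Ck_on_SucI[OF assms(1), where f' = "\<lambda>x v. L (frechet_derivative f (at x) v)"])
      (use Suc bounded_linear.has_derivative[OF assms(2) Ck_on_has_derivative[OF Suc.prems]] in auto)
qed

text \<open>
  An affine inner map has the same derivative everywhere, so the directions of differentiation stay
  constant and no basis of the intermediate space enters. That space is a product of model spaces when
  a bundle chart is linearised, and the model of the fibre comes without a chosen basis.
\<close>

lemma Ck_on_compose_affine:
  assumes "open S" "open T" "bounded_linear L" "Ck_on k T f" "\<And>x. x \<in> S \<Longrightarrow> c + L x \<in> T"
  shows "Ck_on k S (\<lambda>x. f (c + L x))"
  using assms(4)
proof (induction k arbitrary: f)
  case 0
  show ?case
    using 0 assms(5) bounded_linear.continuous_on[OF assms(3) continuous_on_id, of S]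
    by (auto intro!: continuous_on_compose2[of T f S] continuous_intros)
next
  case (Suc k)
  have L: "((\<lambda>x. c + L x) has_derivative L) (at x)" for x
    using bounded_linear.has_derivative[OF assms(3) has_derivative_ident, of "at x"]
    by (auto intro!: derivative_eq_intros)
  show ?case
  proof (rule Ck_on_SucI[OF assms(1)])
    show "((\<lambda>x. f (c + L x)) has_derivative (\<lambda>v. frechet_derivative f (at (c + L x)) (L v))) (at x)"
      if "x \<in> S" for x
      using has_derivative_compose[OF L Ck_on_has_derivative[OF Suc.prems assms(5)[OF that]]] .
    show "Ck_on k S (\<lambda>x. frechet_derivative f (at (c + L x)) (L v))" for v
      using Suc.prems by (intro Suc.IH[of "\<lambda>y. frechet_derivative f (at y) (L v)"]) auto
  qed
qed

lemma Ck_on_add: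
  assumes "open S" "Ck_on k S f" "Ck_on k S g"
  shows "Ck_on k S (\<lambda>x. f x + g x)"
  using assms(2,3)
proof (induction k arbitrary: f g)
  case 0
  then show ?case by (auto intro: continuous_intros)
next
  case (Suc k)
  show ?case
    by (rule Ck_on_SucI[OF assms(1), where
          f' = "\<lambda>x v. frechet_derivative f (at x) v + frechet_derivative g (at x) v"])
      (use Suc Ck_on_has_derivative[OF Suc.prems(1)] Ck_on_has_derivative[OF Suc.prems(2)]
        in \<open>auto intro: has_derivative_add\<close>)
qed

lemma Ck_on_sum:
  assumes "open S" "\<And>i. i \<in> I \<Longrightarrow> Ck_on k S (f i)"
  shows "Ck_on k S (\<lambda>x. \<Sum>i\<in>I. f i x)"
  using assms(2)
  by (induction I rule: infinite_finite_induct) (auto intro!: Ck_on_const Ck_on_add assms(1))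

lemma Ck_on_scaleR:
  fixes f :: "'a::real_normed_vector \<Rightarrow> real"
  assumes "open S" "Ck_on k S f" "Ck_on k S g"
  shows "Ck_on k S (\<lambda>x. f x *\<^sub>R g x)"
  using assms(2,3)
proof (induction k arbitrary: f g)
  case 0
  then show ?case by (auto intro: continuous_intros)
next
  case (Suc k)
  show ?case
  proof (rule Ck_on_SucI[OF assms(1), where
        f' = "\<lambda>x v. f x *\<^sub>R frechet_derivative g (at x) v + frechet_derivative f (at x) v *\<^sub>R g x"])
    show "((\<lambda>x. f x *\<^sub>R g x) has_derivative
        (\<lambda>v. f x *\<^sub>R frechet_derivative g (at x) v + frechet_derivative f (at x) v *\<^sub>R g x)) (at x)"
      if "x \<in> S" for x
      using Ck_on_has_derivative[OF Suc.prems(1) that] Ck_on_has_derivative[OF Suc.prems(2) that]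
      by (rule has_derivative_scaleR)
    show "Ck_on k S
        (\<lambda>x. f x *\<^sub>R frechet_derivative g (at x) v + frechet_derivative f (at x) v *\<^sub>R g x)" for v
    proof -
      have "Ck_on k S f" "Ck_on k S g" using Suc.prems by (blast intro: Ck_on_Suc_imp)+
      moreover have "Ck_on k S (\<lambda>x. frechet_derivative f (at x) v)"
        "Ck_on k S (\<lambda>x. frechet_derivative g (at x) v)" using Suc.prems by auto
      ultimately show ?thesis by (intro Ck_on_add Suc.IH assms(1))
    qed
  qed
qed

text \<open>
  \<^const>\<open>Ck_on\<close> controls derivatives in constant directions only, whereas the chain rule
  differentiates \<open>g\<close> in the moving direction \<open>Df(x)v\<close>. Expanding this direction in an orthonormal
  basis turns the derivative of \<open>g \<circ> f\<close> into a sum of products of functions that are again \<open>C\<^sup>k\<close>.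
\<close>

lemma Ck_on_compose:
  fixes f :: "'a::real_normed_vector \<Rightarrow> 'b::euclidean_space"
  assumes "open S" "open T" "Ck_on k S f" "Ck_on k T g" "f ` S \<subseteq> T"
  shows "Ck_on k S (\<lambda>x. g (f x))"
  using assms(3,4)
proof (induction k arbitrary: g)
  case 0
  then show ?case using assms(5) by (auto intro: continuous_on_compose2)
next
  case (Suc k)
  have f: "Ck_on k S f" using Ck_on_Suc_imp Suc.prems(1) by blast
  show ?case
  proof (rule Ck_on_SucI[OF assms(1), where f' = "\<lambda>x v. \<Sum>b\<in>Basis.
        (frechet_derivative f (at x) v \<bullet> b) *\<^sub>R frechet_derivative g (at (f x)) b"])
    fix x assume x: "x \<in> S"
    then have g: "(g has_derivative frechet_derivative g (at (f x))) (at (f x))"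
      using assms(5) Ck_on_has_derivative[OF Suc.prems(2)] by blast
    interpret linear "frechet_derivative g (at (f x))"
      using g has_derivative_linear by blast
    have "(\<Sum>b\<in>Basis. (w \<bullet> b) *\<^sub>R frechet_derivative g (at (f x)) b)
        = frechet_derivative g (at (f x)) w" for w
      by (subst (2) euclidean_representation[of w, symmetric]) (simp add: sum scaleR)
    then show "((\<lambda>x. g (f x)) has_derivative (\<lambda>v. \<Sum>b\<in>Basis.
        (frechet_derivative f (at x) v \<bullet> b) *\<^sub>R frechet_derivative g (at (f x)) b)) (at x)"
      using has_derivative_compose[OF Ck_on_has_derivative[OF Suc.prems(1) x] g] by simp
  next
    fix v
    have "Ck_on k S (\<lambda>x. frechet_derivative f (at x) v \<bullet> b)" for b
      using Suc.prems(1) by (auto intro!: Ck_on_bounded_linear[OF assms(1) bounded_linear_inner_left])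
    moreover have "Ck_on k S (\<lambda>x. frechet_derivative g (at (f x)) b)" for b
      using Suc.prems(2) by (intro Suc.IH f) auto
    ultimately show "Ck_on k S (\<lambda>x. \<Sum>b\<in>Basis.
        (frechet_derivative f (at x) v \<bullet> b) *\<^sub>R frechet_derivative g (at (f x)) b)"
      by (intro Ck_on_sum Ck_on_scaleR assms(1))
  qed
qed

lemma smooth_on_subset: "smooth_on S f \<Longrightarrow> T \<subseteq> S \<Longrightarrow> smooth_on T f"
  unfolding smooth_on_def using Ck_on_subset by blast

lemma smooth_on_cong: "smooth_on S f \<Longrightarrow> open S \<Longrightarrow> (\<And>x. x \<in> S \<Longrightarrow> f x = g x) \<Longrightarrow> smooth_on S g"
  unfolding smooth_on_def using Ck_on_cong by blast

lemma smooth_on_local: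
  assumes "\<And>x. x \<in> S \<Longrightarrow> \<exists>T. open T \<and> x \<in> T \<and> smooth_on T f"
  shows "smooth_on S f"
  unfolding smooth_on_def
  by (intro allI Ck_on_local) (use assms in \<open>unfold smooth_on_def, blast\<close>)

lemma smooth_on_const: "open S \<Longrightarrow> smooth_on S (\<lambda>x. c)"
  by (simp add: smooth_on_def Ck_on_const)

lemma smooth_on_bounded_linear:
  "open S \<Longrightarrow> bounded_linear L \<Longrightarrow> smooth_on S f \<Longrightarrow> smooth_on S (\<lambda>x. L (f x))"
  by (simp add: smooth_on_def Ck_on_bounded_linear)

lemma smooth_on_compose_affine:
  assumes "open S" "open T" "bounded_linear L" "smooth_on T f" "\<And>x. x \<in> S \<Longrightarrow> c + L x \<in> T"
  shows "smooth_on S (\<lambda>x. f (c + L x))"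
  using assms unfolding smooth_on_def by (blast intro: Ck_on_compose_affine)

lemma smooth_on_add: "open S \<Longrightarrow> smooth_on S f \<Longrightarrow> smooth_on S g \<Longrightarrow> smooth_on S (\<lambda>x. f x + g x)"
  by (simp add: smooth_on_def Ck_on_add)

lemma smooth_on_sum:
  "open S \<Longrightarrow> (\<And>i. i \<in> I \<Longrightarrow> smooth_on S (f i)) \<Longrightarrow> smooth_on S (\<lambda>x. \<Sum>i\<in>I. f i x)"
  by (simp add: smooth_on_def Ck_on_sum)

lemma smooth_on_scaleR:
  fixes f :: "'a::real_normed_vector \<Rightarrow> real"
  shows "open S \<Longrightarrow> smooth_on S f \<Longrightarrow> smooth_on S g \<Longrightarrow> smooth_on S (\<lambda>x. f x *\<^sub>R g x)"
  by (simp add: smooth_on_def Ck_on_scaleR)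

lemma smooth_on_compose:
  fixes f :: "'a::real_normed_vector \<Rightarrow> 'b::euclidean_space"
  shows "open S \<Longrightarrow> open T \<Longrightarrow> smooth_on S f \<Longrightarrow> smooth_on T g \<Longrightarrow> f ` S \<subseteq> T
    \<Longrightarrow> smooth_on S (\<lambda>x. g (f x))"
  unfolding smooth_on_def by (blast intro: Ck_on_compose)

lemma smooth_on_frechet_derivative:
  "smooth_on S f \<Longrightarrow> smooth_on S (\<lambda>x. frechet_derivative f (at x) v)"
  unfolding smooth_on_def by (metis Ck_on.simps(2))

lemma smooth_on_has_derivative:
  "smooth_on S f \<Longrightarrow> x \<in> S \<Longrightarrow> (f has_derivative frechet_derivative f (at x)) (at x)"
  unfolding smooth_on_def using Ck_on_has_derivative by blast

lemma smooth_on_imp_continuous_on: "smooth_on S f \<Longrightarrow> continuous_on S f"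
  unfolding smooth_on_def by (metis Ck_on.simps(1))

lemma smooth_on_affine:
  fixes L :: "'a::euclidean_space \<Rightarrow> 'b::real_normed_vector"
  assumes "open S" "bounded_linear L"
  shows "smooth_on S (\<lambda>x. c + L x)"
  unfolding smooth_on_def
proof
  fix k
  have L: "((\<lambda>x. c + L x) has_derivative L) (at x)" for x
    using bounded_linear.has_derivative[OF assms(2) has_derivative_ident, of "at x"]
    by (auto intro!: derivative_eq_intros)
  have "Ck_on (Suc k) S (\<lambda>x. c + L x)"
    by (rule Ck_on_SucI[OF assms(1) L Ck_on_const[OF assms(1)]])
  then show "Ck_on k S (\<lambda>x. c + L x)" by (rule Ck_on_Suc_imp)
qed

subsection \<open>Symmetry of second derivatives\<close>

text \<open>
  The second difference over a small parallelogram is symmetric in \<open>v\<close> and \<open>w\<close>, and applying the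
  mean value theorem twice identifies it with one mixed second derivative at an inner point.
  Exchanging \<open>v\<close> and \<open>w\<close> gives the other one; shrinking the parallelogram compares the two.
\<close>

lemma second_difference_mvt:
  fixes f :: "'a::real_normed_vector \<Rightarrow> real"
  assumes "Ck_on 2 S f" "h > 0"
    and sub: "\<And>s t. 0 \<le> s \<Longrightarrow> s \<le> h \<Longrightarrow> 0 \<le> t \<Longrightarrow> t \<le> h \<Longrightarrow> x + s *\<^sub>R v + t *\<^sub>R w \<in> S"
  shows "\<exists>s t. 0 < s \<and> s < h \<and> 0 < t \<and> t < h \<and>
    f (x + h *\<^sub>R v + h *\<^sub>R w) - f (x + h *\<^sub>R v) - f (x + h *\<^sub>R w) + f x
      = h * h * frechet_derivative (\<lambda>y. frechet_derivative f (at y) v) (at (x + s *\<^sub>R v + t *\<^sub>R w)) w"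
proof -
  define D where "D y = frechet_derivative f (at y)" for y
  have D: "(f has_derivative D y) (at y)" if "y \<in> S" for y
    unfolding D_def using assms(1) that by (intro Ck_on_has_derivative[of 1]) (auto simp: numeral_2_eq_2)
  have D2: "((\<lambda>y. D y v) has_derivative frechet_derivative (\<lambda>y. D y v) (at y)) (at y)"
    if "y \<in> S" for y
    unfolding D_def using assms(1) that by (intro Ck_on_has_derivative[of 0]) (auto simp: numeral_2_eq_2)
  have 1: "((\<lambda>s. f (x + s *\<^sub>R v + t *\<^sub>R w)) has_real_derivative D (x + s *\<^sub>R v + t *\<^sub>R w) v) (at s)"
    if "0 \<le> s" "s \<le> h" "0 \<le> t" "t \<le> h" for s t
  proof -
    interpret D: bounded_linear "D (x + s *\<^sub>R v + t *\<^sub>R w)"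
      using D[OF sub[OF that]] by (rule has_derivative_bounded_linear)
    have "((\<lambda>s. x + s *\<^sub>R v + t *\<^sub>R w) has_derivative (\<lambda>r. r *\<^sub>R v)) (at s)"
      by (auto intro!: derivative_eq_intros)
    from has_derivative_compose[OF this D[OF sub[OF that]]]
    show ?thesis by (simp add: has_field_derivative_def D.scaleR mult_commute_abs)
  qed
  have 2: "((\<lambda>t. D (x + s *\<^sub>R v + t *\<^sub>R w) v) has_real_derivative
      frechet_derivative (\<lambda>y. D y v) (at (x + s *\<^sub>R v + t *\<^sub>R w)) w) (at t)"
    if "0 \<le> s" "s \<le> h" "0 \<le> t" "t \<le> h" for s t
  proof -
    interpret D: bounded_linear "frechet_derivative (\<lambda>y. D y v) (at (x + s *\<^sub>R v + t *\<^sub>R w))"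
      using D2[OF sub[OF that]] by (rule has_derivative_bounded_linear)
    have "((\<lambda>t. x + s *\<^sub>R v + t *\<^sub>R w) has_derivative (\<lambda>r. r *\<^sub>R w)) (at t)"
      by (auto intro!: derivative_eq_intros)
    from has_derivative_compose[OF this D2[OF sub[OF that]]]
    show ?thesis by (simp add: has_field_derivative_def D.scaleR mult_commute_abs)
  qed
  define g where "g s = f (x + s *\<^sub>R v + h *\<^sub>R w) - f (x + s *\<^sub>R v + 0 *\<^sub>R w)" for s
  have "\<exists>s>0. s < h \<and> g h - g 0 = (h - 0) *
      (D (x + s *\<^sub>R v + h *\<^sub>R w) v - D (x + s *\<^sub>R v + 0 *\<^sub>R w) v)"
    unfolding g_def using \<open>h > 0\<close> by (intro MVT2 DERIV_diff 1) auto
  then obtain s where s: "0 < s" "s < h" and gs: "g h - g 0 = h *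
      (D (x + s *\<^sub>R v + h *\<^sub>R w) v - D (x + s *\<^sub>R v + 0 *\<^sub>R w) v)" by auto
  have "\<exists>t>0. t < h \<and> D (x + s *\<^sub>R v + h *\<^sub>R w) v - D (x + s *\<^sub>R v + 0 *\<^sub>R w) v =
      (h - 0) * frechet_derivative (\<lambda>y. D y v) (at (x + s *\<^sub>R v + t *\<^sub>R w)) w"
    using \<open>h > 0\<close> s by (intro MVT2 2) auto
  then obtain t where t: "0 < t" "t < h" and gt:
    "D (x + s *\<^sub>R v + h *\<^sub>R w) v - D (x + s *\<^sub>R v + 0 *\<^sub>R w) v =
      h * frechet_derivative (\<lambda>y. D y v) (at (x + s *\<^sub>R v + t *\<^sub>R w)) w" by auto
  have "f (x + h *\<^sub>R v + h *\<^sub>R w) - f (x + h *\<^sub>R v) - f (x + h *\<^sub>R w) + f x = g h - g 0"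
    by (simp add: g_def)
  then show ?thesis using s t gs gt unfolding D_def by (metis mult.assoc)
qed

lemma second_derivative_symmetric_real:
  fixes f :: "'a::real_normed_vector \<Rightarrow> real"
  assumes S: "open S" "x \<in> S" and f: "Ck_on 2 S f"
  shows "frechet_derivative (\<lambda>y. frechet_derivative f (at y) v) (at x) w
    = frechet_derivative (\<lambda>y. frechet_derivative f (at y) w) (at x) v"
proof -
  define G where "G v w y = frechet_derivative (\<lambda>y. frechet_derivative f (at y) v) (at y) w" for v w y
  have cont: "isCont (G v w) x" for v w
  proof -
    have "continuous_on S (G v w)" unfolding G_def using f by (simp add: numeral_2_eq_2)
    then show ?thesis using S by (simp add: continuous_on_eq_continuous_at)
  qed
  have "\<bar>G v w x - G w v x\<bar> \<le> e" if e: "e > 0" for e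
  proof -
    obtain d1 where d1: "d1 > 0" "\<And>y. dist y x < d1 \<Longrightarrow> dist (G v w y) (G v w x) < e / 2"
      using cont[of v w, unfolded continuous_at_eps_delta, rule_format, of "e / 2"] e by auto
    obtain d2 where d2: "d2 > 0" "\<And>y. dist y x < d2 \<Longrightarrow> dist (G w v y) (G w v x) < e / 2"
      using cont[of w v, unfolded continuous_at_eps_delta, rule_format, of "e / 2"] e by auto
    obtain d3 where d3: "d3 > 0" "\<And>y. dist y x < d3 \<Longrightarrow> y \<in> S"
      using S by (meson open_dist)
    define d where "d = min d1 (min d2 d3)"
    define h where "h = d / (2 * (norm v + norm w + 1))"
    have nn: "norm v + norm w + 1 > 0" by (simp add: add_nonneg_pos)
    have h: "h > 0" using d1(1) d2(1) d3(1) nn by (simp add: h_def d_def)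
    have near: "dist (x + s *\<^sub>R v + t *\<^sub>R w) x < d" "dist (x + t *\<^sub>R w + s *\<^sub>R v) x < d"
      if "0 \<le> s" "s \<le> h" "0 \<le> t" "t \<le> h" for s t
    proof -
      have "norm (s *\<^sub>R v + t *\<^sub>R w) \<le> norm (s *\<^sub>R v) + norm (t *\<^sub>R w)" by (rule norm_triangle_ineq)
      also have "\<dots> \<le> h * norm v + h * norm w"
        using that by (auto intro!: add_mono mult_right_mono)
      also have "\<dots> < h * (2 * (norm v + norm w + 1))"
      proof -
        have "h * norm v \<ge> 0" "h * norm w \<ge> 0" using h by auto
        then have "0 < h * norm v + (h * norm w + h * 2)" using h by linarith
        then show ?thesis by (simp add: algebra_simps)
      qed
      also have "\<dots> = d" unfolding h_def using nn by (simp add: field_simps)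
      finally show "dist (x + s *\<^sub>R v + t *\<^sub>R w) x < d" "dist (x + t *\<^sub>R w + s *\<^sub>R v) x < d"
        by (simp_all add: dist_norm algebra_simps)
    qed
    have inS: "x + s *\<^sub>R v + t *\<^sub>R w \<in> S" "x + t *\<^sub>R w + s *\<^sub>R v \<in> S"
      if "0 \<le> s" "s \<le> h" "0 \<le> t" "t \<le> h" for s t
      using near[OF that] d3(2) by (auto simp: d_def)
    obtain s t where st: "0 < s" "s < h" "0 < t" "t < h" and
      1: "f (x + h *\<^sub>R v + h *\<^sub>R w) - f (x + h *\<^sub>R v) - f (x + h *\<^sub>R w) + f x
        = h * h * G v w (x + s *\<^sub>R v + t *\<^sub>R w)"
      using second_difference_mvt[OF f h inS(1)] unfolding G_def by blast
    obtain s' t' where st': "0 < s'" "s' < h" "0 < t'" "t' < h" and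
      2: "f (x + h *\<^sub>R w + h *\<^sub>R v) - f (x + h *\<^sub>R w) - f (x + h *\<^sub>R v) + f x
        = h * h * G w v (x + s' *\<^sub>R w + t' *\<^sub>R v)"
      using second_difference_mvt[OF f h inS(2)] unfolding G_def by blast
    have "h * h * G v w (x + s *\<^sub>R v + t *\<^sub>R w) = h * h * G w v (x + s' *\<^sub>R w + t' *\<^sub>R v)"
      unfolding 1[symmetric] 2[symmetric] by (simp add: add.commute add.left_commute)
    then have "G v w (x + s *\<^sub>R v + t *\<^sub>R w) = G w v (x + s' *\<^sub>R w + t' *\<^sub>R v)" using h by simp
    moreover have "dist (G v w (x + s *\<^sub>R v + t *\<^sub>R w)) (G v w x) < e / 2"
      using near(1)[of s t] st by (intro d1(2)) (auto simp: d_def)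
    moreover have "dist (G w v (x + s' *\<^sub>R w + t' *\<^sub>R v)) (G w v x) < e / 2"
      using near(2)[of t' s'] st' by (intro d2(2)) (auto simp: d_def)
    ultimately show ?thesis unfolding dist_real_def by argo
  qed
  then have "\<bar>G v w x - G w v x\<bar> \<le> 0" by (rule field_le_epsilon) simp
  then show ?thesis by (simp add: G_def)
qed

lemma second_derivative_symmetric:
  fixes f :: "'a::real_normed_vector \<Rightarrow> 'b::real_inner"
  assumes S: "open S" "x \<in> S" and f: "smooth_on S f"
  shows "frechet_derivative (\<lambda>y. frechet_derivative f (at y) v) (at x) w
    = frechet_derivative (\<lambda>y. frechet_derivative f (at y) w) (at x) v"
proof -
  have D: "frechet_derivative (\<lambda>y. g y \<bullet> u) (at y) = (\<lambda>v. frechet_derivative g (at y) v \<bullet> u)"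
    if "smooth_on S g" "y \<in> S" for u y and g :: "'a \<Rightarrow> 'b"
    using has_derivative_inner_left[OF smooth_on_has_derivative[OF that], of u]
    by (rule frechet_derivative_at[symmetric])
  have D2: "frechet_derivative (\<lambda>y. frechet_derivative (\<lambda>y. f y \<bullet> u) (at y) v) (at x)
      = (\<lambda>w. frechet_derivative (\<lambda>y. frechet_derivative f (at y) v) (at x) w \<bullet> u)" for u v
  proof -
    have "frechet_derivative (\<lambda>y. frechet_derivative (\<lambda>y. f y \<bullet> u) (at y) v) (at x)
      = frechet_derivative (\<lambda>y. frechet_derivative f (at y) v \<bullet> u) (at x)"
      by (rule frechet_derivative_cong_open[OF S]) (simp add: D[OF f])
    also have "\<dots> = (\<lambda>w. frechet_derivative (\<lambda>y. frechet_derivative f (at y) v) (at x) w \<bullet> u)"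
      by (rule D[OF smooth_on_frechet_derivative[OF f] S(2)])
    finally show ?thesis .
  qed
  have "smooth_on S (\<lambda>y. f y \<bullet> u)" for u
    by (rule smooth_on_bounded_linear[OF S(1) bounded_linear_inner_left f])
  then have "frechet_derivative (\<lambda>y. frechet_derivative f (at y) v) (at x) w \<bullet> u
      = frechet_derivative (\<lambda>y. frechet_derivative f (at y) w) (at x) v \<bullet> u" for u
    using second_derivative_symmetric_real[OF S, of "\<lambda>y. f y \<bullet> u" v w]
    unfolding smooth_on_def by (simp only: D2)
  then show ?thesis by (metis inner_commute vector_eq_ldot)
qed

subsection \<open>Smooth bump functions\<close>

text \<open>
  The classical flat function \<open>exp (- 1/t)\<close>, extended by zero, is the case \<open>n = 0\<close>. With the extra power of
  \<open>1/t\<close> the family becomes closed under differentiation up to linear combinations, so that smoothness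
  of all members follows by one induction.
\<close>

definition flat_exp :: "nat \<Rightarrow> real \<Rightarrow> real" where
  "flat_exp n t = (if t > 0 then inverse t ^ n * exp (- inverse t) else 0)"

lemma flat_exp_tendsto_0: "((flat_exp n) \<longlongrightarrow> 0) (at 0)"
proof -
  have "((\<lambda>t. t ^ n * exp (- t)) \<longlongrightarrow> (0::real)) at_top"
    using tendsto_power_div_exp_0[of n] by (simp add: exp_minus field_simps)
  then have "((\<lambda>t. inverse t ^ n * exp (- inverse t)) \<longlongrightarrow> (0::real)) (at_right 0)"
    by (rule filterlim_compose[OF _ filterlim_inverse_at_top_right])
  then have "((flat_exp n) \<longlongrightarrow> 0) (at_right 0)"
    by (rule Lim_transform_eventually) (auto simp: flat_exp_def eventually_at_filter)
  moreover have "((flat_exp n) \<longlongrightarrow> 0) (at_left 0)"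
    by (rule tendsto_eventually) (auto simp: flat_exp_def eventually_at_filter)
  ultimately show ?thesis by (rule filterlim_split_at[rotated])
qed

lemma flat_exp_has_derivative:
  "(flat_exp n has_real_derivative - real n * flat_exp (Suc n) t + flat_exp (n + 2) t) (at t)"
proof -
  consider "t > 0" | "t < 0" | "t = 0" by linarith
  then show ?thesis
  proof cases
    case 1
    have "((\<lambda>t. inverse t ^ n * exp (- inverse t)) has_real_derivative
        inverse t ^ n * (exp (- inverse t) * (inverse t * inverse t))
        + real n * inverse t ^ (n - 1) * (- (inverse t * inverse t)) * exp (- inverse t)) (at t)"
      using 1 by (auto intro!: derivative_eq_intros)
    also have "inverse t ^ n * (exp (- inverse t) * (inverse t * inverse t))
        + real n * inverse t ^ (n - 1) * (- (inverse t * inverse t)) * exp (- inverse t)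
        = - real n * flat_exp (Suc n) t + flat_exp (n + 2) t"
      using 1 by (cases n) (simp_all add: flat_exp_def algebra_simps)
    finally have "((\<lambda>t. inverse t ^ n * exp (- inverse t)) has_real_derivative
        - real n * flat_exp (Suc n) t + flat_exp (n + 2) t) (at t)" .
    then show ?thesis
      by (rule has_field_derivative_transform_within_open[where S = "{0<..}"]) (use 1 in \<open>auto simp: flat_exp_def\<close>)
  next
    case 2
    have "((\<lambda>t. 0) has_real_derivative - real n * flat_exp (Suc n) t + flat_exp (n + 2) t) (at t)"
      using 2 by (auto simp: flat_exp_def)
    then show ?thesis
      by (rule has_field_derivative_transform_within_open[where S = "{..<0}"]) (use 2 in \<open>auto simp: flat_exp_def\<close>)
  next
    case 3
    have "(\<lambda>t. (flat_exp n t - flat_exp n 0) / (t - 0)) = flat_exp (Suc n)"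
      by (auto simp: flat_exp_def field_simps)
    then show ?thesis
      using flat_exp_tendsto_0[of "Suc n"] 3 by (simp add: has_field_derivative_iff flat_exp_def)
  qed
qed

lemma smooth_on_flat_exp: "smooth_on UNIV (flat_exp n)"
  unfolding smooth_on_def
proof
  fix k show "Ck_on k UNIV (flat_exp n)"
  proof (induction k arbitrary: n)
    case 0
    then show ?case using flat_exp_has_derivative[of n]
      by (auto intro!: continuous_at_imp_continuous_on DERIV_isCont)
  next
    case (Suc k)
    show ?case
    proof (rule Ck_on_SucI[where f' = "\<lambda>t v. (- real n * v) *\<^sub>R flat_exp (Suc n) t
          + v *\<^sub>R flat_exp (n + 2) t"])
      show "(flat_exp n has_derivative (\<lambda>v. (- real n * v) *\<^sub>R flat_exp (Suc n) t
          + v *\<^sub>R flat_exp (n + 2) t)) (at t)" for t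
        using flat_exp_has_derivative[of n t]
        unfolding has_field_derivative_def
        by (rule has_derivative_eq_rhs) (auto simp: algebra_simps)
      show "Ck_on k UNIV (\<lambda>t. (- real n * v) *\<^sub>R flat_exp (Suc n) t + v *\<^sub>R flat_exp (n + 2) t)" for v
        by (intro Ck_on_add Ck_on_scaleR Ck_on_const Suc.IH) auto
    qed auto
  qed
qed

text \<open>
  Vector fields at \<open>x0\<close> are extended by multiplying with \<open>\<beta>\<close>, and dividing by
  the value at the centre afterwards leaves the vector at that point
  unchanged. The function is \<open>flat_exp 0\<close> of \<open>r\<^sup>2 - |x - x0|\<^sup>2\<close>.
\<close>

lemma smooth_bump_exists:
  fixes x0 :: "'a::euclidean_space"
  assumes "r > 0"
  obtains \<beta> :: "'a \<Rightarrow> real" where "smooth_on UNIV \<beta>" "\<beta> x0 \<noteq> 0" "\<And>x. x \<notin> ball x0 r \<Longrightarrow> \<beta> x = 0"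
proof
  let ?q = "\<lambda>x. r\<^sup>2 + - ((x - x0) \<bullet> (x - x0))"
  have "Ck_on (Suc k) UNIV ?q" for k
  proof (rule Ck_on_SucI)
    show "(?q has_derivative (\<lambda>v. - 2 * ((x - x0) \<bullet> v))) (at x)" for x
      by (auto intro!: derivative_eq_intros simp: inner_commute)
    have "bounded_linear (\<lambda>x. - 2 * (x \<bullet> v))" for v :: 'a
      using bounded_linear_mult_right bounded_linear_inner_left by (rule bounded_linear_compose)
    from smooth_on_affine[OF open_UNIV this, of "2 * (x0 \<bullet> _)"]
    show "Ck_on k UNIV (\<lambda>x. - 2 * ((x - x0) \<bullet> v))" for v
      unfolding smooth_on_def by (simp add: algebra_simps inner_diff_left)
  qed auto
  then have q: "smooth_on UNIV ?q" unfolding smooth_on_def using Ck_on_Suc_imp by blast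
  show "smooth_on UNIV (\<lambda>x. flat_exp 0 (?q x))"
    by (rule smooth_on_compose[OF open_UNIV open_UNIV q smooth_on_flat_exp]) auto
  show "flat_exp 0 (?q x0) \<noteq> 0" using assms by (simp add: flat_exp_def)
  show "flat_exp 0 (?q x) = 0" if "x \<notin> ball x0 r" for x
  proof -
    have "r \<le> norm (x - x0)" using that by (simp add: dist_norm norm_minus_commute)
    then have "r\<^sup>2 \<le> (norm (x - x0))\<^sup>2" using assms by (intro power_mono) auto
    then show ?thesis by (simp add: flat_exp_def power2_norm_eq_inner)
  qed
qed

section \<open>Differential forms on open subsets of a vector space\<close>

subsection \<open>Alternating multilinear functions of lists\<close>

abbreviation omit :: "nat \<Rightarrow> 'a list \<Rightarrow> 'a list" where
  "omit i vs \<equiv> take i vs @ drop (Suc i) vs"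

lemma omit_omit:
  assumes "i \<le> j" "Suc j < length vs"
  shows "omit j (omit i vs) = omit i (omit (Suc j) vs)"
  by (rule nth_equalityI) (use assms in \<open>auto simp: nth_append min_def\<close>)

lemma map_omit: "omit i (map A vs) = map A (omit i vs)"
  by (simp add: take_map drop_map)

definition multilinear :: "nat \<Rightarrow> ('v::real_vector list \<Rightarrow> real) \<Rightarrow> bool" where
  "multilinear k F \<longleftrightarrow> (\<forall>vs i. length vs = k \<longrightarrow> i < k \<longrightarrow> linear (\<lambda>u. F (vs[i := u])))"

lemma alternating_form_multilinear: "alternating_form k F \<Longrightarrow> multilinear k F"
  unfolding alternating_form_def multilinear_def by blast

lemma alternating_form_wrong_length: "alternating_form k F \<Longrightarrow> length vs \<noteq> k \<Longrightarrow> F vs = 0"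
  unfolding alternating_form_def by blast

lemma alternating_form_linear:
  "alternating_form k F \<Longrightarrow> length vs = k \<Longrightarrow> i < k \<Longrightarrow> linear (\<lambda>u. F (vs[i := u]))"
  unfolding alternating_form_def by blast

lemma alternating_form_repeat:
  "alternating_form k F \<Longrightarrow> length vs = k \<Longrightarrow> i < j \<Longrightarrow> j < k \<Longrightarrow> vs ! i = vs ! j \<Longrightarrow> F vs = 0"
  unfolding alternating_form_def by blast

lemma multilinear_linear_head:
  "multilinear (Suc k) F \<Longrightarrow> length vs = k \<Longrightarrow> linear (\<lambda>u. F (u # vs))"
  unfolding multilinear_def by (drule spec[of _ "0 # vs"], drule spec[of _ 0]) simp

lemma multilinear_Cons:
  assumes "multilinear (Suc k) F"
  shows "multilinear k (\<lambda>vs. F (u # vs))"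
  unfolding multilinear_def
proof (intro allI impI)
  fix vs :: "'a list" and i assume "length vs = k" "i < k"
  then have "linear (\<lambda>w. F ((u # vs)[Suc i := w]))"
    using assms[unfolded multilinear_def, rule_format, of "u # vs" "Suc i"] by simp
  then show "linear (\<lambda>w. F (u # vs[i := w]))" by simp
qed

text \<open>
  Multilinear functions of lists have no product structure to differentiate. Expanding the first
  argument in the basis reduces them to sums of products with a function of one argument less, which
  is how the inductions for \<open>multilinear_has_derivative\<close> and \<open>multilinear_smooth\<close> proceed.
\<close>

lemma multilinear_expand:
  fixes F :: "'v::euclidean_space list \<Rightarrow> real"
  assumes "multilinear (Suc k) F" "length vs = k"
  shows "F (v # vs) = (\<Sum>b\<in>Basis. (v \<bullet> b) *\<^sub>R F (b # vs))"
proof -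
  have lin: "linear (\<lambda>u. F (u # vs))" by (rule multilinear_linear_head[OF assms])
  have "F (v # vs) = (\<lambda>u. F (u # vs)) (\<Sum>b\<in>Basis. (v \<bullet> b) *\<^sub>R b)"
    by (simp add: euclidean_representation)
  also have "\<dots> = (\<Sum>b\<in>Basis. (\<lambda>u. F (u # vs)) ((v \<bullet> b) *\<^sub>R b))"
    by (rule linear_sum[OF lin])
  finally show ?thesis by (simp add: linear_scale[OF lin])
qed

lemma alternating_form_zero_vector:
  assumes F: "alternating_form k F" and "0 \<in> set vs"
  shows "F vs = 0"
proof (cases "length vs = k")
  case True
  obtain i where i: "i < length vs" "vs ! i = 0" using assms(2) by (auto simp: in_set_conv_nth)
  then show ?thesis
    using linear_0[OF alternating_form_linear[OF F True, of i]] True by (metis list_update_id)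
qed (use alternating_form_wrong_length[OF F] in auto)

lemma alternating_form_swap:
  assumes F: "alternating_form k F" and len: "length (xs @ a # b # ys) = k"
  shows "F (xs @ a # b # ys) = - F (xs @ b # a # ys)"
proof -
  let ?n = "length xs"
  note lin = alternating_form_linear[OF F]
  have lin1: "linear (\<lambda>u. F (xs @ u # w # ys))" for w
    using lin[of "xs @ a # w # ys" ?n] len by simp
  have lin2: "linear (\<lambda>u. F (xs @ w # u # ys))" for w
    using lin[of "xs @ w # b # ys" "Suc ?n"] len by (simp add: list_update_append)
  have z: "F (xs @ u # u # ys) = 0" for u
    using alternating_form_repeat[OF F, of "xs @ u # u # ys" ?n "Suc ?n"] len
    by (simp add: nth_append)
  have "0 = F (xs @ (a + b) # (a + b) # ys)" by (simp add: z)
  also have "\<dots> = F (xs @ a # b # ys) + F (xs @ b # a # ys)"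
    by (simp only: linear_add[OF lin1] linear_add[OF lin2]) (simp add: z)
  finally show ?thesis by linarith
qed

lemma alternating_form_to_front:
  assumes F: "alternating_form k F"
  shows "length (xs @ s # ys) = k \<Longrightarrow> F (xs @ s # ys) = (- 1) ^ length xs * F (s # xs @ ys)"
proof (induction xs arbitrary: ys rule: rev_induct)
  case (snoc a xs)
  have "F ((xs @ [a]) @ s # ys) = - F (xs @ s # a # ys)"
    using alternating_form_swap[OF F, of xs a s ys] snoc.prems by simp
  also have "F (xs @ s # a # ys) = (- 1) ^ length xs * F (s # xs @ a # ys)"
    using snoc.IH[of "a # ys"] snoc.prems by simp
  finally show ?case by simp
qed simp

lemma alternating_form_update:
  assumes "alternating_form k F" "length us = k" "j < k"
  shows "F (us[j := w]) = (- 1) ^ j * F (w # omit j us)"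
  using alternating_form_to_front[OF assms(1), of "take j us" w "drop (Suc j) us"] assms(2,3)
  by (simp add: upd_conv_take_nth_drop min_def)

lemma alternating_form_map:
  assumes F: "alternating_form k F" and A: "linear A"
  shows "alternating_form k (\<lambda>vs. F (map A vs))"
  unfolding alternating_form_def
proof (intro conjI allI impI)
  show "F (map A vs) = 0" if "length vs \<noteq> k" for vs
    using alternating_form_wrong_length[OF F, of "map A vs"] that by simp
  show "linear (\<lambda>u. F (map A (vs[i := u])))" if "length vs = k" "i < k" for vs i
    using linear_compose[OF A alternating_form_linear[OF F, of "map A vs" i]] that
    by (simp add: map_update o_def)
  show "F (map A vs) = 0" if "length vs = k" "i < j" "j < k" "vs ! i = vs ! j" for vs i j
    using alternating_form_repeat[OF F, of "map A vs" i j] that by simp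
qed

text \<open>
  This cancellation is the algebraic reason why the exterior derivative commutes with pullbacks:
  for \<open>H\<close> the second derivative of the map, the sum collects the terms in which a pulled back vector
  is differentiated. Moving \<open>H\<close> to the front leaves it followed by the list with two vectors omitted;
  each such pair of vectors arises twice, in either order, with opposite signs.
\<close>

lemma alternating_form_symmetric_cancel:
  assumes F: "alternating_form k F" and len: "length us = Suc k" "length vs = Suc k"
    and H: "\<And>u v. H u v = H v u"
  shows "(\<Sum>i<Suc k. \<Sum>j<k. (- 1) ^ i * F ((omit i us)[j := H (vs ! i) (omit i vs ! j)])) = 0"
proof -
  define G where
    "G = (\<lambda>(i, j). (- 1) ^ (i + j) * F (H (vs ! i) (omit i vs ! j) # omit j (omit i us)))"
  let ?U = "{(i, j). i \<le> j \<and> j < k}" and ?L = "{(i, j). j < i \<and> i < Suc k}"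
  have fin: "finite ?U" "finite ?L"
    by (rule finite_subset[of _ "{..k} \<times> {..k}"], auto)+
  have "(\<Sum>i<Suc k. \<Sum>j<k. (- 1) ^ i * F ((omit i us)[j := H (vs ! i) (omit i vs ! j)]))
      = (\<Sum>i<Suc k. \<Sum>j<k. G (i, j))"
  proof (intro sum.cong refl)
    fix i j assume ij: "i \<in> {..<Suc k}" "j \<in> {..<k}"
    then have "length (omit i us) = k" using len by simp
    then show "(- 1) ^ i * F ((omit i us)[j := H (vs ! i) (omit i vs ! j)]) = G (i, j)"
      using alternating_form_update[OF F, of "omit i us" j "H (vs ! i) (omit i vs ! j)"] ij
      by (simp add: G_def power_add)
  qed
  also have "\<dots> = sum G ({..<Suc k} \<times> {..<k})"
    by (simp add: sum.cartesian_product)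
  also have "{..<Suc k} \<times> {..<k} = ?U \<union> ?L" by auto
  also have "sum G (?U \<union> ?L) = sum G ?U + sum G ?L"
    by (rule sum.union_disjoint[OF fin]) auto
  also have "sum G ?L = (\<Sum>p\<in>?U. - G p)"
  \<comment> \<open>For \<open>j < i\<close>, omitting entry \<open>i\<close> and then entry \<open>j\<close> is the same as omitting entry \<open>j\<close> and
    then entry \<open>i - 1\<close>.\<close>
  proof (rule sum.reindex_bij_witness[where i = "\<lambda>(i, j). (Suc j, i)" and j = "\<lambda>(i, j). (j, i - 1)"])
    fix p assume p: "p \<in> ?L"
    then obtain i j where pj: "p = (Suc i, j)" and j: "j \<le> i" "i < k"
      by (cases p; cases "fst p") auto
    have "H (vs ! Suc i) (omit (Suc i) vs ! j) = H (vs ! j) (omit j vs ! i)"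
      using j len by (subst H) (simp add: nth_append min_def)
    moreover have "omit j (omit (Suc i) us) = omit i (omit j us)"
      using omit_omit[of j i us] j len by simp
    ultimately show "- G (case p of (i, j) \<Rightarrow> (j, i - 1)) = G p"
      by (simp add: G_def pj add.commute)
  qed auto
  also have "sum G ?U + (\<Sum>p\<in>?U. - G p) = 0" by (simp add: sum_negf)
  finally show ?thesis .
qed


subsection \<open>Differentiating a form along moving points and vectors\<close>

text \<open>
  The product rule for a form evaluated at a moving point on moving vectors: one term for the point
  and one for each vector. As the form is multilinear on a neighbourhood of \<open>\<gamma> x\<close>, the basis expansion
  in the induction step is an equality of functions near \<open>x\<close> and can be differentiated.
\<close>

lemma multilinear_has_derivative:
  fixes f :: "'c::real_normed_vector \<Rightarrow> 'b::euclidean_space list \<Rightarrow> real"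
    and \<gamma> :: "'a::real_normed_vector \<Rightarrow> 'c"
  assumes T: "open T" "\<gamma> x \<in> T" and \<gamma>: "(\<gamma> has_derivative \<gamma>') (at x)"
    and "\<And>y. y \<in> T \<Longrightarrow> multilinear (length ws) (f y)"
    and "\<And>vs. (\<lambda>y. f y vs) differentiable (at (\<gamma> x))"
    and "list_all2 (\<lambda>w w'. (w has_derivative w') (at x)) ws ws'"
  shows "((\<lambda>s. f (\<gamma> s) (map (\<lambda>w. w s) ws)) has_derivative
     (\<lambda>h. frechet_derivative (\<lambda>y. f y (map (\<lambda>w. w x) ws)) (at (\<gamma> x)) (\<gamma>' h) +
       (\<Sum>i<length ws. f (\<gamma> x) ((map (\<lambda>w. w x) ws)[i := (ws' ! i) h])))) (at x)"
  using assms(6,4,5)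
proof (induction ws ws' arbitrary: f rule: list_all2_induct)
  case Nil
  show ?case
    using has_derivative_compose[OF \<gamma>, of "\<lambda>y. f y []"] Nil.prems(2)[of "[]"]
    by (simp add: frechet_derivative_works[symmetric])
next
  case (Cons w ws w' ws')
  let ?us = "map (\<lambda>w. w x) ws"
  have near: "\<forall>\<^sub>F s in nhds x. \<gamma> s \<in> T"
    using topological_tendstoD[OF has_derivative_continuous[OF \<gamma>, unfolded continuous_at] T]
      T(2) by (auto simp: eventually_at_filter elim: eventually_mono)
  have d: "((\<lambda>s. f (\<gamma> s) (b # map (\<lambda>w. w s) ws)) has_derivative
     (\<lambda>h. frechet_derivative (\<lambda>y. f y (b # ?us)) (at (\<gamma> x)) (\<gamma>' h) +
       (\<Sum>i<length ws. f (\<gamma> x) (b # ?us[i := (ws' ! i) h])))) (at x)" for b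
    using Cons.prems by (intro Cons.IH[of "\<lambda>y vs. f y (b # vs)"] multilinear_Cons) auto
  have "((\<lambda>s. \<Sum>b\<in>Basis. (w s \<bullet> b) *\<^sub>R f (\<gamma> s) (b # map (\<lambda>w. w s) ws)) has_derivative
     (\<lambda>h. \<Sum>b\<in>Basis. (w x \<bullet> b) *\<^sub>R (frechet_derivative (\<lambda>y. f y (b # ?us)) (at (\<gamma> x)) (\<gamma>' h) +
         (\<Sum>i<length ws. f (\<gamma> x) (b # ?us[i := (ws' ! i) h])))
       + (w' h \<bullet> b) *\<^sub>R f (\<gamma> x) (b # ?us))) (at x)"
    using Cons.hyps d by (intro has_derivative_sum has_derivative_scaleR has_derivative_inner_left) auto
  also have "(\<lambda>h. \<Sum>b\<in>Basis. (w x \<bullet> b) *\<^sub>R (frechet_derivative (\<lambda>y. f y (b # ?us)) (at (\<gamma> x)) (\<gamma>' h) +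
         (\<Sum>i<length ws. f (\<gamma> x) (b # ?us[i := (ws' ! i) h])))
       + (w' h \<bullet> b) *\<^sub>R f (\<gamma> x) (b # ?us))
    = (\<lambda>h. frechet_derivative (\<lambda>y. f y (w x # ?us)) (at (\<gamma> x)) (\<gamma>' h) +
       (\<Sum>i<Suc (length ws). f (\<gamma> x) ((w x # ?us)[i := ((w' # ws') ! i) h])))"
  proof
    fix h
    have e: "f y (v # vs) = (\<Sum>b\<in>Basis. (v \<bullet> b) *\<^sub>R f y (b # vs))"
      if "y \<in> T" "length vs = length ws" for y v vs
      using Cons.prems(1)[OF that(1)] that(2) by (intro multilinear_expand) auto
    have "((\<lambda>y. \<Sum>b\<in>Basis. (w x \<bullet> b) *\<^sub>R f y (b # ?us)) has_derivative
      (\<lambda>u. \<Sum>b\<in>Basis. (w x \<bullet> b) *\<^sub>R frechet_derivative (\<lambda>y. f y (b # ?us)) (at (\<gamma> x)) u)) (at (\<gamma> x))"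
      using Cons.prems(2)
      by (intro has_derivative_sum has_derivative_scaleR_right) (simp add: frechet_derivative_works[symmetric])
    then have "((\<lambda>y. f y (w x # ?us)) has_derivative
      (\<lambda>u. \<Sum>b\<in>Basis. (w x \<bullet> b) *\<^sub>R frechet_derivative (\<lambda>y. f y (b # ?us)) (at (\<gamma> x)) u)) (at (\<gamma> x))"
      by (rule has_derivative_transform_within_open[OF _ T]) (subst e[of _ _ "w x"], auto)
    from frechet_derivative_at[OF this]
    have 1: "(\<Sum>b\<in>Basis. (w x \<bullet> b) *\<^sub>R frechet_derivative (\<lambda>y. f y (b # ?us)) (at (\<gamma> x)) (\<gamma>' h))
      = frechet_derivative (\<lambda>y. f y (w x # ?us)) (at (\<gamma> x)) (\<gamma>' h)" by (rule fun_cong)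
    have 2: "(\<Sum>b\<in>Basis. (w x \<bullet> b) *\<^sub>R (\<Sum>i<length ws. f (\<gamma> x) (b # ?us[i := (ws' ! i) h])))
      = (\<Sum>i<length ws. f (\<gamma> x) (w x # ?us[i := (ws' ! i) h]))"
      by (subst e[OF T(2), of _ "w x"]) (auto simp: sum_distrib_left intro!: sum.swap)
    have 3: "(\<Sum>b\<in>Basis. (w' h \<bullet> b) *\<^sub>R f (\<gamma> x) (b # ?us)) = f (\<gamma> x) (w' h # ?us)"
      by (subst e[OF T(2), of _ "w' h"]) auto
    show "(\<Sum>b\<in>Basis. (w x \<bullet> b) *\<^sub>R (frechet_derivative (\<lambda>y. f y (b # ?us)) (at (\<gamma> x)) (\<gamma>' h) +
         (\<Sum>i<length ws. f (\<gamma> x) (b # ?us[i := (ws' ! i) h])))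
       + (w' h \<bullet> b) *\<^sub>R f (\<gamma> x) (b # ?us))
    = frechet_derivative (\<lambda>y. f y (w x # ?us)) (at (\<gamma> x)) (\<gamma>' h) +
       (\<Sum>i<Suc (length ws). f (\<gamma> x) ((w x # ?us)[i := ((w' # ws') ! i) h]))"
      unfolding sum.distrib scaleR_add_right 1 2 3 sum.lessThan_Suc_shift by simp
  qed
  finally have main: "((\<lambda>s. \<Sum>b\<in>Basis. (w s \<bullet> b) *\<^sub>R f (\<gamma> s) (b # map (\<lambda>w. w s) ws)) has_derivative
     (\<lambda>h. frechet_derivative (\<lambda>y. f y (w x # ?us)) (at (\<gamma> x)) (\<gamma>' h) +
       (\<Sum>i<Suc (length ws). f (\<gamma> x) ((w x # ?us)[i := ((w' # ws') ! i) h])))) (at x)" .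
  have eq: "(\<Sum>b\<in>Basis. (w s \<bullet> b) *\<^sub>R f (\<gamma> s) (b # map (\<lambda>w. w s) ws))
      = f (\<gamma> s) (map (\<lambda>w. w s) (w # ws))" if "\<gamma> s \<in> T" for s
    using multilinear_expand[of "length ws" "f (\<gamma> s)" "map (\<lambda>w. w s) ws" "w s"]
      Cons.prems(1)[OF that] by simp
  have "((\<lambda>s. f (\<gamma> s) (map (\<lambda>w. w s) (w # ws))) has_derivative
     (\<lambda>h. frechet_derivative (\<lambda>y. f y (w x # ?us)) (at (\<gamma> x)) (\<gamma>' h) +
       (\<Sum>i<Suc (length ws). f (\<gamma> x) ((w x # ?us)[i := ((w' # ws') ! i) h])))) (at x)"
  proof (rule has_derivative_transform_eventually[OF main])
    have "\<forall>\<^sub>F s in at x. \<gamma> s \<in> T"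
      using near unfolding eventually_at_filter by (rule eventually_mono) simp
    then show "\<forall>\<^sub>F s in at x. (\<Sum>b\<in>Basis. (w s \<bullet> b) *\<^sub>R f (\<gamma> s) (b # map (\<lambda>w. w s) ws))
        = f (\<gamma> s) (map (\<lambda>w. w s) (w # ws))"
      by (rule eventually_mono) (rule eq)
  qed (use eq T(2) in auto)
  then show ?case by simp
qed

lemma multilinear_smooth:
  fixes f :: "'c::euclidean_space \<Rightarrow> 'b::euclidean_space list \<Rightarrow> real"
    and \<gamma> :: "'a::real_normed_vector \<Rightarrow> 'c"
  assumes S: "open S" and T: "open T" "\<gamma> ` S \<subseteq> T" and \<gamma>: "smooth_on S \<gamma>"
    and "\<And>y. y \<in> T \<Longrightarrow> multilinear (length ws) (f y)"
    and "\<And>vs. smooth_on T (\<lambda>y. f y vs)"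
    and "\<And>w. w \<in> set ws \<Longrightarrow> smooth_on S w"
  shows "smooth_on S (\<lambda>s. f (\<gamma> s) (map (\<lambda>w. w s) ws))"
  using assms(5-7)
proof (induction ws arbitrary: f)
  case Nil
  show ?case using smooth_on_compose[OF S T(1) \<gamma> Nil.prems(2)[of "[]"] T(2)] by simp
next
  case (Cons w ws)
  have "smooth_on S (\<lambda>s. f (\<gamma> s) (b # map (\<lambda>w. w s) ws))" for b
    using Cons.prems by (intro Cons.IH[of "\<lambda>y vs. f y (b # vs)"] multilinear_Cons) auto
  moreover have "smooth_on S (\<lambda>s. w s \<bullet> b)" for b
    using Cons.prems(3) by (intro smooth_on_bounded_linear[OF S bounded_linear_inner_left]) auto
  ultimately have "smooth_on S (\<lambda>s. \<Sum>b\<in>Basis. (w s \<bullet> b) *\<^sub>R f (\<gamma> s) (b # map (\<lambda>w. w s) ws))"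
    by (intro smooth_on_sum smooth_on_scaleR S)
  moreover have "(\<Sum>b\<in>Basis. (w s \<bullet> b) *\<^sub>R f (\<gamma> s) (b # map (\<lambda>w. w s) ws))
      = f (\<gamma> s) (w s # map (\<lambda>w. w s) ws)" if "s \<in> S" for s
    using Cons.prems(1)[of "\<gamma> s"] T(2) that by (intro multilinear_expand[symmetric]) auto
  ultimately show ?case using S by (auto elim: smooth_on_cong)
qed


subsection \<open>Forms, their differential and pullback\<close>

definition form_on ::
    "nat \<Rightarrow> 'a::real_normed_vector set \<Rightarrow> ('a \<Rightarrow> 'b::real_vector list \<Rightarrow> real) \<Rightarrow> bool" where
  "form_on k S f \<longleftrightarrow> (\<forall>x\<in>S. alternating_form k (f x)) \<and> (\<forall>vs. smooth_on S (\<lambda>x. f x vs))"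

text \<open>
  \<^const>\<open>ext_deriv\<close> applies this operator chart by chart. Having it separately allows it to be used on
  the model spaces and commuted with changes of coordinates.
\<close>

definition exd ::
    "('a::real_normed_vector \<Rightarrow> 'a list \<Rightarrow> real) \<Rightarrow> 'a \<Rightarrow> 'a list \<Rightarrow> real" where
  "exd f x vs =
     (\<Sum>i<length vs. (- 1) ^ i * frechet_derivative (\<lambda>y. f y (omit i vs)) (at x) (vs ! i))"

definition pullback ::
    "('a::real_normed_vector \<Rightarrow> 'b::real_normed_vector) \<Rightarrow> ('b \<Rightarrow> 'b list \<Rightarrow> real)
      \<Rightarrow> 'a \<Rightarrow> 'a list \<Rightarrow> real" where
  "pullback \<phi> f x vs = f (\<phi> x) (map (frechet_derivative \<phi> (at x)) vs)"

lemma form_on_alternating: "form_on k S f \<Longrightarrow> x \<in> S \<Longrightarrow> alternating_form k (f x)"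
  by (simp add: form_on_def)

lemma form_on_smooth: "form_on k S f \<Longrightarrow> smooth_on S (\<lambda>x. f x vs)"
  by (simp add: form_on_def)

lemma form_on_wrong_length: "form_on k S f \<Longrightarrow> x \<in> S \<Longrightarrow> length vs \<noteq> k \<Longrightarrow> f x vs = 0"
  using alternating_form_wrong_length form_on_alternating by blast

lemma form_on_differentiable:
  "form_on k S f \<Longrightarrow> x \<in> S \<Longrightarrow> (\<lambda>x. f x vs) differentiable (at x)"
  using smooth_on_has_derivative[OF form_on_smooth] unfolding differentiable_def by blast

text \<open>
  Lists of any length are allowed: on a list of the wrong length the form vanishes identically.
\<close>

lemma form_on_eval_smooth:
  fixes f :: "'c::euclidean_space \<Rightarrow> 'b::euclidean_space list \<Rightarrow> real"
  assumes S: "open S" and T: "open T" "\<gamma> ` S \<subseteq> T" and \<gamma>: "smooth_on S \<gamma>"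
    and f: "form_on k T f" and ws: "\<And>w. w \<in> set ws \<Longrightarrow> smooth_on S w"
  shows "smooth_on S (\<lambda>s. f (\<gamma> s) (map (\<lambda>w. w s) ws))"
proof (cases "length ws = k")
  case True
  show ?thesis
    by (rule multilinear_smooth[OF S T \<gamma> _ form_on_smooth[OF f] ws])
      (use True form_on_alternating[OF f] alternating_form_multilinear in auto)
next
  case False
  show ?thesis
    by (rule smooth_on_cong[OF smooth_on_const[OF S] S, of 0])
      (use T(2) False in \<open>auto simp: form_on_wrong_length[OF f]\<close>)
qed

lemma form_on_pullback:
  fixes \<phi> :: "'a::real_normed_vector \<Rightarrow> 'b::euclidean_space"
  assumes S: "open S" and T: "open T" "\<phi> ` S \<subseteq> T" and \<phi>: "smooth_on S \<phi>" and f: "form_on k T f"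
  shows "form_on k S (pullback \<phi> f)"
  unfolding form_on_def pullback_def
proof (intro conjI ballI allI)
  fix x assume x: "x \<in> S"
  show "alternating_form k (\<lambda>vs. f (\<phi> x) (map (frechet_derivative \<phi> (at x)) vs))"
    using alternating_form_map[OF form_on_alternating[OF f]
        has_derivative_linear[OF smooth_on_has_derivative[OF \<phi> x]]] T(2) x by blast
next
  fix vs
  have "smooth_on S (\<lambda>s. f (\<phi> s) (map (\<lambda>w. w s) (map (\<lambda>v x. frechet_derivative \<phi> (at x) v) vs)))"
    by (rule form_on_eval_smooth[OF S T \<phi> f]) (auto intro: smooth_on_frechet_derivative[OF \<phi>])
  then show "smooth_on S (\<lambda>s. f (\<phi> s) (map (frechet_derivative \<phi> (at s)) vs))"
    by (simp add: o_def)
qed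

lemma pullback_compose:
  assumes "(\<phi> has_derivative \<phi>') (at x)" "(\<psi> has_derivative \<psi>') (at (\<phi> x))"
  shows "pullback (\<lambda>y. \<psi> (\<phi> y)) f x = pullback \<phi> (pullback \<psi> f) x"
  using frechet_derivative_at[OF assms(1)] frechet_derivative_at[OF assms(2)]
    frechet_derivative_at[OF has_derivative_compose[OF assms]]
  by (auto simp: pullback_def fun_eq_iff o_def)

lemma pullback_cong_open:
  assumes "open S" "x \<in> S" "\<And>y. y \<in> S \<Longrightarrow> \<phi> y = \<psi> y"
  shows "pullback \<phi> f x = pullback \<psi> f x"
proof -
  have "frechet_derivative \<phi> (at x) = frechet_derivative \<psi> (at x)"
    by (rule frechet_derivative_cong_open[OF assms])
  then show ?thesis by (intro ext) (simp add: pullback_def assms(2,3))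
qed

lemma exd_wrong_length:
  assumes "open S" "x \<in> S" "form_on k S f" "length vs \<noteq> Suc k"
  shows "exd f x vs = 0"
  unfolding exd_def
proof (intro sum.neutral ballI)
  fix i assume i: "i \<in> {..<length vs}"
  then have "length (omit i vs) \<noteq> k" using assms(4) by auto
  then have "frechet_derivative (\<lambda>y. f y (omit i vs)) (at x) = frechet_derivative (\<lambda>y. 0) (at x)"
    by (intro frechet_derivative_cong_open[OF assms(1,2)] form_on_wrong_length[OF assms(3)])
  then show "(- 1) ^ i * frechet_derivative (\<lambda>y. f y (omit i vs)) (at x) (vs ! i) = 0" by simp
qed

lemma exd_cong_open:
  assumes "open S" "x \<in> S" "\<And>y. y \<in> S \<Longrightarrow> f y = g y"
  shows "exd f x = exd g x"
proof -
  have "frechet_derivative (\<lambda>y. f y us) (at x) = frechet_derivative (\<lambda>y. g y us) (at x)" for us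
    by (rule frechet_derivative_cong_open[OF assms(1,2)]) (simp add: assms(3))
  then show ?thesis by (simp add: exd_def fun_eq_iff)
qed

lemma exd_add:
  assumes "x \<in> S" "form_on k S f" "form_on l S g"
  shows "exd (\<lambda>y vs. f y vs + g y vs) x vs = exd f x vs + exd g x vs"
proof -
  have "frechet_derivative (\<lambda>y. f y us + g y us) (at x) v
      = frechet_derivative (\<lambda>y. f y us) (at x) v + frechet_derivative (\<lambda>y. g y us) (at x) v" for us v
    using frechet_derivative_at[OF has_derivative_add[OF
          smooth_on_has_derivative[OF form_on_smooth[OF assms(2)] assms(1)]
          smooth_on_has_derivative[OF form_on_smooth[OF assms(3)] assms(1)]], of us us]
    by (simp add: fun_eq_iff)
  then show ?thesis by (simp add: exd_def algebra_simps sum.distrib)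
qed

lemma form_on_add:
  assumes "open S" "form_on k S f" "form_on k S g"
  shows "form_on k S (\<lambda>y vs. f y vs + g y vs)"
  using assms unfolding form_on_def alternating_form_def
  by (auto intro!: smooth_on_add linear_compose_add)

text \<open>
  By the product rule, the derivative of a pulled back form consists of the pulled back derivative
  and of terms containing the second derivative of \<open>\<phi>\<close>, which is symmetric. The latter cancel by
  \<open>alternating_form_symmetric_cancel\<close>.
\<close>

lemma exd_pullback:
  fixes \<phi> :: "'a::real_normed_vector \<Rightarrow> 'b::euclidean_space"
  assumes S: "open S" "x \<in> S" and T: "open T" "\<phi> ` S \<subseteq> T" and \<phi>: "smooth_on S \<phi>"
    and f: "form_on k T f"
  shows "exd (pullback \<phi> f) x vs = pullback \<phi> (exd f) x vs"
proof (cases "length vs = Suc k")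
  case False
  then show ?thesis
    using exd_wrong_length[OF S form_on_pullback[OF S(1) T \<phi> f] False]
      exd_wrong_length[OF T(1) _ f, of "\<phi> x" "map (frechet_derivative \<phi> (at x)) vs"] S T
    by (auto simp: pullback_def)
next
  case True
  let ?A = "frechet_derivative \<phi> (at x)"
  define H where "H u v = frechet_derivative (\<lambda>y. frechet_derivative \<phi> (at y) v) (at x) u" for u v
  have H: "H u v = H v u" for u v
    unfolding H_def by (rule second_derivative_symmetric[OF S \<phi>])
  have \<phi>x: "\<phi> x \<in> T" using S T by auto
  have d: "frechet_derivative (\<lambda>y. pullback \<phi> f y us) (at x) v
      = frechet_derivative (\<lambda>y. f y (map ?A us)) (at (\<phi> x)) (?A v)
        + (\<Sum>j<k. f (\<phi> x) ((map ?A us)[j := H v (us ! j)]))" if us: "length us = k" for us v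
  proof -
    let ?ws = "map (\<lambda>v y. frechet_derivative \<phi> (at y) v) us" and ?ws' = "map (\<lambda>u v. H v u) us"
    have "((\<lambda>s. f (\<phi> s) (map (\<lambda>w. w s) ?ws)) has_derivative
       (\<lambda>h. frechet_derivative (\<lambda>y. f y (map (\<lambda>w. w x) ?ws)) (at (\<phi> x)) (?A h) +
         (\<Sum>i<length ?ws. f (\<phi> x) ((map (\<lambda>w. w x) ?ws)[i := (?ws' ! i) h])))) (at x)"
    proof (rule multilinear_has_derivative[of T])
      show "list_all2 (\<lambda>w w'. (w has_derivative w') (at x)) ?ws ?ws'"
        using smooth_on_has_derivative[OF smooth_on_frechet_derivative[OF \<phi>] S(2)]
        by (auto simp: H_def list_all2_conv_all_nth)
      show "multilinear (length ?ws) (f y)" if "y \<in> T" for y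
        using alternating_form_multilinear[OF form_on_alternating[OF f that]] us by simp
    qed (use T \<phi>x smooth_on_has_derivative[OF \<phi> S(2)] form_on_differentiable[OF f \<phi>x] in auto)
    from frechet_derivative_at[OF this, symmetric] us show ?thesis
      unfolding pullback_def by (simp add: o_def)
  qed
  have "exd (pullback \<phi> f) x vs = (\<Sum>i<Suc k. (- 1) ^ i *
      (frechet_derivative (\<lambda>y. f y (map ?A (omit i vs))) (at (\<phi> x)) (?A (vs ! i))
        + (\<Sum>j<k. f (\<phi> x) ((map ?A (omit i vs))[j := H (vs ! i) (omit i vs ! j)]))))"
    unfolding exd_def True by (intro sum.cong refl) (subst d, auto simp: True)
  also have "\<dots> = (\<Sum>i<Suc k. (- 1) ^ i *
      frechet_derivative (\<lambda>y. f y (map ?A (omit i vs))) (at (\<phi> x)) (?A (vs ! i)))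
    + (\<Sum>i<Suc k. \<Sum>j<k. (- 1) ^ i * f (\<phi> x) ((omit i (map ?A vs))[j := H (vs ! i) (omit i vs ! j)]))"
    by (simp only: distrib_left sum.distrib sum_distrib_left map_omit)
  also have "(\<Sum>i<Suc k. \<Sum>j<k. (- 1) ^ i *
      f (\<phi> x) ((omit i (map ?A vs))[j := H (vs ! i) (omit i vs ! j)])) = 0"
    by (rule alternating_form_symmetric_cancel[OF form_on_alternating[OF f \<phi>x]])
      (use True H in auto)
  also have "(\<Sum>i<Suc k. (- 1) ^ i *
      frechet_derivative (\<lambda>y. f y (map ?A (omit i vs))) (at (\<phi> x)) (?A (vs ! i))) = pullback \<phi> (exd f) x vs"
    unfolding pullback_def exd_def by (simp only: length_map True map_omit) (simp add: True)
  finally show ?thesis by simp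
qed

section \<open>The homotopy operator of a linear map\<close>

subsection \<open>Smooth dependence of integrals on a parameter\<close>

text \<open>
  Differentiation under the integral sign. Continuity of the derivative in the operator norm, as
  the Leibniz rule for integrals wants it, is obtained from continuity of the partial derivatives.
\<close>

lemma parameter_integral_has_derivative:
  fixes g :: "real \<times> 'a::euclidean_space \<Rightarrow> real"
  assumes D: "open D" and g: "Ck_on (Suc 0) D g" and U: "open U" "x \<in> U"
    and sub: "\<And>t y. 0 \<le> t \<Longrightarrow> t \<le> 1 \<Longrightarrow> y \<in> U \<Longrightarrow> (t, y) \<in> D"
  shows "((\<lambda>y. integral {0..1} (\<lambda>t. g (t, y))) has_derivative
      (\<lambda>v. integral {0..1} (\<lambda>t. frechet_derivative g (at (t, x)) (0, v)))) (at x)"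
proof -
  obtain r where r: "r > 0" "ball x r \<subseteq> U" using U openE by blast
  define fx where "fx y t = Blinfun (\<lambda>v. frechet_derivative g (at (t, y)) (0, v))" for y t
  have d: "((\<lambda>y. g (t, y)) has_derivative (\<lambda>v. frechet_derivative g (at (t, y)) (0, v))) (at y)"
    if "(t, y) \<in> D" for t y
  proof -
    have "((\<lambda>y. (t, y)) has_derivative (\<lambda>v. (0, v))) (at y)"
      by (auto intro!: derivative_eq_intros)
    from has_derivative_compose[OF this Ck_on_has_derivative[OF g that]] show ?thesis .
  qed
  have fx: "blinfun_apply (fx y t) = (\<lambda>v. frechet_derivative g (at (t, y)) (0, v))"
    if "(t, y) \<in> D" for t y
    unfolding fx_def by (rule bounded_linear_Blinfun_apply[OF has_derivative_bounded_linear[OF d[OF that]]])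
  have inD: "(t, y) \<in> D" if "y \<in> ball x r" "t \<in> cbox 0 1" for t y
    using that r(2) sub[of t y] by auto
  have cont: "continuous_on D g" using g Ck_on_Suc_imp Ck_on.simps(1) by blast
  have cont_fx: "continuous_on (ball x r \<times> cbox 0 1) (\<lambda>(y, t). fx y t)"
  proof (rule continuous_on_blinfun_componentwise)
    fix i :: 'a
    have "continuous_on D (\<lambda>z. frechet_derivative g (at z) (0, i))" using g by simp
    then have "continuous_on (ball x r \<times> cbox 0 1)
        (\<lambda>z. frechet_derivative g (at (snd z, fst z)) (0, i))"
      by (rule continuous_on_compose2) (use inD in \<open>auto intro!: continuous_intros\<close>)
    then show "continuous_on (ball x r \<times> cbox 0 1)
        (\<lambda>z. blinfun_apply (case z of (y, t) \<Rightarrow> fx y t) i)"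
      by (rule continuous_on_eq) (use fx inD in auto)
  qed
  have "((\<lambda>y. integral (cbox 0 1) (\<lambda>t. g (t, y))) has_derivative
      blinfun_apply (integral (cbox 0 1) (fx x))) (at x within ball x r)"
  proof (rule leibniz_rule[OF _ _ cont_fx])
    show "((\<lambda>y. g (t, y)) has_derivative blinfun_apply (fx y t)) (at y within ball x r)"
      if "y \<in> ball x r" "t \<in> cbox 0 1" for y t
      using d[OF inD[OF that]] fx[OF inD[OF that]] by (simp add: has_derivative_at_withinI)
    show "(\<lambda>t. g (t, y)) integrable_on cbox 0 1" if "y \<in> ball x r" for y
      by (intro integrable_continuous continuous_on_compose2[OF cont] continuous_intros)
        (use inD that in auto)
  qed (use r in auto)
  then have *: "((\<lambda>y. integral {0..1} (\<lambda>t. g (t, y))) has_derivative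
      blinfun_apply (integral {0..1} (fx x))) (at x)"
    using r(1) by (simp add: at_within_open[OF _ open_ball])
  have "continuous_on (cbox 0 1) (\<lambda>t. fx x t)"
    using continuous_on_compose2[OF cont_fx, of "cbox 0 1" "\<lambda>t. (x, t)"] r(1)
    by (simp add: continuous_on_Pair image_subset_iff)
  then have "fx x integrable_on cbox 0 1" by (rule integrable_continuous)
  then have "blinfun_apply (integral {0..1} (fx x)) v = integral {0..1} (\<lambda>t. fx x t v)" for v
    using integral_linear[of "fx x" "{0..1}" "\<lambda>B. blinfun_apply B v"] blinfun.bounded_linear_left
    by (simp add: o_def)
  also have "integral {0..1} (\<lambda>t. fx x t v)
      = integral {0..1} (\<lambda>t. frechet_derivative g (at (t, x)) (0, v))" for v
    by (rule integral_cong) (use fx inD r(1) in auto)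
  finally have "blinfun_apply (integral {0..1} (fx x))
      = (\<lambda>v. integral {0..1} (\<lambda>t. frechet_derivative g (at (t, x)) (0, v)))"
    by (rule ext)
  with * show ?thesis by simp
qed

lemma parameter_integral_Ck_on:
  fixes g :: "real \<times> 'a::euclidean_space \<Rightarrow> real"
  assumes D: "open D" and U: "open U"
    and sub: "\<And>t y. 0 \<le> t \<Longrightarrow> t \<le> 1 \<Longrightarrow> y \<in> U \<Longrightarrow> (t, y) \<in> D"
  shows "smooth_on D g \<Longrightarrow> Ck_on k U (\<lambda>y. integral {0..1} (\<lambda>t. g (t, y)))"
proof (induction k arbitrary: g)
  case 0
  have "Ck_on (Suc 0) D g" using 0 unfolding smooth_on_def by blast
  from parameter_integral_has_derivative[OF D this U _ sub]
  show ?case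
    by (auto intro!: continuous_at_imp_continuous_on has_derivative_continuous simp del: Ck_on.simps(2))
next
  case (Suc k)
  have g: "Ck_on (Suc 0) D g" using Suc.prems unfolding smooth_on_def by blast
  show ?case
    by (rule Ck_on_SucI[OF U parameter_integral_has_derivative[OF D g U _ sub]])
      (use Suc.IH smooth_on_frechet_derivative[OF Suc.prems] in auto)
qed

lemma parameter_integral_smooth_on:
  fixes g :: "real \<times> 'a::euclidean_space \<Rightarrow> real"
  assumes "open D" "open U" "\<And>t y. 0 \<le> t \<Longrightarrow> t \<le> 1 \<Longrightarrow> y \<in> U \<Longrightarrow> (t, y) \<in> D" "smooth_on D g"
  shows "smooth_on U (\<lambda>y. integral {0..1} (\<lambda>t. g (t, y)))"
  unfolding smooth_on_def using parameter_integral_Ck_on[OF assms] by blast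


subsection \<open>The homotopy formula\<close>

definition contraction :: "('a::real_vector \<Rightarrow> 'a) \<Rightarrow> real \<Rightarrow> 'a \<Rightarrow> 'a" where
  "contraction P t z = P z + t *\<^sub>R (z - P z)"

text \<open>
  The integrand is the interior product of the pullback of \<open>f\<close> under \<open>(t, z) \<mapsto> contraction P t z\<close> with
  the coordinate field \<open>\<partial>/\<partial>t\<close>: the first argument \<open>z - P z\<close> is the velocity of this homotopy. It leads
  from \<open>P\<close> at \<open>t = 0\<close> to the identity at \<open>t = 1\<close>.
\<close>

definition homotopy_op ::
    "('a::real_normed_vector \<Rightarrow> 'a) \<Rightarrow> ('a \<Rightarrow> 'a list \<Rightarrow> real) \<Rightarrow> 'a \<Rightarrow> 'a list \<Rightarrow> real" where
  "homotopy_op P f z vs =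
     integral {0..1} (\<lambda>t. f (contraction P t z) ((z - P z) # map (contraction P t) vs))"

lemma contraction_0 [simp]: "contraction P 0 z = P z"
  and contraction_1 [simp]: "contraction P 1 z = z"
  by (simp_all add: contraction_def)

lemma homotopy_op_eq_0:
  assumes "\<And>t. 0 \<le> t \<Longrightarrow> t \<le> 1 \<Longrightarrow> f (contraction P t z) ((z - P z) # map (contraction P t) vs) = 0"
  shows "homotopy_op P f z vs = 0"
proof -
  have "homotopy_op P f z vs = integral {0..1} (\<lambda>t::real. 0 :: real)"
    unfolding homotopy_op_def by (rule integral_cong) (use assms in auto)
  then show ?thesis by simp
qed

lemma linear_contraction: "linear P \<Longrightarrow> linear (contraction P t)"
  unfolding contraction_def
  by (intro linear_compose_add linear_compose_scale_right linear_compose_sub linear_ident)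

lemma contraction_has_derivative:
  assumes "bounded_linear P"
  shows "((\<lambda>s. contraction P (fst s) (snd s)) has_derivative
    (\<lambda>h. contraction P (fst s) (snd h) + fst h *\<^sub>R (snd s - P (snd s)))) (at s)"
proof -
  have "((\<lambda>s. P (snd s)) has_derivative (\<lambda>h. P (snd h))) (at s)" for s :: "real \<times> 'a"
    by (intro bounded_linear.has_derivative[OF assms] has_derivative_snd has_derivative_ident)
  note [derivative_intros] = this
  show ?thesis unfolding contraction_def
    by (auto intro!: derivative_eq_intros simp: algebra_simps)
qed

locale linear_homotopy =
  fixes P :: "'a::euclidean_space \<Rightarrow> 'a" and S :: "'a set" and f :: "'a \<Rightarrow> 'a list \<Rightarrow> real" and k :: nat
  assumes linP: "linear P" and openS: "open S" and form: "form_on k S f"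
    and stable: "\<And>t z. 0 \<le> t \<Longrightarrow> t \<le> 1 \<Longrightarrow> z \<in> S \<Longrightarrow> contraction P t z \<in> S"
begin

lemma bounded_linear_P: "bounded_linear P"
  using linP by (simp add: linear_conv_bounded_linear)

text \<open>
  An open neighbourhood of \<open>[0,1] \<times> S\<close>, as smoothness of the integrand jointly in \<open>t\<close> and \<open>z\<close> is
  a statement about open sets.
\<close>

definition homotopy_dom :: "(real \<times> 'a) set" where
  "homotopy_dom = (\<lambda>s. contraction P (fst s) (snd s)) -` S"

lemma smooth_contraction:
  assumes "open E" shows "smooth_on E (\<lambda>s. contraction P (fst s) (snd s))"
proof -
  have "smooth_on E (\<lambda>s. P (snd s) + fst s *\<^sub>R (snd s - P (snd s)))"
  proof (intro smooth_on_add smooth_on_scaleR assms)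
    have "bounded_linear (\<lambda>s::real \<times> 'a. P (snd s))"
      by (rule bounded_linear_compose[OF bounded_linear_P bounded_linear_snd])
    moreover have "bounded_linear (\<lambda>s::real \<times> 'a. snd s - P (snd s))"
      using calculation by (intro bounded_linear_sub bounded_linear_snd)
    ultimately show "smooth_on E (\<lambda>s::real \<times> 'a. P (snd s))"
      "smooth_on E (\<lambda>s::real \<times> 'a. snd s - P (snd s))" "smooth_on E (fst :: real \<times> 'a \<Rightarrow> real)"
      using smooth_on_affine[OF assms, of _ 0] bounded_linear_fst[where 'a = real and 'b = 'a] by auto
  qed
  then show ?thesis by (simp add: contraction_def)
qed

lemma open_homotopy_dom: "open homotopy_dom"
  unfolding homotopy_dom_def
  by (rule open_vimage[OF openS smooth_on_imp_continuous_on[OF smooth_contraction[OF open_UNIV]]])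

lemma in_homotopy_dom: "0 \<le> t \<Longrightarrow> t \<le> 1 \<Longrightarrow> z \<in> S \<Longrightarrow> (t, z) \<in> homotopy_dom"
  by (simp add: homotopy_dom_def stable)

definition integrand :: "'a list \<Rightarrow> real \<times> 'a \<Rightarrow> real" where
  "integrand us = (\<lambda>s. f (contraction P (fst s) (snd s))
      ((snd s - P (snd s)) # map (contraction P (fst s)) us))"

lemma homotopy_op_integrand: "homotopy_op P f z us = integral {0..1} (\<lambda>t. integrand us (t, z))"
  by (simp add: homotopy_op_def integrand_def)

lemma smooth_integrand: "smooth_on homotopy_dom (integrand us)"
proof -
  let ?ws = "(\<lambda>s::real \<times> 'a. snd s - P (snd s)) # map (\<lambda>u s. contraction P (fst s) u) us"
  have "smooth_on homotopy_dom (\<lambda>s. f (contraction P (fst s) (snd s)) (map (\<lambda>w. w s) ?ws))"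
  proof (rule form_on_eval_smooth[OF open_homotopy_dom openS _ smooth_contraction[OF open_homotopy_dom] form])
    fix w assume "w \<in> set ?ws"
    then consider "w = (\<lambda>s. snd s - P (snd s))" | u where "w = (\<lambda>s. contraction P (fst s) u)" by auto
    then show "smooth_on homotopy_dom w"
    proof cases
      case 1
      have "bounded_linear (\<lambda>s::real \<times> 'a. snd s - P (snd s))"
        by (intro bounded_linear_sub bounded_linear_snd
            bounded_linear_compose[OF bounded_linear_P bounded_linear_snd])
      from smooth_on_affine[OF open_homotopy_dom this, of 0] show ?thesis by (simp add: 1)
    next
      case 2
      have "bounded_linear (\<lambda>s::real \<times> 'a. fst s *\<^sub>R (u - P u))"
        by (rule bounded_linear_compose[OF bounded_linear_scaleR_left bounded_linear_fst])
      from smooth_on_affine[OF open_homotopy_dom this, of "P u"] show ?thesis by (simp add: 2 contraction_def)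
    qed
  qed (auto simp: homotopy_dom_def)
  then show ?thesis by (simp add: integrand_def o_def)
qed

lemma integrand_integrable: "z \<in> S \<Longrightarrow> (\<lambda>t. integrand us (t, z)) integrable_on {0..1}"
  by (intro integrable_continuous_interval
      continuous_on_compose2[OF smooth_on_imp_continuous_on[OF smooth_integrand]] continuous_intros)
    (auto intro: in_homotopy_dom)

lemma homotopy_op_has_derivative:
  "z \<in> S \<Longrightarrow> ((\<lambda>y. homotopy_op P f y us) has_derivative
    (\<lambda>v. integral {0..1} (\<lambda>t. frechet_derivative (integrand us) (at (t, z)) (0, v)))) (at z)"
  unfolding homotopy_op_integrand
  by (rule parameter_integral_has_derivative[OF open_homotopy_dom _ openS _ in_homotopy_dom])
    (use smooth_integrand in \<open>unfold smooth_on_def, blast+\<close>)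

lemma integrand_derivative_integrable:
  "z \<in> S \<Longrightarrow> (\<lambda>t. frechet_derivative (integrand us) (at (t, z)) (0, v)) integrable_on {0..1}"
  by (intro integrable_continuous_interval
      continuous_on_compose2[OF smooth_on_imp_continuous_on[OF
          smooth_on_frechet_derivative[OF smooth_integrand]]] continuous_intros)
    (auto intro: in_homotopy_dom)

text \<open>
  For \<open>k = 0\<close> the truncated difference \<open>k - 1\<close> is harmless: a \<open>0\<close>-form vanishes on nonempty lists, so
  the operator gives the zero form.
\<close>

lemma form_on_homotopy_op: "form_on (k - 1) S (homotopy_op P f)"
  unfolding form_on_def
proof (intro conjI ballI allI)
  show "smooth_on S (\<lambda>z. homotopy_op P f z vs)" for vs
    unfolding homotopy_op_integrand
    by (rule parameter_integral_smooth_on[OF open_homotopy_dom openS in_homotopy_dom smooth_integrand])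
next
  fix z assume z: "z \<in> S"
  note alt = form_on_alternating[OF form stable[OF _ _ z]]
  show "alternating_form (k - 1) (homotopy_op P f z)"
    unfolding alternating_form_def
  proof (intro conjI allI impI)
    show "homotopy_op P f z vs = 0" if "length vs \<noteq> k - 1" for vs
      by (rule homotopy_op_eq_0, rule alternating_form_wrong_length[OF alt]) (use that in auto)
    show "homotopy_op P f z vs = 0" if "length vs = k - 1" "i < j" "j < k - 1" "vs ! i = vs ! j" for vs i j
      by (rule homotopy_op_eq_0, rule alternating_form_repeat[OF alt, of _ _ "Suc i" "Suc j"]) (use that in auto)
    show "linear (\<lambda>u. homotopy_op P f z (vs[i := u]))" if vs: "length vs = k - 1" "i < k - 1" for vs i
    proof -
      have lin: "linear (\<lambda>u. integrand (vs[i := u]) (t, z))" if "0 \<le> t" "t \<le> 1" for t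
        using linear_compose[OF linear_contraction[OF linP, of t] alternating_form_linear[OF alt[OF that],
              of "(z - P z) # map (contraction P t) vs" "Suc i"]] vs
        by (simp add: integrand_def map_update o_def)
      show ?thesis
      proof (rule linearI)
        fix u w
        have "integral {0..1} (\<lambda>t. integrand (vs[i := u + w]) (t, z))
          = integral {0..1} (\<lambda>t. integrand (vs[i := u]) (t, z) + integrand (vs[i := w]) (t, z))"
          by (rule integral_cong) (simp add: linear_add[OF lin])
        then show "homotopy_op P f z (vs[i := u + w])
            = homotopy_op P f z (vs[i := u]) + homotopy_op P f z (vs[i := w])"
          by (simp add: homotopy_op_integrand integral_add integrand_integrable z)
      next
        fix c u
        have "integral {0..1} (\<lambda>t. integrand (vs[i := c *\<^sub>R u]) (t, z))
          = integral {0..1} (\<lambda>t. c *\<^sub>R integrand (vs[i := u]) (t, z))"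
          by (rule integral_cong) (simp add: linear_scale[OF lin])
        then show "homotopy_op P f z (vs[i := c *\<^sub>R u]) = c *\<^sub>R homotopy_op P f z (vs[i := u])"
          by (simp add: homotopy_op_integrand)
      qed
    qed
  qed
qed

text \<open>
  Of the product rule, only the terms for the point and for the velocity \<open>z - P z\<close> remain: in the
  direction \<open>(0, v)\<close> the vectors \<open>contraction P t u\<close> do not move.
\<close>

lemma integrand_derivative:
  assumes t: "0 \<le> t" "t \<le> 1" and z: "z \<in> S" and us: "Suc (length us) = k"
  shows "frechet_derivative (integrand us) (at (t, z)) (0, v)
    = frechet_derivative (\<lambda>y. f y ((z - P z) # map (contraction P t) us)) (at (contraction P t z))
        (contraction P t v)
      + f (contraction P t z) ((v - P v) # map (contraction P t) us)"
proof -
  let ?ws = "(\<lambda>s::real \<times> 'a. snd s - P (snd s)) # map (\<lambda>u s. contraction P (fst s) u) us"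
  let ?ws' = "(\<lambda>h::real \<times> 'a. snd h - P (snd h)) # map (\<lambda>u h. fst h *\<^sub>R (u - P u)) us"
  let ?\<gamma> = "\<lambda>s. contraction P (fst s) (snd s)"
  note hS = stable[OF t z]
  have "((\<lambda>s. f (?\<gamma> s) (map (\<lambda>w. w s) ?ws)) has_derivative
     (\<lambda>h. frechet_derivative (\<lambda>y. f y (map (\<lambda>w. w (t, z)) ?ws)) (at (?\<gamma> (t, z)))
         (contraction P (fst (t, z)) (snd h) + fst h *\<^sub>R (snd (t, z) - P (snd (t, z)))) +
       (\<Sum>i<length ?ws. f (?\<gamma> (t, z)) ((map (\<lambda>w. w (t, z)) ?ws)[i := (?ws' ! i) h])))) (at (t, z))"
  proof (rule multilinear_has_derivative[OF openS _ contraction_has_derivative[OF bounded_linear_P]])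
    show "multilinear (length ?ws) (f y)" if "y \<in> S" for y
      using alternating_form_multilinear[OF form_on_alternating[OF form that]] us by simp
    have "((\<lambda>s::real \<times> 'a. snd s - P (snd s)) has_derivative (\<lambda>h. snd h - P (snd h))) (at (t, z))"
      by (intro has_derivative_diff bounded_linear.has_derivative[OF bounded_linear_P]
          has_derivative_snd has_derivative_ident)
    moreover have "((\<lambda>s::real \<times> 'a. contraction P (fst s) u) has_derivative
        (\<lambda>h. fst h *\<^sub>R (u - P u))) (at (t, z))" for u
      unfolding contraction_def by (auto intro!: derivative_eq_intros)
    ultimately show "list_all2 (\<lambda>w w'. (w has_derivative w') (at (t, z))) ?ws ?ws'"
      by (auto simp: list_all2_conv_all_nth nth_Cons split: nat.split)
  qed (use hS form_on_differentiable[OF form hS] in auto)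
  from fun_cong[OF frechet_derivative_at[OF this, symmetric], of "(0, v)"]
  have "frechet_derivative (integrand us) (at (t, z)) (0, v)
    = frechet_derivative (\<lambda>y. f y ((z - P z) # map (contraction P t) us)) (at (contraction P t z))
        (contraction P t v)
      + (\<Sum>i<Suc (length us). f (contraction P t z)
          (((z - P z) # map (contraction P t) us)[i := (?ws' ! i) (0, v)]))"
    by (simp add: integrand_def o_def)
  also have "(\<Sum>i<Suc (length us). f (contraction P t z)
          (((z - P z) # map (contraction P t) us)[i := (?ws' ! i) (0, v)]))
      = f (contraction P t z) ((v - P v) # map (contraction P t) us)"
  proof -
    have "f (contraction P t z) (((z - P z) # map (contraction P t) us)[Suc i := 0]) = 0"
      if "i < length us" for i
      using linear_0[OF alternating_form_linear[OF form_on_alternating[OF form hS],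
            of "(z - P z) # map (contraction P t) us" "Suc i"]] that us by simp
    then show ?thesis unfolding sum.lessThan_Suc_shift by simp
  qed
  finally show ?thesis .
qed

lemma pullback_contraction_has_derivative:
  assumes t: "0 \<le> t" "t \<le> 1" and z: "z \<in> S" and vs: "length vs = k"
  shows "((\<lambda>t. f (contraction P t z) (map (contraction P t) vs)) has_derivative
     (\<lambda>h. frechet_derivative (\<lambda>y. f y (map (contraction P t) vs)) (at (contraction P t z)) (h *\<^sub>R (z - P z))
       + (\<Sum>i<k. f (contraction P t z) ((map (contraction P t) vs)[i := h *\<^sub>R (vs ! i - P (vs ! i))]))))
     (at t)"
proof -
  let ?ws = "map (\<lambda>u t. contraction P t u) vs" and ?ws' = "map (\<lambda>u h. h *\<^sub>R (u - P u)) vs"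
  note hS = stable[OF t z]
  have d: "((\<lambda>t. contraction P t u) has_derivative (\<lambda>h. h *\<^sub>R (u - P u))) (at t)" for u
    unfolding contraction_def by (auto intro!: derivative_eq_intros)
  have "((\<lambda>t. f (contraction P t z) (map (\<lambda>w. w t) ?ws)) has_derivative
     (\<lambda>h. frechet_derivative (\<lambda>y. f y (map (\<lambda>w. w t) ?ws)) (at (contraction P t z)) (h *\<^sub>R (z - P z))
       + (\<Sum>i<length ?ws. f (contraction P t z) ((map (\<lambda>w. w t) ?ws)[i := (?ws' ! i) h])))) (at t)"
  proof (rule multilinear_has_derivative[OF openS hS d])
    show "multilinear (length ?ws) (f y)" if "y \<in> S" for y
      using alternating_form_multilinear[OF form_on_alternating[OF form that]] vs by simp
    show "list_all2 (\<lambda>w w'. (w has_derivative w') (at t)) ?ws ?ws'"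
      using d by (auto simp: list_all2_conv_all_nth)
  qed (use form_on_differentiable[OF form hS] in auto)
  then show ?thesis by (simp add: o_def vs)
qed

text \<open>
  Inserting the derivative of the integrand into \<open>exd (homotopy_op P f)\<close> gives, for each \<open>t\<close>, two
  sums. Closedness of \<open>f\<close>, applied to the list starting with \<open>z - P z\<close>, turns the first one into the
  derivative of \<open>f\<close> along the homotopy. The second one replaces each vector by its velocity. Together
  they are the \<open>t\<close>-derivative of \<open>f\<close> pulled back by \<open>contraction P t\<close>, which is then integrated.
\<close>

lemma homotopy_formula:
  assumes closed: "\<And>y us. y \<in> S \<Longrightarrow> exd f y us = 0" and z: "z \<in> S" and vs: "length vs = k"
  shows "exd (homotopy_op P f) z vs = f z vs - f (P z) (map P vs)"
proof -
  let ?D = "\<lambda>t us v. frechet_derivative (\<lambda>y. f y us) (at (contraction P t z)) v"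
  have "exd (homotopy_op P f) z vs = (\<Sum>i<k. (- 1) ^ i *
      integral {0..1} (\<lambda>t. frechet_derivative (integrand (omit i vs)) (at (t, z)) (0, vs ! i)))"
    unfolding exd_def vs
    by (simp only: frechet_derivative_at[OF homotopy_op_has_derivative[OF z], symmetric])
  also have "\<dots> = integral {0..1} (\<lambda>t. \<Sum>i<k. (- 1) ^ i *
      frechet_derivative (integrand (omit i vs)) (at (t, z)) (0, vs ! i))"
    by (subst integral_sum)
      (auto intro!: integrable_on_mult_right integrand_derivative_integrable z)
  also have "\<dots> = integral {0..1} (\<lambda>t. ?D t (map (contraction P t) vs) (z - P z)
       + (\<Sum>i<k. f (contraction P t z) ((map (contraction P t) vs)[i := vs ! i - P (vs ! i)])))"
  proof (rule integral_cong)
    fix t :: real assume "t \<in> {0..1}"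
    then have t: "0 \<le> t" "t \<le> 1" by auto
    let ?h = "contraction P t"
    have "(\<Sum>i<k. (- 1) ^ i * frechet_derivative (integrand (omit i vs)) (at (t, z)) (0, vs ! i))
      = (\<Sum>i<k. (- 1) ^ i * ?D t ((z - P z) # map ?h (omit i vs)) (?h (vs ! i))
          + (- 1) ^ i * f (?h z) ((vs ! i - P (vs ! i)) # map ?h (omit i vs)))"
      by (intro sum.cong refl, subst integrand_derivative[OF t z])
        (use vs in \<open>auto simp: algebra_simps\<close>)
    also have "\<dots> = (\<Sum>i<k. (- 1) ^ i * ?D t ((z - P z) # map ?h (omit i vs)) (?h (vs ! i)))
        + (\<Sum>i<k. f (?h z) ((map ?h vs)[i := vs ! i - P (vs ! i)]))"
      unfolding sum.distrib
      using alternating_form_update[OF form_on_alternating[OF form stable[OF t z]], of "map ?h vs"] vs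
      by (auto intro!: sum.cong simp: map_omit)
    also have "(\<Sum>i<k. (- 1) ^ i * ?D t ((z - P z) # map ?h (omit i vs)) (?h (vs ! i)))
        = ?D t (map ?h vs) (z - P z)"
    proof -
      \<comment> \<open>The summand of index \<open>0\<close> omits \<open>z - P z\<close> and is the derivative in that direction; in the
        others the index is shifted by one, whence the minus sign.\<close>
      have "0 = exd f (?h z) ((z - P z) # map ?h vs)" using closed stable[OF t z] by simp
      also have "\<dots> = ?D t (map ?h vs) (z - P z)
          - (\<Sum>i<k. (- 1) ^ i * ?D t ((z - P z) # map ?h (omit i vs)) (?h (vs ! i)))"
        unfolding exd_def length_Cons length_map vs sum.lessThan_Suc_shift
        using vs by (simp add: sum_negf map_omit take_map drop_map)
      finally show ?thesis by simp
    qed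
    finally show "(\<Sum>i<k. (- 1) ^ i *
        frechet_derivative (integrand (omit i vs)) (at (t, z)) (0, vs ! i))
      = ?D t (map ?h vs) (z - P z)
         + (\<Sum>i<k. f (?h z) ((map ?h vs)[i := vs ! i - P (vs ! i)]))" .
  qed
  also have "\<dots> = f (contraction P 1 z) (map (contraction P 1) vs)
      - f (contraction P 0 z) (map (contraction P 0) vs)"
  proof (rule integral_unique, rule fundamental_theorem_of_calculus)
    fix t :: real assume "t \<in> {0..1}"
    then have t: "0 \<le> t" "t \<le> 1" by auto
    note hS = stable[OF t z]
    have "linear (?D t us)" for us
      using form_on_differentiable[OF form hS] by (auto intro: has_derivative_linear simp: frechet_derivative_works)
    then have 1: "?D t us (c *\<^sub>R w) = c * ?D t us w" for us c w
      by (simp add: linear_scale)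
    have 2: "f (contraction P t z) ((map (contraction P t) vs)[i := c *\<^sub>R w])
        = c * f (contraction P t z) ((map (contraction P t) vs)[i := w])" if "i < k" for i c w
      using linear_scale[OF alternating_form_linear[OF form_on_alternating[OF form hS],
            of "map (contraction P t) vs" i]] vs that by simp
    have "((\<lambda>t. f (contraction P t z) (map (contraction P t) vs)) has_vector_derivative
        ?D t (map (contraction P t) vs) (z - P z)
       + (\<Sum>i<k. f (contraction P t z) ((map (contraction P t) vs)[i := vs ! i - P (vs ! i)]))) (at t)"
      unfolding has_vector_derivative_def
      by (rule has_derivative_eq_rhs[OF pullback_contraction_has_derivative[OF t z vs]])
        (simp add: fun_eq_iff 1 2 sum_distrib_left distrib_left)
    then show "((\<lambda>t. f (contraction P t z) (map (contraction P t) vs)) has_vector_derivative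
        ?D t (map (contraction P t) vs) (z - P z)
       + (\<Sum>i<k. f (contraction P t z) ((map (contraction P t) vs)[i := vs ! i - P (vs ! i)])))
       (at t within {0..1})"
      by (rule has_vector_derivative_at_within)
  qed simp
  also have "contraction P 1 = (\<lambda>z. z)" by (simp add: fun_eq_iff)
  also have "contraction P 0 = P" by (simp add: fun_eq_iff)
  finally show ?thesis by simp
qed

end

section \<open>Forms and coordinates on manifolds\<close>

subsection \<open>Charts\<close>

lemma smooth_atlas_chart:
  assumes "smooth_atlas A" "c \<in> A"
  shows "open (fst c)" "homeomorphism (fst c) (chart_img c UNIV) (snd c) (chart_inv c)"
    "open (chart_img c UNIV)"
  using assms by (auto simp: smooth_atlas_def)

lemma smooth_atlas_covers: "smooth_atlas A \<Longrightarrow> \<exists>c\<in>A. p \<in> fst c"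
  by (auto simp: smooth_atlas_def)

lemma smooth_atlas_transition:
  "smooth_atlas A \<Longrightarrow> c \<in> A \<Longrightarrow> c' \<in> A \<Longrightarrow> smooth_on (chart_img c (fst c')) (coord_rep c c' id)"
  by (auto simp: smooth_atlas_def)

lemma chart_inv_chart: "smooth_atlas A \<Longrightarrow> c \<in> A \<Longrightarrow> p \<in> fst c \<Longrightarrow> chart_inv c (snd c p) = p"
  using smooth_atlas_chart(2) homeomorphism_apply1 by blast

text \<open>
  Outside the image of the chart \<^const>\<open>chart_inv\<close> returns an arbitrary point; the last conjunct
  excludes this case.
\<close>

lemma chart_img_iff:
  assumes "smooth_atlas A" "c \<in> A"
  shows "x \<in> chart_img c W \<longleftrightarrow>
    chart_inv c x \<in> fst c \<and> chart_inv c x \<in> W \<and> snd c (chart_inv c x) = x"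
proof
  assume "x \<in> chart_img c W"
  then obtain p where "p \<in> fst c" "p \<in> W" "x = snd c p" by (auto simp: chart_img_def)
  then show "chart_inv c x \<in> fst c \<and> chart_inv c x \<in> W \<and> snd c (chart_inv c x) = x"
    using chart_inv_chart[OF assms] by simp
next
  assume "chart_inv c x \<in> fst c \<and> chart_inv c x \<in> W \<and> snd c (chart_inv c x) = x"
  then show "x \<in> chart_img c W" unfolding chart_img_def by (metis IntI imageI)
qed

lemma chart_in_chart_img: "p \<in> fst c \<Longrightarrow> p \<in> W \<Longrightarrow> snd c p \<in> chart_img c W"
  by (simp add: chart_img_def)

lemma open_chart_img:
  assumes A: "smooth_atlas A" "c \<in> A" and W: "open W"
  shows "open (chart_img c W)"
proof -
  note h = smooth_atlas_chart[OF A]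
  have "chart_img c W = chart_img c UNIV \<inter> chart_inv c -` W"
    using chart_img_iff[OF A] by (auto simp del: vimage_eq simp: vimage_def)
  then show ?thesis
    using continuous_open_preimage[OF homeomorphism_cont2[OF h(2)] h(3) W] by simp
qed

lemma smooth_map_on_coord_rep:
  "smooth_map_on A B W f \<Longrightarrow> c \<in> A \<Longrightarrow> d \<in> B
    \<Longrightarrow> smooth_on (chart_img c (W \<inter> f -` fst d)) (coord_rep c d f)"
  by (simp add: smooth_map_on_def)


subsection \<open>Pulling back a form from a vector space to a manifold\<close>

text \<open>
  The pullback along a vector-valued map, with no chart on the side of the vector space. Both the
  primitive on the total space and the form \<open>\<eta>\<close> on the base arise in this way, so compatibility
  between charts has to be checked only here.
\<close>

definition manifold_pullback :: "('p \<Rightarrow> 'v::real_normed_vector) \<Rightarrow> ('v \<Rightarrow> 'v list \<Rightarrow> real)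
    \<Rightarrow> ('p, 'g::real_inner) form" where
  "manifold_pullback \<phi> f = (\<lambda>c. pullback (\<lambda>x. \<phi> (chart_inv c x)) f)"

lemma ext_deriv_exd: "ext_deriv \<omega> c = exd (\<omega> c)"
  by (simp add: ext_deriv_def exd_def fun_eq_iff)

locale smooth_vector_map =
  fixes A :: "('p::{t2_space,second_countable_topology}, 'g::real_inner) chart set"
    and W :: "'p set" and T :: "'v::euclidean_space set" and \<phi> :: "'p \<Rightarrow> 'v"
  assumes atlas: "smooth_atlas A" and openW: "open W" and openT: "open T"
    and maps: "\<And>p. p \<in> W \<Longrightarrow> \<phi> p \<in> T"
    and smooth: "\<And>c. c \<in> A \<Longrightarrow> smooth_on (chart_img c W) (\<lambda>x. \<phi> (chart_inv c x))"
begin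

lemma manifold_pullback_form_on: "form_on k T f \<Longrightarrow> c \<in> A \<Longrightarrow> form_on k (chart_img c W) (manifold_pullback \<phi> f c)"
  unfolding manifold_pullback_def
  by (rule form_on_pullback[OF open_chart_img[OF atlas _ openW] openT _ smooth])
    (auto simp: chart_img_iff[OF atlas] maps)

lemma manifold_pullback_diff_forms:
  assumes f: "form_on k T f"
  shows "manifold_pullback \<phi> f \<in> diff_forms A k W"
  unfolding diff_forms_def
proof (intro CollectI conjI ballI allI)
  fix c x assume "c \<in> A" "x \<in> chart_img c W"
  then show "alternating_form k (manifold_pullback \<phi> f c x)"
    using manifold_pullback_form_on[OF f] form_on_alternating by blast
next
  fix c vs assume "c \<in> A"
  then show "smooth_on (chart_img c W) (\<lambda>x. manifold_pullback \<phi> f c x vs)"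
    using manifold_pullback_form_on[OF f] form_on_smooth by blast
next
  fix c c' p vs assume c: "c \<in> A" "c' \<in> A" and p: "p \<in> fst c \<inter> fst c' \<inter> W"
  let ?x = "snd c p" and ?N = "chart_img c (fst c' \<inter> W)"
  have N: "open ?N" "?x \<in> ?N"
    using open_chart_img[OF atlas c(1)] smooth_atlas_chart(1)[OF atlas c(2)] openW p
    by (auto intro: chart_in_chart_img)
  have tx: "coord_rep c c' id ?x = snd c' p"
    using p chart_inv_chart[OF atlas c(1)] by (simp add: coord_rep_def)
  have "?x \<in> chart_img c (fst c')" "snd c' p \<in> chart_img c' W"
    using p by (auto intro: chart_in_chart_img)
  then have d: "(coord_rep c c' id has_derivative coord_deriv c c' id ?x) (at ?x)"
    "((\<lambda>y. \<phi> (chart_inv c' y)) has_derivative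
      frechet_derivative (\<lambda>y. \<phi> (chart_inv c' y)) (at (snd c' p))) (at (coord_rep c c' id ?x))"
    unfolding tx using smooth_on_has_derivative smooth_atlas_transition[OF atlas c] smooth[OF c(2)]
    by blast+
  have "pullback (\<lambda>x. \<phi> (chart_inv c x)) f ?x = pullback (\<lambda>x. \<phi> (chart_inv c' (coord_rep c c' id x))) f ?x"
    by (rule pullback_cong_open[OF N])
      (auto simp: coord_rep_def chart_img_iff[OF atlas c(1)] chart_inv_chart[OF atlas c(2)])
  also have "\<dots> = pullback (coord_rep c c' id) (pullback (\<lambda>x. \<phi> (chart_inv c' x)) f) ?x"
    by (rule pullback_compose[OF d])
  finally show "manifold_pullback \<phi> f c ?x vs
      = manifold_pullback \<phi> f c' (snd c' p) (map (coord_deriv c c' id ?x) vs)"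
    by (simp add: manifold_pullback_def pullback_def[of "coord_rep c c' id"] tx)
qed

lemma ext_deriv_manifold_pullback:
  assumes f: "form_on k T f" and c: "c \<in> A" and x: "x \<in> chart_img c W"
  shows "ext_deriv (manifold_pullback \<phi> f) c x vs = manifold_pullback \<phi> (exd f) c x vs"
  unfolding ext_deriv_exd manifold_pullback_def
  by (rule exd_pullback[OF open_chart_img[OF atlas c openW] x openT _ smooth[OF c] f])
    (use maps chart_img_iff[OF atlas c] in auto)

end

lemma foldr_interior_prod:
  "foldr interior_prod Ys \<omega> c x vs = \<omega> c x (rev (map (\<lambda>Y. Y c x) Ys) @ vs)"
  by (induction Ys arbitrary: vs) (auto simp: interior_prod_def)


subsection \<open>Coordinate systems\<close>

text \<open>
  A local parametrisation of the manifold by an open set of its model space. It is a diffeomorphism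
  with inverse \<open>\<xi>\<close>, but not a chart of the atlas, which need not be maximal.
\<close>

locale coordinate_system = smooth_vector_map A W T \<phi>
  for A :: "('p::{t2_space,second_countable_topology}, 'g::euclidean_space) chart set"
    and W and T :: "'g set" and \<phi> +
  fixes \<xi> :: "'g \<Rightarrow> 'p"
  assumes inv_maps: "\<And>z. z \<in> T \<Longrightarrow> \<xi> z \<in> W"
    and inv_left: "\<And>p. p \<in> W \<Longrightarrow> \<xi> (\<phi> p) = p"
    and inv_right: "\<And>z. z \<in> T \<Longrightarrow> \<phi> (\<xi> z) = z"
    and inv_continuous: "continuous_on T \<xi>"
    and inv_smooth: "\<And>c. c \<in> A \<Longrightarrow> smooth_on (T \<inter> \<xi> -` fst c) (\<lambda>z. snd c (\<xi> z))"
begin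

lemma open_inv_vimage: "open U \<Longrightarrow> open (T \<inter> \<xi> -` U)"
  by (rule continuous_open_preimage[OF inv_continuous openT])

text \<open>
  A form on the manifold is recovered from its expression \<open>f\<close> in the coordinates, and \<open>f\<close> inherits
  closedness. The coordinates lie over a single chart \<open>a\<close>, from which \<open>f\<close> is read off.
\<close>

lemma diff_form_in_coordinates:
  assumes \<omega>: "\<omega> \<in> diff_forms A k UNIV" and a: "a \<in> A" "W \<subseteq> fst a"
  defines "f \<equiv> pullback (\<lambda>z. snd a (\<xi> z)) (\<omega> a)"
  shows "form_on k T f"
    and "\<And>c x. c \<in> A \<Longrightarrow> x \<in> chart_img c W \<Longrightarrow> \<omega> c x = manifold_pullback \<phi> f c x"
    and "\<And>z vs. form_eq_on A UNIV (ext_deriv \<omega>) zero_form \<Longrightarrow> z \<in> T \<Longrightarrow> exd f z vs = 0"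
proof -
  have \<omega>a: "form_on k (chart_img a UNIV) (\<omega> a)"
    using \<omega> a(1) by (auto simp: diff_forms_def form_on_def)
  have sub: "(\<lambda>z. snd a (\<xi> z)) ` T \<subseteq> chart_img a UNIV"
    using inv_maps a(2) by (auto intro!: chart_in_chart_img)
  have "T \<inter> \<xi> -` fst a = T" using inv_maps a(2) by auto
  then have sm: "smooth_on T (\<lambda>z. snd a (\<xi> z))" using inv_smooth[OF a(1)] by simp
  note openA = smooth_atlas_chart(3)[OF atlas a(1)]
  show "form_on k T f" unfolding f_def by (rule form_on_pullback[OF openT openA sub sm \<omega>a])
  show "exd f z vs = 0" if "form_eq_on A UNIV (ext_deriv \<omega>) zero_form" "z \<in> T" for z vs
  proof -
    have "snd a (\<xi> z) \<in> chart_img a UNIV" using sub that(2) by auto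
    then have "exd (\<omega> a) (snd a (\<xi> z)) us = 0" for us
      using that(1) a(1) by (simp add: form_eq_on_def zero_form_def ext_deriv_exd)
    then show ?thesis
      unfolding f_def exd_pullback[OF openT that(2) openA sub sm \<omega>a] by (simp add: pullback_def)
  qed
  show "\<omega> c x = manifold_pullback \<phi> f c x" if c: "c \<in> A" and x: "x \<in> chart_img c W" for c x
  proof -
    define p where "p = chart_inv c x"
    have p: "p \<in> fst c" "p \<in> W" "snd c p = x" using x chart_img_iff[OF atlas c] by (auto simp: p_def)
    have tx: "coord_rep c a id x = snd a p" by (simp add: coord_rep_def p_def)
    have "p \<in> fst c \<inter> fst a \<inter> UNIV" using p a(2) by auto
    with \<omega> c a(1) have "\<omega> c (snd c p) vs = \<omega> a (snd a p) (map (coord_deriv c a id (snd c p)) vs)" for vs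
      unfolding diff_forms_def by blast
    then have "\<omega> c x = pullback (coord_rep c a id) (\<omega> a) x" by (intro ext) (simp only: p(3) pullback_def tx)
    also have "\<dots> = pullback (\<lambda>y. snd a (\<xi> (\<phi> (chart_inv c y)))) (\<omega> a) x"
      by (rule pullback_cong_open[OF open_chart_img[OF atlas c openW] x])
        (auto simp: coord_rep_def chart_img_iff[OF atlas c] inv_left)
    also have "\<dots> = pullback (\<lambda>y. \<phi> (chart_inv c y)) (pullback (\<lambda>z. snd a (\<xi> z)) (\<omega> a)) x"
      by (rule pullback_compose[OF smooth_on_has_derivative[OF smooth[OF c] x] smooth_on_has_derivative[OF sm]])
        (use p maps in \<open>auto simp: p_def\<close>)
    finally show ?thesis by (simp add: manifold_pullback_def f_def)
  qed
qed

end


subsection \<open>Coordinates adapted to a fibre bundle\<close>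

text \<open>
  Coordinates \<open>z\<close> on the total space in which \<open>\<alpha>\<close>, seen in the chart \<open>b\<close>, is the linear map \<open>\<pi>\<close> up to
  the translation \<open>y0\<close>. The section \<open>\<sigma>\<close> of \<open>\<pi>\<close> singles out a complement of the vertical vectors, the
  kernel of \<open>\<pi>\<close>. The domain is stable under contraction of the fibres onto this complement and under
  contraction of everything to the origin.
\<close>

locale adapted_coordinates = coordinate_system A W T \<phi> \<xi>
  for A :: "('p::{t2_space,second_countable_topology}, 'g::euclidean_space) chart set"
    and W and T :: "'g set" and \<phi> \<xi> +
  fixes B :: "('m::{t2_space,second_countable_topology}, 'e::euclidean_space) chart set"
    and \<alpha> :: "'p \<Rightarrow> 'm" and b :: "('m, 'e) chart" and y0 :: 'e
    and \<pi> :: "'g \<Rightarrow> 'e" and \<sigma> :: "'e \<Rightarrow> 'g"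
  assumes base_atlas: "smooth_atlas B" and \<alpha>_smooth: "smooth_map_on A B UNIV \<alpha>"
    and b: "b \<in> B" and \<alpha>_b: "\<And>p. p \<in> W \<Longrightarrow> \<alpha> p \<in> fst b"
    and \<alpha>_linear: "\<And>z. z \<in> T \<Longrightarrow> snd b (\<alpha> (\<xi> z)) = y0 + \<pi> z"
    and linear_\<pi>: "linear \<pi>" and linear_\<sigma>: "linear \<sigma>" and \<pi>_\<sigma>: "\<And>y. \<pi> (\<sigma> y) = y"
    and fibre_contraction: "\<And>t z. 0 \<le> t \<Longrightarrow> t \<le> 1 \<Longrightarrow> z \<in> T \<Longrightarrow> contraction (\<lambda>z. \<sigma> (\<pi> z)) t z \<in> T"
    and point_contraction: "\<And>t z. 0 \<le> t \<Longrightarrow> t \<le> 1 \<Longrightarrow> z \<in> T \<Longrightarrow> contraction (\<lambda>z. 0) t z \<in> T"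
begin

lemma \<pi>_has_derivative: "((\<lambda>z. y0 + \<pi> z) has_derivative \<pi>) (at z)"
  using linear_imp_has_derivative[OF linear_\<pi>] by (auto intro!: derivative_eq_intros)

lemma vertical_field_in_coordinates:
  assumes Y: "Y \<in> vertical_fields A B \<alpha> W" and c: "c \<in> A" and x: "x \<in> chart_img c W"
  shows "\<pi> (frechet_derivative (\<lambda>x. \<phi> (chart_inv c x)) (at x) (Y c x)) = 0"
proof -
  have p: "chart_inv c x \<in> fst c" "chart_inv c x \<in> W" "snd c (chart_inv c x) = x"
    using x chart_img_iff[OF atlas c] by auto
  then have "chart_inv c x \<in> fst c \<inter> W \<inter> \<alpha> -` fst b" using \<alpha>_b by auto
  with Y c b have "coord_deriv c b \<alpha> (snd c (chart_inv c x)) (Y c (snd c (chart_inv c x))) = 0"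
    unfolding vertical_fields_def by blast
  then have "coord_deriv c b \<alpha> x (Y c x) = 0" by (simp only: p(3))
  moreover have "coord_deriv c b \<alpha> x
      = frechet_derivative (\<lambda>x. y0 + \<pi> (\<phi> (chart_inv c x))) (at x)"
  proof (rule frechet_derivative_cong_open[OF open_chart_img[OF atlas c openW] x])
    fix y assume "y \<in> chart_img c W"
    then have "chart_inv c y \<in> W" using chart_img_iff[OF atlas c] by auto
    then show "coord_rep c b \<alpha> y = y0 + \<pi> (\<phi> (chart_inv c y))"
      using \<alpha>_linear[OF maps] by (simp add: coord_rep_def inv_left)
  qed
  moreover have "frechet_derivative (\<lambda>x. y0 + \<pi> (\<phi> (chart_inv c x))) (at x)
      = (\<lambda>v. \<pi> (frechet_derivative (\<lambda>x. \<phi> (chart_inv c x)) (at x) v))"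
    by (rule frechet_derivative_at[symmetric],
        rule has_derivative_compose[OF smooth_on_has_derivative[OF smooth[OF c] x] \<pi>_has_derivative])
  ultimately show ?thesis by simp
qed

text \<open>
  In the coordinates, \<open>d \<circ> \<alpha>\<close> is a change of charts on the base after \<open>y0 + \<pi>\<close>; so its derivative
  kills the kernel of \<open>\<pi>\<close>, in whichever charts it is computed.
\<close>

lemma vertical_push_forward:
  assumes c: "c \<in> A" and d: "d \<in> B" and p: "p \<in> fst c" "p \<in> W" "\<alpha> p \<in> fst d" and u: "\<pi> u = 0"
  shows "coord_deriv c d \<alpha> (snd c p) (frechet_derivative (\<lambda>z. snd c (\<xi> z)) (at (\<phi> p)) u) = 0"
proof -
  have cont\<alpha>: "continuous_on UNIV \<alpha>" using \<alpha>_smooth by (simp add: smooth_map_on_def)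
  let ?N = "T \<inter> \<xi> -` (fst c \<inter> \<alpha> -` fst d)"
  have "open (fst c \<inter> \<alpha> -` fst d)"
    using smooth_atlas_chart(1)[OF atlas c] smooth_atlas_chart(1)[OF base_atlas d] cont\<alpha>
    by (intro open_Int open_vimage)
  then have N: "open ?N" "\<phi> p \<in> ?N"
    using p maps inv_left by (auto intro!: open_inv_vimage simp del: vimage_Int)
  have 1: "((\<lambda>z. snd c (\<xi> z)) has_derivative frechet_derivative (\<lambda>z. snd c (\<xi> z)) (at (\<phi> p))) (at (\<phi> p))"
    by (rule smooth_on_has_derivative[OF inv_smooth[OF c]]) (use N in auto)
  have 2: "(coord_rep c d \<alpha> has_derivative coord_deriv c d \<alpha> (snd c p)) (at (snd c (\<xi> (\<phi> p))))"
    using smooth_on_has_derivative[OF smooth_map_on_coord_rep[OF \<alpha>_smooth c d], of "snd c p"]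
      p inv_left by (auto intro: chart_in_chart_img)
  have "\<alpha> p \<in> fst b" using \<alpha>_b p by auto
  moreover have "snd b (\<alpha> p) = y0 + \<pi> (\<phi> p)" using \<alpha>_linear[OF maps] p inv_left by auto
  ultimately have "y0 + \<pi> (\<phi> p) \<in> chart_img b (fst d)" using p by (metis chart_in_chart_img)
  from smooth_on_has_derivative[OF smooth_atlas_transition[OF base_atlas b d] this]
  have 3: "(coord_rep b d id has_derivative coord_deriv b d id (y0 + \<pi> (\<phi> p))) (at (y0 + \<pi> (\<phi> p)))" .
  have "(\<lambda>v. coord_deriv c d \<alpha> (snd c p) (frechet_derivative (\<lambda>z. snd c (\<xi> z)) (at (\<phi> p)) v))
      = frechet_derivative (\<lambda>z. coord_rep c d \<alpha> (snd c (\<xi> z))) (at (\<phi> p))"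
    by (rule frechet_derivative_at[OF has_derivative_compose[OF 1 2]])
  also have "\<dots> = frechet_derivative (\<lambda>z. coord_rep b d id (y0 + \<pi> z)) (at (\<phi> p))"
  proof (rule frechet_derivative_cong_open[OF N])
    fix z assume z: "z \<in> ?N"
    then have "\<alpha> (\<xi> z) \<in> fst b" using inv_maps \<alpha>_b by auto
    then show "coord_rep c d \<alpha> (snd c (\<xi> z)) = coord_rep b d id (y0 + \<pi> z)"
      using z chart_inv_chart[OF atlas c] chart_inv_chart[OF base_atlas b]
      by (auto simp: coord_rep_def \<alpha>_linear[symmetric])
  qed
  also have "\<dots> = (\<lambda>v. coord_deriv b d id (y0 + \<pi> (\<phi> p)) (\<pi> v))"
    by (rule frechet_derivative_at[symmetric], rule has_derivative_compose[OF \<pi>_has_derivative 3])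
  finally show ?thesis
    using u linear_0[OF has_derivative_linear[OF 3]] by (simp add: fun_eq_iff)
qed

text \<open>
  The definition of affine forms tests global vertical fields only. To make it a pointwise
  condition, a vertical vector is extended constantly in the coordinates, multiplied by a bump function
  and continued by zero. The field vanishes off the image of a closed ball, which is compact and hence
  closed in the Hausdorff total space; this makes the continuation smooth.
\<close>

lemma vertical_field_extension:
  assumes z0: "z0 \<in> T" and u: "\<pi> u = 0"
    and a: "a \<in> A" "\<xi> z0 \<in> fst a"
  obtains Y where "Y \<in> vertical_fields A B \<alpha> UNIV"
    and "Y a (snd a (\<xi> z0)) = frechet_derivative (\<lambda>z. snd a (\<xi> z)) (at z0) u"
proof -
  obtain r where r: "r > 0" "cball z0 r \<subseteq> T" using openT z0 open_contains_cball by blast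
  obtain \<beta> :: "'g \<Rightarrow> real" where \<beta>: "smooth_on UNIV \<beta>" "\<beta> z0 \<noteq> 0" "\<And>z. z \<notin> ball z0 r \<Longrightarrow> \<beta> z = 0"
    using smooth_bump_exists[OF r(1)] by blast
  define Y :: "('p, 'g) vfield" where "Y c x = (if chart_inv c x \<in> W
      then (\<beta> (\<phi> (chart_inv c x)) / \<beta> z0) *\<^sub>R
        frechet_derivative (\<lambda>z. snd c (\<xi> z)) (at (\<phi> (chart_inv c x))) u else 0)" for c x
  define K where "K = \<xi> ` cball z0 r"
  have "compact K" unfolding K_def
    by (rule compact_continuous_image[OF continuous_on_subset[OF inv_continuous r(2)] compact_cball])
  then have openK: "open (- K)" by (simp add: compact_imp_closed open_Compl)
  have YK: "Y c x = 0" if "chart_inv c x \<notin> K" for c x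
  proof (cases "chart_inv c x \<in> W")
    case True
    then have "\<phi> (chart_inv c x) \<notin> cball z0 r" using that inv_left unfolding K_def by force
    then show ?thesis using \<beta>(3)[of "\<phi> (chart_inv c x)"] by (auto simp: Y_def)
  qed (simp add: Y_def)
  have smoothY: "smooth_on (chart_img c UNIV) (Y c)" if c: "c \<in> A" for c
  proof (rule smooth_on_local)
    fix x assume x: "x \<in> chart_img c UNIV"
    show "\<exists>N. open N \<and> x \<in> N \<and> smooth_on N (Y c)"
    proof (cases "chart_inv c x \<in> W")
      case True
      let ?N = "chart_img c W"
      have N: "open ?N" "x \<in> ?N"
        using open_chart_img[OF atlas c openW] True x chart_img_iff[OF atlas c] by auto
      have 1: "smooth_on ?N (\<lambda>x. (1 / \<beta> z0) *\<^sub>R \<beta> (\<phi> (chart_inv c x)))"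
        by (intro smooth_on_scaleR smooth_on_const N(1)
            smooth_on_compose[OF N(1) open_UNIV smooth[OF c] \<beta>(1)]) auto
      have 2: "smooth_on ?N (\<lambda>x. frechet_derivative (\<lambda>z. snd c (\<xi> z)) (at (\<phi> (chart_inv c x))) u)"
        by (rule smooth_on_compose[OF N(1) open_inv_vimage[OF smooth_atlas_chart(1)[OF atlas c]] smooth[OF c]
              smooth_on_frechet_derivative[OF inv_smooth[OF c]]])
          (auto simp: chart_img_iff[OF atlas c] inv_left maps)
      have "smooth_on ?N (Y c)"
        by (rule smooth_on_cong[OF smooth_on_scaleR[OF N(1) 1 2] N(1)])
          (auto simp: Y_def chart_img_iff[OF atlas c])
      with N show ?thesis by blast
    next
      case False
      \<comment> \<open>Here the field vanishes near \<open>x\<close>, since the point lies off the closed set \<open>K\<close>.\<close>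
      let ?N = "chart_img c (- K)"
      have "chart_inv c x \<notin> K" using False r(2) inv_maps unfolding K_def by auto
      then have N: "open ?N" "x \<in> ?N"
        using open_chart_img[OF atlas c openK] x chart_img_iff[OF atlas c] by auto
      have "smooth_on ?N (Y c)"
        by (rule smooth_on_cong[OF smooth_on_const[OF N(1), of 0] N(1)])
          (auto simp: YK chart_img_iff[OF atlas c])
      with N show ?thesis by blast
    qed
  qed
  have compat: "Y c' (snd c' p) = coord_deriv c c' id (snd c p) (Y c (snd c p))"
    if c: "c \<in> A" "c' \<in> A" and p: "p \<in> fst c" "p \<in> fst c'" for c c' p
  proof -
    have i: "chart_inv c (snd c p) = p" "chart_inv c' (snd c' p) = p"
      using chart_inv_chart[OF atlas] c p by auto
    have t: "(coord_rep c c' id has_derivative coord_deriv c c' id (snd c p)) (at (snd c p))"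
      by (rule smooth_on_has_derivative[OF smooth_atlas_transition[OF atlas c]])
        (use p in \<open>auto intro: chart_in_chart_img\<close>)
    note lin = has_derivative_linear[OF t]
    show ?thesis
    proof (cases "p \<in> W")
      case False
      then show ?thesis by (simp add: Y_def i linear_0[OF lin])
    next
      case True
      let ?N = "T \<inter> \<xi> -` (fst c \<inter> fst c')"
      have "open (fst c \<inter> fst c')"
        by (intro open_Int smooth_atlas_chart(1)[OF atlas] c)
      then have N: "open ?N" "\<phi> p \<in> ?N"
        using p True maps inv_left by (auto intro!: open_inv_vimage simp del: vimage_Int)
      have 1: "((\<lambda>z. snd c (\<xi> z)) has_derivative
          frechet_derivative (\<lambda>z. snd c (\<xi> z)) (at (\<phi> p))) (at (\<phi> p))"
        by (rule smooth_on_has_derivative[OF inv_smooth[OF c(1)]]) (use N in auto)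
      have "frechet_derivative (\<lambda>z. snd c' (\<xi> z)) (at (\<phi> p))
          = frechet_derivative (\<lambda>z. coord_rep c c' id (snd c (\<xi> z))) (at (\<phi> p))"
        by (rule frechet_derivative_cong_open[OF N])
          (auto simp: coord_rep_def chart_inv_chart[OF atlas c(1)])
      also have "\<dots> = (\<lambda>v. coord_deriv c c' id (snd c p)
          (frechet_derivative (\<lambda>z. snd c (\<xi> z)) (at (\<phi> p)) v))"
        by (rule frechet_derivative_at[symmetric], rule has_derivative_compose[OF 1])
          (simp only: inv_left[OF True] t)
      finally have e: "frechet_derivative (\<lambda>z. snd c' (\<xi> z)) (at (\<phi> p)) u
          = coord_deriv c c' id (snd c p) (frechet_derivative (\<lambda>z. snd c (\<xi> z)) (at (\<phi> p)) u)"
        by (rule fun_cong)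
      have Yp: "Y d (snd d p) = (\<beta> (\<phi> p) / \<beta> z0) *\<^sub>R frechet_derivative (\<lambda>z. snd d (\<xi> z)) (at (\<phi> p)) u"
        if "chart_inv d (snd d p) = p" for d
        using that True by (simp add: Y_def)
      show ?thesis
        unfolding Yp[OF i(1)] Yp[OF i(2)] e by (rule linear_scale[OF lin, symmetric])
    qed
  qed
  have vert: "coord_deriv c d \<alpha> (snd c p) (Y c (snd c p)) = 0"
    if c: "c \<in> A" and d: "d \<in> B" and p: "p \<in> fst c" "\<alpha> p \<in> fst d" for c d p
  proof -
    have "(coord_rep c d \<alpha> has_derivative coord_deriv c d \<alpha> (snd c p)) (at (snd c p))"
      by (rule smooth_on_has_derivative[OF smooth_map_on_coord_rep[OF \<alpha>_smooth c d]])
        (use p in \<open>auto intro: chart_in_chart_img\<close>)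
    note lin = has_derivative_linear[OF this]
    show ?thesis
    proof (cases "p \<in> W")
      case True
      then show ?thesis
        using vertical_push_forward[OF c d p(1) True p(2) u]
        by (simp add: Y_def chart_inv_chart[OF atlas c p(1)] linear_scale[OF lin])
    next
      case False
      then show ?thesis by (simp add: Y_def chart_inv_chart[OF atlas c p(1)] linear_0[OF lin])
    qed
  qed
  show thesis
  proof (rule that)
    show "Y \<in> vertical_fields A B \<alpha> UNIV"
      unfolding vertical_fields_def vector_fields_def
    proof (intro CollectI conjI ballI)
      show "smooth_on (chart_img c UNIV) (Y c)" if "c \<in> A" for c by (rule smoothY[OF that])
      show "Y c' (snd c' p) = coord_deriv c c' id (snd c p) (Y c (snd c p))"
        if "c \<in> A" "c' \<in> A" "p \<in> fst c \<inter> fst c' \<inter> UNIV" for c c' p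
        using compat[OF that(1,2)] that(3) by blast
      show "coord_deriv c d \<alpha> (snd c p) (Y c (snd c p)) = 0"
        if "c \<in> A" "d \<in> B" "p \<in> fst c \<inter> UNIV \<inter> \<alpha> -` fst d" for c d p
        using vert[OF that(1,2)] that(3) by blast
    qed
    show "Y a (snd a (\<xi> z0)) = frechet_derivative (\<lambda>z. snd a (\<xi> z)) (at z0) u"
      using chart_inv_chart[OF atlas a] inv_maps[OF z0] inv_right[OF z0] \<beta>(2) by (simp add: Y_def)
  qed
qed

text \<open>
  Forms that vanish as soon as \<open>m\<close> of their arguments are vertical; it is enough to say this for the
  leading arguments, as the forms of interest are alternating.
\<close>

definition vertically_null :: "nat \<Rightarrow> ('g \<Rightarrow> 'g list \<Rightarrow> real) \<Rightarrow> bool" where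
  "vertically_null m f \<longleftrightarrow> (\<forall>z\<in>T. \<forall>us vs. length us = m \<longrightarrow> (\<forall>u\<in>set us. \<pi> u = 0) \<longrightarrow> f z (us @ vs) = 0)"

text \<open>
  Iterated interior products feed the fields to the form in reverse order, so the extended vectors
  are listed backwards.
\<close>

lemma Lambda_forms_vertically_null:
  assumes \<omega>: "\<omega> \<in> Lambda_forms A B \<alpha> l k UNIV" and kl: "l \<le> k" and a: "a \<in> A" "W \<subseteq> fst a"
  shows "vertically_null (k - l + 1) (pullback (\<lambda>z. snd a (\<xi> z)) (\<omega> a))"
  unfolding vertically_null_def
proof (intro ballI allI impI)
  fix z us and vs :: "'g list" assume z: "z \<in> T" and len: "length us = k - l + 1" and us: "\<forall>u\<in>set us. \<pi> u = 0"
  let ?A = "frechet_derivative (\<lambda>z. snd a (\<xi> z)) (at z)"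
  have ex: "\<exists>Y. Y \<in> vertical_fields A B \<alpha> UNIV \<and> Y a (snd a (\<xi> z)) = ?A u" if u: "\<pi> u = 0" for u
  proof -
    have "\<xi> z \<in> fst a" using a(2) inv_maps[OF z] by auto
    from vertical_field_extension[OF z u a(1) this] show ?thesis by blast
  qed
  obtain Y where Y: "\<And>u. \<pi> u = 0 \<Longrightarrow> Y u \<in> vertical_fields A B \<alpha> UNIV"
    "\<And>u. \<pi> u = 0 \<Longrightarrow> Y u a (snd a (\<xi> z)) = ?A u" using ex by metis
  have x: "snd a (\<xi> z) \<in> chart_img a UNIV" using inv_maps[OF z] a(2) by (auto intro!: chart_in_chart_img)
  have "form_eq_on A UNIV (foldr interior_prod (rev (map Y us)) \<omega>) zero_form"
  proof -
    have "length (rev (map Y us)) = k - l + 1" "set (rev (map Y us)) \<subseteq> vertical_fields A B \<alpha> UNIV"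
      using len us Y(1) by auto
    moreover have "\<not> k < l" using kl by simp
    ultimately show ?thesis using \<omega> unfolding Lambda_forms_def by (simp only: mem_Collect_eq if_False)
  qed
  then have "foldr interior_prod (rev (map Y us)) \<omega> a (snd a (\<xi> z)) (map ?A vs) = 0"
    using a(1) x by (simp add: form_eq_on_def zero_form_def)
  then have "\<omega> a (snd a (\<xi> z)) (map (\<lambda>u. Y u a (snd a (\<xi> z))) us @ map ?A vs) = 0"
    by (simp add: foldr_interior_prod rev_map[symmetric] o_def)
  also have "map (\<lambda>u. Y u a (snd a (\<xi> z))) us = map ?A us" using us Y(2) by simp
  finally show "pullback (\<lambda>z. snd a (\<xi> z)) (\<omega> a) z (us @ vs) = 0" by (simp add: pullback_def)
qed

lemma vertically_null_Lambda_forms: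
  assumes f: "form_on k T f" "vertically_null (k - l + 1) f" and kl: "l \<le> k"
  shows "manifold_pullback \<phi> f \<in> Lambda_forms A B \<alpha> l k W"
proof -
  have "foldr interior_prod Ys (manifold_pullback \<phi> f) c x vs = 0"
    if Ys: "length Ys = k - l + 1" "set Ys \<subseteq> vertical_fields A B \<alpha> W"
      and c: "c \<in> A" and x: "x \<in> chart_img c W" for Ys c x vs
  proof -
    let ?D = "frechet_derivative (\<lambda>x. \<phi> (chart_inv c x)) (at x)"
    have "\<phi> (chart_inv c x) \<in> T" using x chart_img_iff[OF atlas c] maps by auto
    moreover have "\<forall>u\<in>set (map ?D (rev (map (\<lambda>Y. Y c x) Ys))). \<pi> u = 0"
      using vertical_field_in_coordinates[OF _ c x] Ys(2) by auto
    ultimately have "f (\<phi> (chart_inv c x)) (map ?D (rev (map (\<lambda>Y. Y c x) Ys)) @ map ?D vs) = 0"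
      using f(2) Ys(1) unfolding vertically_null_def by simp
    then show ?thesis by (simp add: foldr_interior_prod manifold_pullback_def pullback_def)
  qed
  then show ?thesis
    unfolding Lambda_forms_def using manifold_pullback_diff_forms[OF f(1)] kl
    by (auto simp: form_eq_on_def zero_form_def fun_eq_iff)
qed

end

section \<open>Existence of adapted coordinates\<close>

text \<open>
  A local trivialisation of the bundle followed by charts of base and fibre. Smoothness is
  stated in every chart of the total space because fields and forms on it are families indexed by all
  charts.
\<close>

lemma fiber_bundle_product_coordinates:
  fixes A :: "('p::{t2_space,second_countable_topology}, 'g::euclidean_space) chart set"
    and B :: "('m::{t2_space,second_countable_topology}, 'e::euclidean_space) chart set"
    and C :: "('f::{t2_space,second_countable_topology}, 'h::real_inner) chart set"
  assumes fib: "fiber_bundle A B C \<alpha>" and a: "a \<in> A" "p0 \<in> fst a"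
  obtains W and N :: "('e \<times> 'h) set" and \<Phi> \<Xi> b where "open W" "p0 \<in> W" "W \<subseteq> fst a" "open N"
    and "\<And>p. p \<in> W \<Longrightarrow> \<Phi> p \<in> N" "\<And>w. w \<in> N \<Longrightarrow> \<Xi> w \<in> W"
    and "\<And>p. p \<in> W \<Longrightarrow> \<Xi> (\<Phi> p) = p" "\<And>w. w \<in> N \<Longrightarrow> \<Phi> (\<Xi> w) = w"
    and "continuous_on W \<Phi>" "continuous_on N \<Xi>"
    and "\<And>c. c \<in> A \<Longrightarrow> smooth_on (chart_img c W) (\<lambda>x. \<Phi> (chart_inv c x))"
    and "\<And>c. c \<in> A \<Longrightarrow> smooth_on (N \<inter> \<Xi> -` fst c) (\<lambda>w. snd c (\<Xi> w))"
    and "b \<in> B" "\<And>p. p \<in> W \<Longrightarrow> \<alpha> p \<in> fst b" "\<And>p. p \<in> W \<Longrightarrow> fst (\<Phi> p) = snd b (\<alpha> p)"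
proof -
  have atlases: "smooth_atlas A" "smooth_atlas B" "smooth_atlas C" and sm\<alpha>: "smooth_map_on A B UNIV \<alpha>"
    using fib by (auto simp: fiber_bundle_def)
  have "\<exists>U \<psi>. open U \<and> \<alpha> p0 \<in> U \<and>
        diffeo_betw A (prod_atlas B C) (\<alpha> -` U) (U \<times> UNIV) \<psi> \<and>
        (\<forall>p\<in>\<alpha> -` U. fst (\<psi> p) = \<alpha> p)"
    using fib unfolding fiber_bundle_def by blast
  then obtain U \<psi> where U: "open U" "\<alpha> p0 \<in> U"
    and \<psi>: "diffeo_betw A (prod_atlas B C) (\<alpha> -` U) (U \<times> UNIV) \<psi>"
    and fst\<psi>: "\<And>p. \<alpha> p \<in> U \<Longrightarrow> fst (\<psi> p) = \<alpha> p"
    by auto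
  define \<Psi> where "\<Psi> = inv_into (\<alpha> -` U) \<psi>"
  have bij: "bij_betw \<psi> (\<alpha> -` U) (U \<times> UNIV)" and sm\<psi>: "smooth_map_on A (prod_atlas B C) (\<alpha> -` U) \<psi>"
    and sm\<Psi>: "smooth_map_on (prod_atlas B C) A (U \<times> UNIV) \<Psi>"
    using \<psi> by (auto simp: diffeo_betw_def \<Psi>_def)
  have \<Psi>\<psi>: "\<Psi> (\<psi> p) = p" if "\<alpha> p \<in> U" for p
    using bij_betw_inv_into_left[OF bij] that by (simp add: \<Psi>_def)
  have \<psi>\<Psi>: "\<psi> (\<Psi> m) = m" and \<Psi>U: "\<alpha> (\<Psi> m) \<in> U" if "fst m \<in> U" for m
    using bij_betw_inv_into_right[OF bij, of m] bij_betw_apply[OF bij_betw_inv_into[OF bij], of m] that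
    by (auto simp: \<Psi>_def mem_Times_iff)
  obtain b where b: "b \<in> B" "\<alpha> p0 \<in> fst b" using smooth_atlas_covers[OF atlases(2)] by blast
  obtain c where c: "c \<in> C" "snd (\<psi> p0) \<in> fst c" using smooth_atlas_covers[OF atlases(3)] by blast
  define e where "e = (fst b \<times> fst c, map_prod (snd b) (snd c))"
  have e: "e \<in> prod_atlas B C" unfolding prod_atlas_def e_def using b(1) c(1) by force
  have inve: "chart_inv e (snd e m) = m" if "m \<in> fst e" for m
  proof -
    have "inj_on (snd b) (fst b)" "inj_on (snd c) (fst c)"
      using chart_inv_chart[OF atlases(2) b(1)] chart_inv_chart[OF atlases(3) c(1)]
      by (auto intro: inj_on_inverseI)
    then have "inj_on (snd e) (fst e)" by (simp add: e_def map_prod_inj_on)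
    then show ?thesis using that by (simp add: chart_inv_def)
  qed
  define \<Phi> where "\<Phi> p = snd e (\<psi> p)" for p
  define \<Xi> where "\<Xi> w = \<Psi> (chart_inv e w)" for w
  define N1 where "N1 = chart_img b U \<times> chart_img c UNIV"
  have N1: "\<exists>m. m \<in> fst e \<and> fst m \<in> U \<and> w = snd e m" if "w \<in> N1" for w
    using that unfolding N1_def chart_img_def e_def by (cases w) force
  have openN1: "open N1"
    unfolding N1_def
    by (intro open_Times open_chart_img[OF atlases(2) b(1) U(1)] open_chart_img[OF atlases(3) c(1) open_UNIV])
  have "continuous_on (chart_img b UNIV) (chart_inv b)" "continuous_on (chart_img c UNIV) (chart_inv c)"
    using homeomorphism_cont2[OF smooth_atlas_chart(2)[OF atlases(2) b(1)]]
      homeomorphism_cont2[OF smooth_atlas_chart(2)[OF atlases(3) c(1)]] by auto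
  then have "continuous_on N1 (\<lambda>w. chart_inv b (fst w))" "continuous_on N1 (\<lambda>w. chart_inv c (snd w))"
    by (auto intro!: continuous_intros elim!: continuous_on_compose2 simp: N1_def chart_img_def)
  then have "continuous_on N1 (\<lambda>w. (chart_inv b (fst w), chart_inv c (snd w)))"
    by (rule continuous_on_Pair)
  moreover have "(chart_inv b (fst w), chart_inv c (snd w)) = chart_inv e w" if "w \<in> N1" for w
    using N1[OF that] inve chart_inv_chart[OF atlases(2) b(1)] chart_inv_chart[OF atlases(3) c(1)]
    by (auto simp: e_def)
  ultimately have "continuous_on N1 (chart_inv e)" by (rule continuous_on_eq)
  then have cont\<Xi>: "continuous_on N1 \<Xi>"
    unfolding \<Xi>_def
  proof (rule continuous_on_compose2[rotated])
    show "continuous_on (U \<times> UNIV) \<Psi>" using sm\<Psi> by (simp add: smooth_map_on_def)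
    show "chart_inv e ` N1 \<subseteq> U \<times> UNIV" using N1 inve by (force simp: mem_Times_iff)
  qed
  have cont\<alpha>: "continuous_on UNIV \<alpha>" using sm\<alpha> by (simp add: smooth_map_on_def)
  have cont\<psi>: "continuous_on (\<alpha> -` U) \<psi>" using sm\<psi> by (simp add: smooth_map_on_def)
  have opene: "open (fst e)"
    unfolding e_def using smooth_atlas_chart(1)[OF atlases(2) b(1)] smooth_atlas_chart(1)[OF atlases(3) c(1)]
    by (simp add: open_Times)
  have conte: "continuous_on (fst e) (snd e)"
    using homeomorphism_cont1[OF smooth_atlas_chart(2)[OF atlases(2) b(1)]]
      homeomorphism_cont1[OF smooth_atlas_chart(2)[OF atlases(3) c(1)]]
    unfolding e_def map_prod_def
    by (auto simp: case_prod_unfold intro!: continuous_on_Pair continuous_intros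
        elim: continuous_on_compose2)
  define W where "W = (\<alpha> -` U \<inter> \<psi> -` fst e) \<inter> fst a"
  define N where "N = N1 \<inter> \<Xi> -` fst a"
  have \<alpha>b: "\<alpha> p \<in> fst b" if "p \<in> W" for p
    using that fst\<psi>[of p] by (auto simp: W_def e_def mem_Times_iff)
  show thesis
  proof (rule that[of W N \<Phi> \<Xi> b])
    show "open W"
      unfolding W_def
      by (intro open_Int continuous_open_preimage[OF cont\<psi> _ opene] open_vimage[OF U(1) cont\<alpha>]
          smooth_atlas_chart(1)[OF atlases(1) a(1)])
    show "p0 \<in> W" using a(2) U(2) b(2) c(2) fst\<psi>[OF U(2)] by (simp add: W_def e_def mem_Times_iff)
    show "W \<subseteq> fst a" by (simp add: W_def)
    show "open N"
      unfolding N_def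
      by (rule continuous_open_preimage[OF cont\<Xi> openN1 smooth_atlas_chart(1)[OF atlases(1) a(1)]])
    show inv1: "\<Xi> (\<Phi> p) = p" if "p \<in> W" for p
      using that by (simp add: W_def \<Xi>_def \<Phi>_def inve \<Psi>\<psi>)
    show inv2: "\<Phi> (\<Xi> w) = w" if "w \<in> N" for w
      using that N1[of w] by (auto simp: N_def \<Xi>_def \<Phi>_def inve \<psi>\<Psi>)
    show "\<Phi> p \<in> N" if p: "p \<in> W" for p
    proof -
      have "\<psi> p \<in> fst e" "fst (\<psi> p) \<in> U" using p fst\<psi>[of p] by (auto simp: W_def)
      then have "\<Phi> p \<in> N1" unfolding \<Phi>_def N1_def e_def chart_img_def by (cases "\<psi> p") auto
      then show ?thesis using inv1[OF p] p by (simp add: N_def W_def)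
    qed
    show "\<Xi> w \<in> W" if "w \<in> N" for w
      using that N1[of w] by (auto simp: N_def W_def \<Xi>_def inve \<psi>\<Psi> \<Psi>U)
    show "continuous_on W \<Phi>"
      unfolding \<Phi>_def
      by (rule continuous_on_compose2[OF conte continuous_on_subset[OF cont\<psi>]]) (auto simp: W_def)
    show "continuous_on N \<Xi>" by (rule continuous_on_subset[OF cont\<Xi>]) (auto simp: N_def)
    show "smooth_on (chart_img c' W) (\<lambda>x. \<Phi> (chart_inv c' x))" if "c' \<in> A" for c'
    proof -
      have "(\<lambda>x. \<Phi> (chart_inv c' x)) = coord_rep c' e \<psi>" by (auto simp: \<Phi>_def coord_rep_def)
      then show ?thesis
        using smooth_on_subset[OF smooth_map_on_coord_rep[OF sm\<psi> that e], of "chart_img c' W"]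
        by (auto simp: chart_img_def W_def)
    qed
    show "smooth_on (N \<inter> \<Xi> -` fst c') (\<lambda>w. snd c' (\<Xi> w))" if "c' \<in> A" for c'
    proof -
      have "w \<in> chart_img e (U \<times> UNIV \<inter> \<Psi> -` fst c')" if "w \<in> N \<inter> \<Xi> -` fst c'" for w
        using that N1[of w] unfolding chart_img_def by (auto simp: N_def \<Xi>_def inve mem_Times_iff)
      moreover have "(\<lambda>w. snd c' (\<Xi> w)) = coord_rep e c' \<Psi>" by (auto simp: \<Xi>_def coord_rep_def)
      ultimately show ?thesis
        using smooth_on_subset[OF smooth_map_on_coord_rep[OF sm\<Psi> e that], of "N \<inter> \<Xi> -` fst c'"]
        by (metis subsetI)
    qed
    show "b \<in> B" by (rule b(1))
    show "\<alpha> p \<in> fst b" if "p \<in> W" for p by (rule \<alpha>b[OF that])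
    show "fst (\<Phi> p) = snd b (\<alpha> p)" if "p \<in> W" for p
      using that fst\<psi>[of p] by (simp add: \<Phi>_def e_def W_def)
  qed
qed

text \<open>
  The product coordinates \<open>\<Phi>\<close> take values in \<open>'e \<times> 'h\<close>. Composing them with the inverse \<open>M\<close> of the
  derivative \<open>L\<close> of \<open>\<Phi>\<close>, computed in the chart \<open>a\<close>, brings them back to the model space of \<open>P\<close> by a linear
  map. This avoids comparing dimensions, and the projection to the base stays linear: it becomes
  \<open>fst \<circ> L\<close>. Finally the coordinates are restricted to a box around the origin, bounded separately along
  the base and along the fibre, which is stable under both contractions.
\<close>

lemma adapted_coordinates_exist:
  fixes A :: "('p::{t2_space,second_countable_topology}, 'g::euclidean_space) chart set"
    and B :: "('m::{t2_space,second_countable_topology}, 'e::euclidean_space) chart set"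
    and C :: "('f::{t2_space,second_countable_topology}, 'h::real_inner) chart set"
  assumes fib: "fiber_bundle A B C \<alpha>" and a: "a \<in> A" "p0 \<in> fst a"
  obtains W T \<phi> \<xi> b y0 \<pi> \<sigma>
    where "adapted_coordinates A W T \<phi> \<xi> B \<alpha> b y0 \<pi> \<sigma>" "p0 \<in> W" "W \<subseteq> fst a"
proof -
  have atlas: "smooth_atlas A" using fib by (simp add: fiber_bundle_def)
  obtain W1 and N :: "('e \<times> 'h) set" and \<Phi> \<Xi> b where W1: "open W1" "p0 \<in> W1" "W1 \<subseteq> fst a" "open N"
    and maps: "\<And>p. p \<in> W1 \<Longrightarrow> \<Phi> p \<in> N" "\<And>w. w \<in> N \<Longrightarrow> \<Xi> w \<in> W1"
    and inv: "\<And>p. p \<in> W1 \<Longrightarrow> \<Xi> (\<Phi> p) = p" "\<And>w. w \<in> N \<Longrightarrow> \<Phi> (\<Xi> w) = w"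
    and cont: "continuous_on W1 \<Phi>" "continuous_on N \<Xi>"
    and smooth: "\<And>c. c \<in> A \<Longrightarrow> smooth_on (chart_img c W1) (\<lambda>x. \<Phi> (chart_inv c x))"
      "\<And>c. c \<in> A \<Longrightarrow> smooth_on (N \<inter> \<Xi> -` fst c) (\<lambda>w. snd c (\<Xi> w))"
    and b: "b \<in> B" "\<And>p. p \<in> W1 \<Longrightarrow> \<alpha> p \<in> fst b" "\<And>p. p \<in> W1 \<Longrightarrow> fst (\<Phi> p) = snd b (\<alpha> p)"
    using fiber_bundle_product_coordinates[OF fib a] by blast
  define w0 where "w0 = \<Phi> p0"
  have w0: "w0 \<in> N" "\<Xi> w0 = p0" using maps(1) inv(1) W1(2) by (auto simp: w0_def)
  have Na: "N \<inter> \<Xi> -` fst a = N" using maps(2) W1(3) by auto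
  define L where "L = frechet_derivative (\<lambda>x. \<Phi> (chart_inv a x)) (at (snd a p0))"
  define M where "M = frechet_derivative (\<lambda>w. snd a (\<Xi> w)) (at w0)"
  have inva: "chart_inv a (snd a p) = p" if "p \<in> fst a" for p by (rule chart_inv_chart[OF atlas a(1) that])
  have L: "((\<lambda>x. \<Phi> (chart_inv a x)) has_derivative L) (at (snd a p0))"
    unfolding L_def
    by (rule smooth_on_has_derivative[OF smooth(1)[OF a(1)]]) (use W1 a in \<open>auto intro: chart_in_chart_img\<close>)
  have M: "((\<lambda>w. snd a (\<Xi> w)) has_derivative M) (at w0)"
    unfolding M_def by (rule smooth_on_has_derivative[OF smooth(2)[OF a(1)]]) (use w0 Na in auto)
  have "((\<lambda>x. snd a (\<Xi> (\<Phi> (chart_inv a x)))) has_derivative (\<lambda>v. M (L v))) (at (snd a p0))"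
    by (rule has_derivative_compose[OF L]) (use M inva a(2) in \<open>simp add: w0_def\<close>)
  then have "((\<lambda>x. x) has_derivative (\<lambda>v. M (L v))) (at (snd a p0))"
    by (rule has_derivative_transform_within_open[OF _ open_chart_img[OF atlas a(1) W1(1)]])
      (use chart_in_chart_img[OF a(2) W1(2)] in \<open>auto simp: chart_img_iff[OF atlas a(1)] inv(1)\<close>)
  \<comment> \<open>\<open>\<Phi>\<close> and \<open>\<Xi>\<close> being inverse to each other, so are their derivatives.\<close>
  then have M_L: "M (L v) = v" for v
    using has_derivative_unique[OF _ has_derivative_ident] by (metis (mono_tags))
  have "((\<lambda>w. \<Phi> (chart_inv a (snd a (\<Xi> w)))) has_derivative (\<lambda>v. L (M v))) (at w0)"
    by (rule has_derivative_compose[OF M]) (use L w0 in simp)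
  then have "((\<lambda>w. w) has_derivative (\<lambda>v. L (M v))) (at w0)"
    by (rule has_derivative_transform_within_open[OF _ W1(4) w0(1)])
      (use maps(2) W1(3) in \<open>auto simp: inva inv(2) subset_iff\<close>)
  then have L_M: "L (M w) = w" for w
    using has_derivative_unique[OF _ has_derivative_ident] by (metis (mono_tags))
  have blL: "bounded_linear L" and blM: "bounded_linear M"
    using L M has_derivative_bounded_linear by auto
  interpret L: bounded_linear L by (rule blL)
  interpret M: bounded_linear M by (rule blM)
  define \<pi> where "\<pi> z = fst (L z)" for z
  define \<sigma> where "\<sigma> y = M (y, 0)" for y
  define P where "P z = \<sigma> (\<pi> z)" for z
  have lin\<pi>: "linear \<pi>" by (rule linearI) (simp_all add: \<pi>_def L.add L.scaleR)
  have lin\<sigma>: "linear \<sigma>" by (rule linearI) (simp_all add: \<sigma>_def M.add[symmetric] M.scaleR[symmetric])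
  have \<pi>\<sigma>: "\<pi> (\<sigma> y) = y" for y by (simp add: \<pi>_def \<sigma>_def L_M)
  have linP: "linear P" unfolding P_def using linear_compose[OF lin\<pi> lin\<sigma>] by (simp add: o_def)
  have PP: "P (P z) = P z" for z by (simp add: P_def \<pi>\<sigma>)
  have contP: "continuous_on UNIV P"
    using linP by (simp add: linear_conv_bounded_linear linear_continuous_on)
  define \<phi> where "\<phi> p = M (\<Phi> p - w0)" for p
  define \<xi> where "\<xi> z = \<Xi> (w0 + L z)" for z
  have "open ((\<lambda>z. w0 + L z) -` N)"
    by (intro open_vimage W1(4) continuous_intros linear_continuous_on blL)
  moreover have "0 \<in> (\<lambda>z. w0 + L z) -` N" by (simp add: L.zero w0)
  ultimately obtain r where r: "r > 0" "ball 0 r \<subseteq> (\<lambda>z. w0 + L z) -` N" by (rule openE)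
  \<comment> \<open>The two bounds add up to the radius \<open>r\<close> of the ball that fits into the domain.\<close>
  define T where "T = {z. norm (P z) < r / 2 \<and> norm (z - P z) < r / 2}"
  have T0: "0 \<in> T" using r(1) by (simp add: T_def linear_0[OF linP])
  have openT: "open T"
    unfolding T_def by (intro open_Collect_conj open_Collect_less continuous_intros contP)
  have TN: "w0 + L z \<in> N" if "z \<in> T" for z
  proof -
    have "norm z \<le> norm (P z) + norm (z - P z)" using norm_triangle_ineq[of "P z" "z - P z"] by simp
    then have "z \<in> ball 0 r" using that by (simp add: T_def)
    then show ?thesis using r(2) by auto
  qed
  define W where "W = W1 \<inter> \<phi> -` T"
  have cont\<phi>: "continuous_on W1 \<phi>"
    unfolding \<phi>_def by (intro bounded_linear.continuous_on[OF blM] continuous_intros cont(1))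
  have openW: "open W" unfolding W_def by (rule continuous_open_preimage[OF cont\<phi> W1(1) openT])
  have \<phi>\<xi>: "\<phi> (\<xi> z) = z" if "z \<in> T" for z
    using TN[OF that] by (simp add: \<phi>_def \<xi>_def inv(2) M_L)
  have \<xi>\<phi>: "\<xi> (\<phi> p) = p" if "p \<in> W1" for p
    using that by (simp add: \<phi>_def \<xi>_def inv(1) L_M)
  have \<xi>W: "\<xi> z \<in> W" if "z \<in> T" for z
    using that maps(2)[OF TN[OF that]] \<phi>\<xi>[OF that] by (simp add: W_def \<xi>_def)
  have cont\<xi>: "continuous_on T \<xi>"
    unfolding \<xi>_def
  proof (rule continuous_on_compose2[OF cont(2)])
    show "continuous_on T (\<lambda>z. w0 + L z)"
      by (rule continuous_on_add[OF continuous_on_const linear_continuous_on[OF blL]])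
  qed (use TN in auto)
  have "adapted_coordinates A W T \<phi> \<xi> B \<alpha> b (fst w0) \<pi> \<sigma>"
  proof (intro adapted_coordinates.intro coordinate_system.intro smooth_vector_map.intro
      coordinate_system_axioms.intro adapted_coordinates_axioms.intro)
    show "smooth_atlas A" "open W" "open T" by (fact atlas openW openT)+
    show "smooth_atlas B" "smooth_map_on A B UNIV \<alpha>" using fib by (auto simp: fiber_bundle_def)
    show "b \<in> B" "linear \<pi>" "linear \<sigma>" "continuous_on T \<xi>" by (fact b(1) lin\<pi> lin\<sigma> cont\<xi>)+
    show "\<pi> (\<sigma> y) = y" for y by (rule \<pi>\<sigma>)
    show "\<phi> p \<in> T" if "p \<in> W" for p using that by (simp add: W_def)
    show "\<xi> z \<in> W" if "z \<in> T" for z by (rule \<xi>W[OF that])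
    show "\<xi> (\<phi> p) = p" if "p \<in> W" for p using that \<xi>\<phi> by (simp add: W_def)
    show "\<phi> (\<xi> z) = z" if "z \<in> T" for z by (rule \<phi>\<xi>[OF that])
    show "smooth_on (chart_img c W) (\<lambda>x. \<phi> (chart_inv c x))" if c: "c \<in> A" for c
    proof -
      have o: "open (chart_img c W1)" by (rule open_chart_img[OF atlas c W1(1)])
      have "smooth_on (chart_img c W1) (\<lambda>x. M (\<Phi> (chart_inv c x) + - w0))"
        by (intro smooth_on_bounded_linear[OF o blM] smooth_on_add[OF o] smooth_on_const[OF o] smooth(1) c)
      then have "smooth_on (chart_img c W1) (\<lambda>x. \<phi> (chart_inv c x))" by (simp add: \<phi>_def)
      then show ?thesis by (rule smooth_on_subset) (auto simp: chart_img_def W_def)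
    qed
    show "smooth_on (T \<inter> \<xi> -` fst c) (\<lambda>z. snd c (\<xi> z))" if c: "c \<in> A" for c
      unfolding \<xi>_def
    proof (rule smooth_on_compose_affine[OF _ _ blL smooth(2)[OF c]])
      show "open (N \<inter> \<Xi> -` fst c)"
        by (rule continuous_open_preimage[OF cont(2) W1(4) smooth_atlas_chart(1)[OF atlas c]])
      show "open (T \<inter> (\<lambda>z. \<Xi> (w0 + L z)) -` fst c)"
        using continuous_open_preimage[OF cont\<xi> openT smooth_atlas_chart(1)[OF atlas c]]
        by (simp add: vimage_def \<xi>_def)
    qed (use TN in auto)
    show "\<alpha> p \<in> fst b" if "p \<in> W" for p using that b(2) by (simp add: W_def)
    show "snd b (\<alpha> (\<xi> z)) = fst w0 + \<pi> z" if "z \<in> T" for z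
      using b(3)[of "\<xi> z"] \<xi>W[OF that] inv(2)[OF TN[OF that]] by (simp add: W_def \<xi>_def \<pi>_def)
    show "contraction (\<lambda>z. \<sigma> (\<pi> z)) t z \<in> T" if t: "0 \<le> t" "t \<le> 1" and z: "z \<in> T" for t z
    proof -
      let ?z = "P z + t *\<^sub>R (z - P z)"
      have "P ?z = P z" by (simp add: linear_add[OF linP] linear_scale[OF linP] linear_diff[OF linP] PP)
      moreover have "norm (t *\<^sub>R (z - P z)) \<le> 1 * norm (z - P z)"
        unfolding norm_scaleR using t by (intro mult_right_mono) auto
      ultimately have "?z \<in> T" using z by (simp add: T_def)
      then show ?thesis by (simp add: contraction_def P_def)
    qed
    show "contraction (\<lambda>z. 0) t z \<in> T" if t: "0 \<le> t" "t \<le> 1" and z: "z \<in> T" for t z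
    proof -
      have "norm (t *\<^sub>R v) \<le> 1 * norm v" for v :: 'g
        unfolding norm_scaleR using t by (intro mult_right_mono) auto
      from this[of "P z"] this[of "z - P z"] have "t *\<^sub>R z \<in> T"
        using z by (simp add: T_def linear_scale[OF linP] flip: scaleR_diff_right)
      then show ?thesis by (simp add: contraction_def)
    qed
  qed
  moreover have "p0 \<in> W" using W1(2) T0 by (simp add: W_def \<phi>_def w0_def M.zero)
  moreover have "W \<subseteq> fst a" using W1(3) by (auto simp: W_def)
  ultimately show thesis by (rule that)
qed


section \<open>Closed affine forms\<close>

context adapted_coordinates
begin

abbreviation base_proj :: "'g \<Rightarrow> 'g" where
  "base_proj z \<equiv> \<sigma> (\<pi> z)"

lemma linear_base_proj: "linear base_proj"
  using linear_compose[OF linear_\<pi> linear_\<sigma>] by (simp add: o_def)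

lemma base_proj_has_derivative: "(base_proj has_derivative base_proj) (at z)"
  by (rule linear_imp_has_derivative[OF linear_base_proj])

lemma base_proj_smooth: "smooth_on T base_proj"
  using smooth_on_affine[OF openT, of base_proj 0] linear_base_proj
  by (simp add: linear_conv_bounded_linear)

lemma base_proj_in: "z \<in> T \<Longrightarrow> base_proj z \<in> T"
  using fibre_contraction[of 0 z] by simp

lemma pullback_base_proj: "pullback base_proj f z vs = f (base_proj z) (map base_proj vs)"
  unfolding pullback_def frechet_derivative_at[OF base_proj_has_derivative, symmetric] ..

lemma form_on_pullback_base_proj: "form_on k T f \<Longrightarrow> form_on k T (pullback base_proj f)"
  by (rule form_on_pullback[OF openT openT _ base_proj_smooth]) (use base_proj_in in auto)

lemma linear_homotopy_base_proj: "form_on k T f \<Longrightarrow> linear_homotopy base_proj T f k"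
  by (rule linear_homotopy.intro[OF linear_base_proj openT _ fibre_contraction])

lemma linear_homotopy_point: "form_on k T f \<Longrightarrow> linear_homotopy (\<lambda>z. 0) T f k"
  by (rule linear_homotopy.intro[OF linear_zero openT _ point_contraction])

text \<open>
  The contraction of the fibres moves points vertically, so \<open>z - base_proj z\<close> uses up one of the
  \<open>Suc m\<close> vertical arguments; and it maps vertical vectors to vertical vectors.
\<close>

lemma homotopy_op_base_proj_null:
  assumes "vertically_null (Suc m) f" "z \<in> T" "length us = m" "\<forall>u\<in>set us. \<pi> u = 0"
  shows "homotopy_op base_proj f z (us @ vs) = 0"
proof (rule homotopy_op_eq_0)
  fix t :: real assume t: "0 \<le> t" "t \<le> 1"
  let ?h = "contraction base_proj t"
  have "\<pi> (?h u) = 0" if "\<pi> u = 0" for u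
    using that by (simp add: contraction_def linear_add[OF linear_\<pi>] linear_scale[OF linear_\<pi>]
        linear_diff[OF linear_\<pi>] \<pi>_\<sigma>)
  then have "\<forall>u\<in>set ((z - base_proj z) # map ?h us). \<pi> u = 0"
    using assms(4) by (auto simp: linear_diff[OF linear_\<pi>] \<pi>_\<sigma>)
  moreover have "length ((z - base_proj z) # map ?h us) = Suc m" using assms(3) by simp
  ultimately have "f (?h z) (((z - base_proj z) # map ?h us) @ map ?h vs) = 0"
    using assms(1) fibre_contraction[OF t assms(2)] unfolding vertically_null_def by blast
  then show "f (?h z) ((z - base_proj z) # map ?h (us @ vs)) = 0" by simp
qed

text \<open>
  Here the homotopy operator of the fibre contraction gives zero, because its first argument is
  already vertical. The homotopy formula then says that \<open>f\<close> equals its pullback by the projection.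
\<close>

lemma closed_horizontal_eq_pullback:
  assumes f: "form_on k T f" and closed: "\<And>z vs. z \<in> T \<Longrightarrow> exd f z vs = 0"
    and null: "vertically_null 1 f" and z: "z \<in> T"
  shows "f z = pullback base_proj f z"
proof
  fix vs
  interpret linear_homotopy base_proj T f k by (rule linear_homotopy_base_proj[OF f])
  show "f z vs = pullback base_proj f z vs"
  proof (cases "length vs = k")
    case True
    have "homotopy_op base_proj f y = (\<lambda>us. 0)" if "y \<in> T" for y
      using homotopy_op_base_proj_null[of 0 f y "[]"] null that by auto
    then have "exd (homotopy_op base_proj f) z vs = exd (\<lambda>y us. 0) z vs"
      using exd_cong_open[OF openT z] by metis
    then have "f z vs - f (base_proj z) (map base_proj vs) = 0"
      using homotopy_formula[OF closed z True] by (simp add: exd_def)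
    then show ?thesis by (simp add: pullback_base_proj)
  next
    case False
    then show ?thesis
      using form_on_wrong_length[OF f z] form_on_wrong_length[OF form_on_pullback_base_proj[OF f] z] by simp
  qed
qed

text \<open>
  The fibre contraction reduces \<open>f\<close> to its pullback under the projection to the base; the
  contraction to the origin then provides a primitive of that pullback.
\<close>

definition primitive :: "('g \<Rightarrow> 'g list \<Rightarrow> real) \<Rightarrow> 'g \<Rightarrow> 'g list \<Rightarrow> real" where
  "primitive f z vs =
     homotopy_op base_proj f z vs + homotopy_op (\<lambda>z. 0) (pullback base_proj f) z vs"

lemma form_on_primitive: "form_on k T f \<Longrightarrow> form_on (k - 1) T (primitive f)"
  unfolding primitive_def
  by (intro form_on_add openT linear_homotopy.form_on_homotopy_op
      linear_homotopy_base_proj linear_homotopy_point form_on_pullback_base_proj)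

text \<open>
  The error term \<open>f\<close> pulled back by \<open>base_proj\<close> of the first homotopy is the main term of the second
  one, whose own error term is evaluated on zero vectors and vanishes in positive degree.
\<close>

lemma exd_primitive:
  assumes f: "form_on k T f" and k: "k > 0" and closed: "\<And>z vs. z \<in> T \<Longrightarrow> exd f z vs = 0"
    and z: "z \<in> T"
  shows "exd (primitive f) z vs = f z vs"
proof (cases "length vs = k")
  case False
  then show ?thesis
    using exd_wrong_length[OF openT z form_on_primitive[OF f]] form_on_wrong_length[OF f z False] k by simp
next
  case True
  interpret h1: linear_homotopy base_proj T f k by (rule linear_homotopy_base_proj[OF f])
  interpret h2: linear_homotopy "\<lambda>z. 0" T "pullback base_proj f" k
    by (rule linear_homotopy_point[OF form_on_pullback_base_proj[OF f]])
  have closed2: "exd (pullback base_proj f) y us = 0" if "y \<in> T" for y us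
    using exd_pullback[OF openT that openT _ base_proj_smooth f, of us] base_proj_in closed that
    by (auto simp: pullback_def)
  have "0 \<in> T" using point_contraction[of 0 z] z by simp
  moreover have "0 \<in> set (map (\<lambda>v. 0 :: 'g) vs)" using True k by (cases vs) auto
  ultimately have 0: "pullback base_proj f 0 (map (\<lambda>v. 0) vs) = 0"
    using alternating_form_zero_vector form_on_alternating[OF form_on_pullback_base_proj[OF f]] by blast
  have "exd (primitive f) z vs = exd (homotopy_op base_proj f) z vs
      + exd (homotopy_op (\<lambda>z. 0) (pullback base_proj f)) z vs"
    using exd_add[OF z h1.form_on_homotopy_op h2.form_on_homotopy_op] by (simp add: primitive_def[abs_def])
  also have "exd (homotopy_op base_proj f) z vs = f z vs - f (base_proj z) (map base_proj vs)"
    using h1.homotopy_formula[OF closed z True] by simp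
  also have "exd (homotopy_op (\<lambda>z. 0) (pullback base_proj f)) z vs = pullback base_proj f z vs"
    using h2.homotopy_formula[OF closed2 z True] 0 by simp
  finally show ?thesis by (simp add: pullback_base_proj)
qed

text \<open>
  For the first summand this is \<open>homotopy_op_base_proj_null\<close>. The second one is built from a form
  pulled back by \<open>base_proj\<close>, which kills every single vertical vector; so \<open>m > 0\<close> is enough.
\<close>

lemma vertically_null_primitive:
  assumes f: "form_on k T f" and null: "vertically_null (Suc m) f" and m: "m > 0"
  shows "vertically_null m (primitive f)"
  unfolding vertically_null_def
proof (intro ballI allI impI)
  fix z us and vs :: "'g list" assume z: "z \<in> T" and us: "length us = m" "\<forall>u\<in>set us. \<pi> u = 0"
  have "homotopy_op (\<lambda>z. 0) (pullback base_proj f) z (us @ vs) = 0"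
  proof (rule homotopy_op_eq_0)
    fix t :: real assume t: "0 \<le> t" "t \<le> 1"
    obtain u where u: "u \<in> set us" "\<pi> u = 0" using us m by (cases us) auto
    then have "base_proj (contraction (\<lambda>z. 0) t u) = 0"
      by (simp add: contraction_def linear_scale[OF linear_\<pi>] linear_0[OF linear_\<sigma>])
    then have "0 \<in> set (map base_proj ((z - 0) # map (contraction (\<lambda>z. 0) t) (us @ vs)))"
      using u(1) by force
    then show "pullback base_proj f (contraction (\<lambda>z. 0) t z)
        ((z - 0) # map (contraction (\<lambda>z. 0) t) (us @ vs)) = 0"
      unfolding pullback_base_proj
      using alternating_form_zero_vector form_on_alternating[OF f base_proj_in[OF point_contraction[OF t z]]]
      by blast
  qed
  then show "primitive f z (us @ vs) = 0"
    using homotopy_op_base_proj_null[OF null z us] by (simp add: primitive_def)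
qed

lemma closed_affine_form_exact:
  assumes \<omega>: "\<omega> \<in> Lambda_forms A B \<alpha> l k UNIV" and l: "l < k" and a: "a \<in> A" "W \<subseteq> fst a"
    and closed: "form_eq_on A UNIV (ext_deriv \<omega>) zero_form"
  shows "\<exists>\<theta>\<in>Lambda_forms A B \<alpha> l (k - 1) W. form_eq_on A W \<omega> (ext_deriv \<theta>)"
proof
  define f where "f = pullback (\<lambda>z. snd a (\<xi> z)) (\<omega> a)"
  have \<omega>': "\<omega> \<in> diff_forms A k UNIV" using \<omega> by (simp add: Lambda_forms_def)
  note f = diff_form_in_coordinates[OF \<omega>' a, folded f_def]
  have null: "vertically_null (Suc (k - l)) f"
    using Lambda_forms_vertically_null[OF \<omega> less_imp_le[OF l] a] by (simp add: f_def)
  have \<theta>: "form_on (k - 1) T (primitive f)" by (rule form_on_primitive[OF f(1)])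
  have "vertically_null (k - l) (primitive f)"
    by (rule vertically_null_primitive[OF f(1) null]) (use l in simp)
  then show "manifold_pullback \<phi> (primitive f) \<in> Lambda_forms A B \<alpha> l (k - 1) W"
    by (intro vertically_null_Lambda_forms[OF \<theta>]) (use l in \<open>auto simp: Suc_diff_Suc\<close>)
  show "form_eq_on A W \<omega> (ext_deriv (manifold_pullback \<phi> (primitive f)))"
    unfolding form_eq_on_def
  proof (intro ballI ext)
    fix c x vs assume c: "c \<in> A" and x: "x \<in> chart_img c W"
    then have "\<phi> (chart_inv c x) \<in> T" using maps chart_img_iff[OF atlas c] by auto
    then have "manifold_pullback \<phi> f c x vs = manifold_pullback \<phi> (exd (primitive f)) c x vs"
      using exd_primitive[OF f(1) _ f(3)[OF closed]] l by (simp add: manifold_pullback_def pullback_def)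
    then show "\<omega> c x vs = ext_deriv (manifold_pullback \<phi> (primitive f)) c x vs"
      using f(2)[OF c x] ext_deriv_manifold_pullback[OF \<theta> c x] by simp
  qed
qed

text \<open>
  With \<open>\<kappa>\<close> the coordinates of the base followed by \<open>\<sigma>\<close>, the map \<open>\<kappa> \<circ> \<alpha>\<close> is \<open>base_proj\<close> in the adapted
  coordinates. Hence the pullback of \<open>f\<close> along \<open>\<kappa>\<close> is a form on the base whose pullback along \<open>\<alpha>\<close> is
  \<open>f\<close> pulled back by \<open>base_proj\<close>, that is \<open>f\<close> itself.
\<close>

lemma closed_horizontal_form_pullback:
  assumes \<omega>: "\<omega> \<in> Lambda_forms A B \<alpha> k k UNIV" and a: "a \<in> A" "W \<subseteq> fst a"
    and closed: "form_eq_on A UNIV (ext_deriv \<omega>) zero_form"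
  shows "\<exists>V \<eta>. open V \<and> \<alpha> ` W \<subseteq> V \<and> \<eta> \<in> diff_forms B k V
    \<and> form_eq_on A W \<omega> (form_pullback B \<alpha> \<eta>)"
proof -
  define f where "f = pullback (\<lambda>z. snd a (\<xi> z)) (\<omega> a)"
  have \<omega>': "\<omega> \<in> diff_forms A k UNIV" using \<omega> by (simp add: Lambda_forms_def)
  note f = diff_form_in_coordinates[OF \<omega>' a, folded f_def]
  have null: "vertically_null 1 f"
    using Lambda_forms_vertically_null[OF \<omega> order_refl a] by (simp add: f_def)
  have bl: "bounded_linear \<sigma>" using linear_\<sigma> by (simp add: linear_conv_bounded_linear)
  define \<kappa> where "\<kappa> y = \<sigma> (snd b y - y0)" for y
  define V where "V = fst b \<inter> \<kappa> -` T"
  have "continuous_on (fst b) \<kappa>"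
    unfolding \<kappa>_def
    by (intro bounded_linear.continuous_on[OF bl] continuous_intros
        homeomorphism_cont1[OF smooth_atlas_chart(2)[OF base_atlas b]])
  then have openV: "open V"
    unfolding V_def by (rule continuous_open_preimage[OF _ smooth_atlas_chart(1)[OF base_atlas b] openT])
  have \<kappa>\<alpha>: "\<kappa> (\<alpha> p) = base_proj (\<phi> p)" if "p \<in> W" for p
    using \<alpha>_linear[OF maps[OF that]] inv_left[OF that] by (simp add: \<kappa>_def)
  have \<alpha>V: "\<alpha> p \<in> V" if "p \<in> W" for p
    using \<alpha>_b[OF that] \<kappa>\<alpha>[OF that] base_proj_in[OF maps[OF that]] by (simp add: V_def)
  interpret base: smooth_vector_map B V T \<kappa>
  proof
    show "smooth_on (chart_img d V) (\<lambda>y. \<kappa> (chart_inv d y))" if d: "d \<in> B" for d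
    proof -
      let ?N = "chart_img d (fst b)"
      have o: "open ?N" by (rule open_chart_img[OF base_atlas d smooth_atlas_chart(1)[OF base_atlas b]])
      have "smooth_on ?N (\<lambda>y. \<sigma> (coord_rep d b id y + - y0))"
        by (intro smooth_on_bounded_linear[OF o bl] smooth_on_add[OF o] smooth_on_const[OF o]
            smooth_atlas_transition[OF base_atlas d b])
      then have "smooth_on ?N (\<lambda>y. \<kappa> (chart_inv d y))" by (simp add: \<kappa>_def coord_rep_def)
      then show ?thesis by (rule smooth_on_subset) (auto simp: chart_img_def V_def)
    qed
  qed (use base_atlas openV openT in \<open>auto simp: V_def\<close>)
  have "form_eq_on A W \<omega> (form_pullback B \<alpha> (manifold_pullback \<kappa> f))"
    unfolding form_eq_on_def
  proof (intro ballI ext)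
    fix c x vs assume c: "c \<in> A" and x: "x \<in> chart_img c W"
    define p where "p = chart_inv c x"
    have p: "p \<in> fst c" "p \<in> W" "snd c p = x" using x chart_img_iff[OF atlas c] by (auto simp: p_def)
    define d where "d = (SOME d. d \<in> B \<and> \<alpha> p \<in> fst d)"
    have "\<exists>d. d \<in> B \<and> \<alpha> p \<in> fst d" using b \<alpha>_b[OF p(2)] by blast
    then have d: "d \<in> B" "\<alpha> p \<in> fst d" unfolding d_def by (rule someI2_ex, blast)+
    let ?N = "chart_img c (W \<inter> \<alpha> -` fst d)"
    have cont\<alpha>: "continuous_on UNIV \<alpha>" using \<alpha>_smooth by (simp add: smooth_map_on_def)
    have "open (W \<inter> \<alpha> -` fst d)"
      by (intro open_Int openW open_vimage[OF smooth_atlas_chart(1)[OF base_atlas d(1)] cont\<alpha>])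
    then have N: "open ?N" "x \<in> ?N"
      using open_chart_img[OF atlas c] p d(2) chart_img_iff[OF atlas c] by (auto simp: p_def[symmetric])
    have rep: "coord_rep c d \<alpha> x = snd d (\<alpha> p)" by (simp add: coord_rep_def p_def)
    have 1: "(coord_rep c d \<alpha> has_derivative coord_deriv c d \<alpha> x) (at x)"
      by (rule smooth_on_has_derivative[OF smooth_map_on_coord_rep[OF \<alpha>_smooth c d(1)]])
        (use N(2) in \<open>auto simp: chart_img_def\<close>)
    have 2: "((\<lambda>y. \<kappa> (chart_inv d y)) has_derivative
        frechet_derivative (\<lambda>y. \<kappa> (chart_inv d y)) (at (coord_rep c d \<alpha> x))) (at (coord_rep c d \<alpha> x))"
      unfolding rep
      by (rule smooth_on_has_derivative[OF base.smooth[OF d(1)]], rule chart_in_chart_img[OF d(2) \<alpha>V[OF p(2)]])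
    have "form_pullback B \<alpha> (manifold_pullback \<kappa> f) c x vs
        = pullback (coord_rep c d \<alpha>) (pullback (\<lambda>y. \<kappa> (chart_inv d y)) f) x vs"
      by (simp add: form_pullback_def Let_def p_def[symmetric] d_def[symmetric] manifold_pullback_def
          pullback_def[of "coord_rep c d \<alpha>"] rep)
    also have "\<dots> = pullback (\<lambda>y. \<kappa> (chart_inv d (coord_rep c d \<alpha> y))) f x vs"
      by (simp only: pullback_compose[OF 1 2])
    also have "\<dots> = pullback (\<lambda>y. base_proj (\<phi> (chart_inv c y))) f x vs"
    proof (rule fun_cong[of _ _ vs], rule pullback_cong_open[OF N])
      fix y assume "y \<in> ?N"
      then have "chart_inv c y \<in> W" "\<alpha> (chart_inv c y) \<in> fst d"
        using chart_img_iff[OF atlas c] by auto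
      then show "\<kappa> (chart_inv d (coord_rep c d \<alpha> y)) = base_proj (\<phi> (chart_inv c y))"
        by (simp add: coord_rep_def chart_inv_chart[OF base_atlas d(1)] \<kappa>\<alpha>)
    qed
    also have "\<dots> = pullback (\<lambda>y. \<phi> (chart_inv c y)) (pullback base_proj f) x vs"
      by (simp only: pullback_compose[OF smooth_on_has_derivative[OF smooth[OF c] x] base_proj_has_derivative])
    also have "\<dots> = pullback (\<lambda>y. \<phi> (chart_inv c y)) f x vs"
      using closed_horizontal_eq_pullback[OF f(1) f(3)[OF closed] null maps[OF p(2)]] by (simp add: pullback_def p_def)
    also have "\<dots> = \<omega> c x vs" using f(2)[OF c x] by (simp add: manifold_pullback_def)
    finally show "\<omega> c x vs = form_pullback B \<alpha> (manifold_pullback \<kappa> f) c x vs" by simp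
  qed
  then show ?thesis using openV \<alpha>V base.manifold_pullback_diff_forms[OF f(1)] by blast
qed

end

theorem corollary4p6:
  fixes A :: "('p::{t2_space,second_countable_topology}, 'g::euclidean_space) chart set"
    and B :: "('m::{t2_space,second_countable_topology}, 'e::euclidean_space) chart set"
    and C :: "('f::{t2_space,second_countable_topology}, 'h::real_inner) chart set"
    and \<alpha> :: "'p \<Rightarrow> 'm"
    and n q :: nat
    and \<omega> :: "('p, 'g) form"
  assumes fib: "fiber_bundle A B C \<alpha>"
    and dim: "n = DIM('e)"
    and omega: "\<omega> \<in> affine_forms A B \<alpha> n q UNIV"
    and closed: "form_eq_on A UNIV (ext_deriv \<omega>) zero_form"
  shows "(q = 0 \<longrightarrow>
           (\<forall>p. \<exists>W V \<eta>. open W \<and> p \<in> W \<and> open V \<and> \<alpha> ` W \<subseteq> V \<and>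
              \<eta> \<in> diff_forms B (n - 1) V \<and>
              form_eq_on A W \<omega> (form_pullback B \<alpha> \<eta>))) \<and>
         (q > 0 \<longrightarrow>
           (\<forall>p. \<exists>W \<theta>. open W \<and> p \<in> W \<and>
              \<theta> \<in> affine_forms A B \<alpha> n (q - 1) W \<and>
              form_eq_on A W \<omega> (ext_deriv \<theta>)))"
proof -
  have n: "n > 0" using dim by simp
  have local: "(q = 0 \<longrightarrow> (\<exists>W V \<eta>. open W \<and> p \<in> W \<and> open V \<and> \<alpha> ` W \<subseteq> V \<and>
        \<eta> \<in> diff_forms B (n - 1) V \<and> form_eq_on A W \<omega> (form_pullback B \<alpha> \<eta>)))
    \<and> (q > 0 \<longrightarrow> (\<exists>W \<theta>. open W \<and> p \<in> W \<and> \<theta> \<in> affine_forms A B \<alpha> n (q - 1) W \<and>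
        form_eq_on A W \<omega> (ext_deriv \<theta>)))" for p
  proof -
    have "smooth_atlas A" using fib by (simp add: fiber_bundle_def)
    then obtain a where a: "a \<in> A" "p \<in> fst a" using smooth_atlas_covers by blast
    from adapted_coordinates_exist[OF fib a] obtain W T \<phi> \<xi> b y0 \<pi> \<sigma>
      where ac: "adapted_coordinates A W T \<phi> \<xi> B \<alpha> b y0 \<pi> \<sigma>" and W: "p \<in> W" "W \<subseteq> fst a" .
    interpret adapted_coordinates A W T \<phi> \<xi> B \<alpha> b y0 \<pi> \<sigma> by (rule ac)
    have \<omega>: "\<omega> \<in> Lambda_forms A B \<alpha> (n - 1) (q + n - 1) UNIV"
      using omega by (simp add: affine_forms_def)
    show ?thesis
    proof (cases "q = 0")
      case True
      with \<omega> have "\<omega> \<in> Lambda_forms A B \<alpha> (n - 1) (n - 1) UNIV" by simp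
      from closed_horizontal_form_pullback[OF this a(1) W(2) closed] True openW W(1)
      show ?thesis by blast
    next
      case False
      \<comment> \<open>The degrees are truncated differences; they are the intended numbers since \<open>n > 0\<close>.\<close>
      then have "n - 1 < q + n - 1" and e: "q + n - 1 - 1 = q - 1 + n - 1" using n by auto
      from closed_affine_form_exact[OF \<omega> this(1) a(1) W(2) closed] False openW W(1)
      show ?thesis unfolding affine_forms_def e by blast
    qed
  qed
  then show ?thesis by blast
qed

end
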